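(* Let $M$ be a connected orientable hypersurface of $\mathbb{H}^2\times\mathbb{H}^2$ with unit normal field $N$ such that $M$ has constant principal curvatures and constant product angle function $C=\langle PN,N\rangle$. Then, up to an isometry of $\mathbb{H}^2\times\mathbb{H}^2$, one of the following four cases occurs: (1) $M$ is an open part of $M_\Gamma$, where $\Gamma$ is a curve of $\mathbb{H}^2$ with constant curvature; or (2) $M$ is an open part of $M^c_{1,-1}$ for some $c\in(0,1)$; or (3) $M$ is an open part of $M^c_{1,1}$ for some $c\in(0,1)$; or (4) $M$ is an open part of $M_\tau$ for some $\tau<-1$.
   Context: $\mathbb{R}^3_1$ denotes $\mathbb{R}^3$ with the Lorentzian inner product $\langle x,y\rangle=-x_1y_1+x_2y_2+x_3y_3$, and $\mathbb{H}^2=\{x\in\mathbb{R}^3_1:\langle x,x\rangle=-1,\ x_1>0\}$ is the hyperbolic plane of curvature $-1$. $\mathbb{H}^2\times\mathbb{H}^2\subset\mathbb{R}^3_1\times\mathbb{R}^3_1$ carries the Riemannian product metric, denoted $\langle\cdot,\cdot\rangle$. The product structure is $P(v_1,v_2)=(v_1,-v_2)$ for tangent vectors $v_1,v_2$ of $\mathbb{H}^2$. For a hypersurface with unit normal $N$, $C=\langle PN,N\rangle$ is the product angle function. "Constant principal curvatures" means the eigenvalues of the shape operator are constant on $M$. Examples: for a smooth curve $\Gamma\subset\mathbb{H}^2$, $M_\Gamma=\{(x,y)\in\mathbb{H}^2\times\mathbb{H}^2: x\in\Gamma,\ y\in\mathbb{H}^2\}$. For $0<c<1$, put $\gamma(r)=(\tfrac{2+r^2}{2},r,\tfrac{r^2}{2})$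 (a horocycle parametrized by arc length) and $N(r)=(-\tfrac{r^2}{2},-r,\tfrac{2-r^2}{2})$; $M^c_{1,-1}$ is the image of $(t,r,s)\mapsto\big(\cosh(\sqrt c\,t)\gamma(r)+\sinh(\sqrt c\,t)N(r),\ \cosh(\sqrt{1-c}\,t)\gamma(s)+\sinh(\sqrt{1-c}\,t)\tilde N(s)\big)$ with $\tilde N(s)=(\tfrac{s^2}{2},s,\tfrac{s^2-2}{2})$, and $M^c_{1,1}$ is the image of the same map with $\tilde N(s)=(-\tfrac{s^2}{2},-s,\tfrac{2-s^2}{2})$. For $\tau<-1$, $M_\tau=\{(p,q)\in\mathbb{H}^2\times\mathbb{H}^2:\langle p,q\rangle=\tau\}$, where $\langle p,q\rangle$ is the Lorentzian inner product of $\mathbb{R}^3_1$. *)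

theory Defs
  imports "HOL-Analysis.Analysis"
begin

type_synonym pt = "(real^3) \<times> (real^3)"

definition lor :: "real^3 \<Rightarrow> real^3 \<Rightarrow> real" where
  "lor x y = - (x$1 * y$1) + x$2 * y$2 + x$3 * y$3"

definition H2 :: "(real^3) set" where
  "H2 = {x. lor x x = -1 \<and> x$1 > 0}"

definition pmetric :: "pt \<Rightarrow> pt \<Rightarrow> real" where
  "pmetric v w = lor (fst v) (fst w) + lor (snd v) (snd w)"

definition Pstr :: "pt \<Rightarrow> pt" where
  "Pstr v = (fst v, - snd v)"

fun ddl :: "'a::euclidean_space list \<Rightarrow> ('a \<Rightarrow> 'b::real_normed_vector) \<Rightarrow> 'a \<Rightarrow> 'b" where
  "ddl [] f = f"
| "ddl (v # vs) f = (\<lambda>x. frechet_derivative (ddl vs f) (at x) v)"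

definition smooth_on :: "'a::euclidean_space set \<Rightarrow> ('a \<Rightarrow> 'b::real_normed_vector) \<Rightarrow> bool" where
  "smooth_on U f \<longleftrightarrow> (\<forall>vs. \<forall>x\<in>U. ddl vs f differentiable (at x))"

definition chart :: "pt set \<Rightarrow> (real^3) set \<Rightarrow> (real^3 \<Rightarrow> pt) \<Rightarrow> bool" where
  "chart M U \<phi> \<longleftrightarrow> open U \<and> smooth_on U \<phi> \<and> \<phi> ` U \<subseteq> M \<and> openin (top_of_set M) (\<phi> ` U)
     \<and> inj_on \<phi> U \<and> continuous_on (\<phi> ` U) (inv_into U \<phi>)
     \<and> (\<forall>u\<in>U. inj (frechet_derivative \<phi> (at u)))"

definition hypersurface :: "pt set \<Rightarrow> bool" where
  "hypersurface M \<longleftrightarrow> M \<subseteq> H2 \<times> H2 \<and> (\<forall>p\<in>M. \<exists>U \<phi>. chart M U \<phi> \<and> p \<in> \<phi> ` U)"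

definition tangent_space :: "pt set \<Rightarrow> pt \<Rightarrow> pt set" where
  "tangent_space M p = \<Union>{range (frechet_derivative \<phi> (at u)) | U \<phi> u. chart M U \<phi> \<and> u \<in> U \<and> \<phi> u = p}"

definition unit_normal :: "pt set \<Rightarrow> (pt \<Rightarrow> pt) \<Rightarrow> bool" where
  "unit_normal M N \<longleftrightarrow> (\<forall>U \<phi>. chart M U \<phi> \<longrightarrow> smooth_on U (N \<circ> \<phi>))
     \<and> (\<forall>p\<in>M. lor (fst p) (fst (N p)) = 0 \<and> lor (snd p) (snd (N p)) = 0
              \<and> pmetric (N p) (N p) = 1 \<and> (\<forall>X\<in>tangent_space M p. pmetric (N p) X = 0))"

text \<open>e is a principal direction at p with principal curvature k, i.e. A e = k e where
  A X = -(D_X N)^T (tangential part w.r.t. T_pM; the Levi-Civita connection of H2 x H2 is the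
  tangential part of the flat derivative, so this is the shape operator).\<close>
definition principal_dir :: "pt set \<Rightarrow> (pt \<Rightarrow> pt) \<Rightarrow> pt \<Rightarrow> real \<Rightarrow> pt \<Rightarrow> bool" where
  "principal_dir M N p k e \<longleftrightarrow> e \<in> tangent_space M p \<and>
     (\<forall>U \<phi> u v. chart M U \<phi> \<and> u \<in> U \<and> \<phi> u = p \<and> frechet_derivative \<phi> (at u) v = e \<longrightarrow>
        (\<forall>X\<in>tangent_space M p. pmetric (frechet_derivative (N \<circ> \<phi>) (at u) v + k *\<^sub>R e) X = 0))"

definition const_principal_curvatures :: "pt set \<Rightarrow> (pt \<Rightarrow> pt) \<Rightarrow> bool" where
  "const_principal_curvatures M N \<longleftrightarrow> (\<exists>k1 k2 k3. \<forall>p\<in>M. \<exists>e1 e2 e3.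
     pmetric e1 e1 = 1 \<and> pmetric e2 e2 = 1 \<and> pmetric e3 e3 = 1 \<and>
     pmetric e1 e2 = 0 \<and> pmetric e1 e3 = 0 \<and> pmetric e2 e3 = 0 \<and>
     principal_dir M N p k1 e1 \<and> principal_dir M N p k2 e2 \<and> principal_dir M N p k3 e3)"

definition hdist :: "real^3 \<Rightarrow> real^3 \<Rightarrow> real" where
  "hdist x y = arcosh (- lor x y)"

definition pdist :: "pt \<Rightarrow> pt \<Rightarrow> real" where
  "pdist p q = sqrt ((hdist (fst p) (fst q))\<^sup>2 + (hdist (snd p) (snd q))\<^sup>2)"

definition isometry :: "(pt \<Rightarrow> pt) \<Rightarrow> bool" where
  "isometry f \<longleftrightarrow> bij_betw f (H2 \<times> H2) (H2 \<times> H2) \<and>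
     (\<forall>p\<in>H2 \<times> H2. \<forall>q\<in>H2 \<times> H2. pdist (f p) (f q) = pdist p q)"

definition open_part :: "pt set \<Rightarrow> pt set \<Rightarrow> bool" where
  "open_part M X \<longleftrightarrow> M \<subseteq> X \<and> openin (top_of_set X) M"

text \<open>Curves of H2 with constant (geodesic) curvature: images of smooth unit-speed curves
  on an open interval; the covariant acceleration is gamma'' - gamma.\<close>
definition const_curv_curve :: "(real^3) set \<Rightarrow> bool" where
  "const_curv_curve G \<longleftrightarrow> (\<exists>(\<gamma>::real \<Rightarrow> real^3) (I::real set) \<kappa>::real. open I \<and> is_interval I \<and> I \<noteq> {} \<and> smooth_on I \<gamma> \<and>
     G = \<gamma> ` I \<and>
     (\<forall>t\<in>I. \<gamma> t \<in> H2 \<and> lor (ddl [1] \<gamma> t) (ddl [1] \<gamma> t) = 1 \<and>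
        lor (ddl [1,1] \<gamma> t - \<gamma> t) (ddl [1,1] \<gamma> t - \<gamma> t) = \<kappa>\<^sup>2))"

definition M_Gamma :: "(real^3) set \<Rightarrow> pt set" where
  "M_Gamma G = {(x, y). x \<in> G \<and> y \<in> H2}"

definition hgam :: "real \<Rightarrow> real^3" where
  "hgam r = vector [(2 + r\<^sup>2) / 2, r, r\<^sup>2 / 2]"

definition hN :: "real \<Rightarrow> real^3" where
  "hN r = vector [- (r\<^sup>2 / 2), - r, (2 - r\<^sup>2) / 2]"

definition hNt :: "real \<Rightarrow> real^3" where
  "hNt s = vector [s\<^sup>2 / 2, s, (s\<^sup>2 - 2) / 2]"

definition M_c_1m1 :: "real \<Rightarrow> pt set" where
  "M_c_1m1 c = {(cosh (sqrt c * t) *\<^sub>R hgam r + sinh (sqrt c * t) *\<^sub>R hN r,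
                 cosh (sqrt (1 - c) * t) *\<^sub>R hgam s + sinh (sqrt (1 - c) * t) *\<^sub>R hNt s) | t r s. True}"

definition M_c_11 :: "real \<Rightarrow> pt set" where
  "M_c_11 c = {(cosh (sqrt c * t) *\<^sub>R hgam r + sinh (sqrt c * t) *\<^sub>R hN r,
                cosh (sqrt (1 - c) * t) *\<^sub>R hgam s + sinh (sqrt (1 - c) * t) *\<^sub>R hN s) | t r s. True}"

definition M_tau :: "real \<Rightarrow> pt set" where
  "M_tau \<tau> = {(p, q). p \<in> H2 \<and> q \<in> H2 \<and> lor p q = \<tau>}"

end

theory Submission
  imports Defs
begin

text \<open>Write \<open>N = (b n\<^sub>1, a n\<^sub>2)\<close> with unit vectors \<open>n\<^sub>i\<close> tangent to the factors and let \<open>t\<^sub>i\<close> complete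
  them to moving frames. If \<open>a = 0\<close> or \<open>b = 0\<close>, then \<open>M\<close> is a product and the vector \<open>\<alpha> p - n\<close>
  is constant, where \<open>\<alpha>\<close> is minus the trace of the shape operator; this places \<open>p\<close> on a plane section
  of the hyperboloid, a curve of constant curvature.

  Otherwise \<open>(a n\<^sub>1, - b n\<^sub>2)\<close> is a principal direction of curvature \<open>0\<close>, and on its complement the shape
  operator is given by three functions \<open>\<alpha>, \<mu>, \<delta>\<close> through \<open>\<omega>\<^sub>1 = \<alpha> \<theta>\<^sub>1 + a \<mu> \<theta>\<^sub>2\<close> and
  \<open>\<omega>\<^sub>2 = b \<mu> \<theta>\<^sub>1 + \<delta> \<theta>\<^sub>2\<close>. The structure equations of the hyperbolic plane give a Riccati system along that
  direction; combined with constancy of trace and determinant it leaves only \<open>\<mu> = 0, \<alpha>\<^sup>2 = \<delta>\<^sup>2 = 1\<close>, or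
  \<open>a = b, \<alpha> = \<delta>, \<alpha>\<^sup>2 = 1 + \<mu>\<^sup>2 / 2\<close>, both with constant coefficients. In the first case the null
  directions \<open>p - \<alpha> n\<^sub>1\<close> and \<open>q - \<delta> n\<^sub>2\<close> are constant, and \<open>M\<close> is a level set of a combination of two
  Busemann functions. In the second case the Lorentz transformation carrying the frame at \<open>q\<close> to a fixed
  boost of the frame at \<open>p\<close> is constant, so \<open>q\<close> has constant distance to \<open>p\<close> after an isometry.\<close>

section \<open>Lorentzian linear algebra and isometries\<close>

text \<open>The curvature hypothesis provides principal directions point by point, with no
  regularity, so nothing can be differentiated along them. What survives are symmetric functions: in
  a frame adapted to \<open>N\<close> one curvature is \<open>0\<close>, and trace and squared norm
  leave one degree of freedom in the remaining block. Differentiating these constants along the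
  direction of curvature \<open>0\<close> and inserting the Riccati equations gives two relations,
  one of them linear in \<alpha> and \<delta> because the determinant reappears as its coefficient.
  Together with the trace it makes \<alpha> and \<delta> constant unless a 2 by 2 system
  degenerates. The degenerate value is the real obstacle: it shrinks to \<open>a = b\<close> with
  trace \<open>0\<close>, where first-order information no longer suffices and second derivatives
  must be compared. Vanishing derivatives only place \<open>M\<close> inside a model. That it is
  open there is a separate, purely topological matter.\<close>

lemmas vec3_eq_iff = vec_eq_iff[where 'b = 3, unfolded forall_3]

lemma bounded_bilinear_lor: "bounded_bilinear lor"
proof
  show "\<exists>K. \<forall>a b. norm (lor a b) \<le> norm a * norm b * K"
  proof (intro exI allI)
    fix a b :: "real^3"
    have m: "\<bar>a$i * b$i\<bar> \<le> norm a * norm b" for i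
      unfolding abs_mult using component_le_norm_cart[of a i] component_le_norm_cart[of b i]
      by (intro mult_mono) auto
    show "norm (lor a b) \<le> norm a * norm b * 3"
      using m[of 1] m[of 2] m[of 3] unfolding lor_def real_norm_def by arith
  qed
qed (auto simp: lor_def algebra_simps)

interpretation lor: bounded_bilinear lor by (rule bounded_bilinear_lor)

lemmas lor_simps = lor.add_left lor.add_right lor.diff_left lor.diff_right lor.minus_left
  lor.minus_right lor.scaleR_left lor.scaleR_right lor.zero_left lor.zero_right

lemma lor_commute: "lor x y = lor y x"
  by (simp add: lor_def mult.commute)

text \<open>The Euclidean cross product with its first entry negated, so that
  \<open>lor (lcross x y) z\<close> is the determinant of \<open>x, y, z\<close>. Being bilinear, it
  completes a moving frame differentiably and without a choice.\<close>

definition lcross :: "real^3 \<Rightarrow> real^3 \<Rightarrow> real^3" where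
  "lcross x y = vector [x$3 * y$2 - x$2 * y$3, x$3 * y$1 - x$1 * y$3, x$1 * y$2 - x$2 * y$1]"

lemma lcross_nth [simp]:
  "lcross x y $ 1 = x$3 * y$2 - x$2 * y$3"
  "lcross x y $ 2 = x$3 * y$1 - x$1 * y$3"
  "lcross x y $ 3 = x$1 * y$2 - x$2 * y$1"
  by (simp_all add: lcross_def)

lemma bounded_bilinear_lcross: "bounded_bilinear lcross"
proof
  show "\<exists>K. \<forall>a b. norm (lcross a b) \<le> norm a * norm b * K"
  proof (intro exI allI)
    fix a b :: "real^3"
    have m: "\<bar>a$i * b$j\<bar> \<le> norm a * norm b" for i j
      unfolding abs_mult using component_le_norm_cart[of a i] component_le_norm_cart[of b j]
      by (intro mult_mono) auto
    have "\<bar>lcross a b $ 1\<bar> \<le> 2 * (norm a * norm b)" "\<bar>lcross a b $ 2\<bar> \<le> 2 * (norm a * norm b)"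
      "\<bar>lcross a b $ 3\<bar> \<le> 2 * (norm a * norm b)"
      unfolding lcross_nth using m[of 3 2] m[of 2 3] m[of 3 1] m[of 1 3] m[of 1 2] m[of 2 1]
      by arith+
    then show "norm (lcross a b) \<le> norm a * norm b * 6"
      using norm_le_l1_cart[of "lcross a b"] unfolding sum_3 by arith
  qed
qed (auto simp: vec3_eq_iff algebra_simps)

interpretation lcross: bounded_bilinear lcross by (rule bounded_bilinear_lcross)

lemma lor_lcross_orth [simp]:
  "lor x (lcross x y) = 0" "lor y (lcross x y) = 0" "lor (lcross x y) x = 0" "lor (lcross x y) y = 0"
  by (simp_all add: lor_def algebra_simps)

lemma lor_lcross_self: "lor (lcross x y) (lcross x y) = (lor x y)\<^sup>2 - lor x x * lor y y"
  by (simp add: lor_def power2_eq_square algebra_simps)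

section \<open>Lorentz-orthonormal frames and the geometry of the hyperboloid\<close>

definition lframe :: "real^3 \<Rightarrow> real^3 \<Rightarrow> real^3 \<Rightarrow> bool" where
  "lframe p n t \<longleftrightarrow> lor p p = -1 \<and> lor n n = 1 \<and> lor t t = 1 \<and> lor p n = 0 \<and> lor p t = 0 \<and> lor n t = 0"

lemma lframe_lcross:
  assumes "lor p p = -1" "lor n n = 1" "lor p n = 0"
  shows "lframe p n (lcross p n)"
  using assms by (simp add: lframe_def lor_lcross_self)

lemma lframeD:
  assumes "lframe p n t"
  shows "lor p p = -1" "lor n n = 1" "lor t t = 1" "lor p n = 0" "lor p t = 0" "lor n t = 0"
    "lor n p = 0" "lor t p = 0" "lor t n = 0"
  using assms by (auto simp: lframe_def lor_commute)

lemma lframe_expand: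
  assumes "lframe p n t"
  shows "x = - lor x p *\<^sub>R p + lor x n *\<^sub>R n + lor x t *\<^sub>R t"
proof -
  \<comment> \<open>\<open>A\<close> holds the dual functionals of the frame as rows,
    \<open>B\<close> its vectors as columns. Orthonormality is \<open>A ** B = mat 1\<close>;
    completeness is the reversed product.\<close>
  define A :: "real^3^3" where "A = vector [vector [p$1, -p$2, -p$3], vector [-n$1, n$2, n$3], vector [-t$1, t$2, t$3]]"
  define B :: "real^3^3" where "B = vector [vector [p$1, n$1, t$1], vector [p$2, n$2, t$2], vector [p$3, n$3, t$3]]"
  have "A ** B = mat 1"
    using assms unfolding lframe_def lor_def
    by (simp add: vec3_eq_iff matrix_matrix_mult_def mat_def sum_3 A_def B_def algebra_simps)
  then have "B ** A = mat 1"
    by (rule matrix_left_right_inverse1)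
  then have "B *v (A *v x) = x"
    by (simp add: matrix_vector_mul_assoc)
  then show ?thesis
    by (simp add: vec3_eq_iff matrix_vector_mult_def sum_3 A_def B_def lor_def algebra_simps)
qed

lemma lframe_lor:
  assumes "lframe p n t"
  shows "lor x y = - (lor x p * lor y p) + lor x n * lor y n + lor x t * lor y t"
proof -
  have "lor x y = lor x (- lor y p *\<^sub>R p + lor y n *\<^sub>R n + lor y t *\<^sub>R t)"
    using lframe_expand[OF assms, of y] by simp
  then show ?thesis by (simp add: lor_simps mult.commute)
qed

lemma lor_nondegenerate:
  assumes "\<And>z. lor x z = 0" shows "x = 0"
  using assms[of "axis 1 1"] assms[of "axis 2 1"] assms[of "axis 3 1"]
  by (simp add: lor_def axis_def vec3_eq_iff)

text \<open>Multiplying by \<open>(p$1)\<^sup>2\<close> lets tangency eliminate \<open>x$1\<close>;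
  a sum of three squares remains.\<close>

lemma H2_tangent_spacelike:
  assumes "p \<in> H2" "lor p x = 0"
  shows "lor x x \<ge> 0" "lor x x = 0 \<Longrightarrow> x = 0"
proof -
  have p: "p$1 * p$1 = 1 + p$2 * p$2 + p$3 * p$3" "p$1 > 0" and
    e: "p$1 * x$1 = p$2 * x$2 + p$3 * x$3"
    using assms by (auto simp: H2_def lor_def)
  have "(p$1)\<^sup>2 * lor x x = - (p$1 * x$1)\<^sup>2 + p$1 * p$1 * ((x$2)\<^sup>2 + (x$3)\<^sup>2)"
    by (simp add: lor_def power2_eq_square algebra_simps)
  also have "\<dots> = (x$2)\<^sup>2 + (x$3)\<^sup>2 + (p$2 * x$3 - p$3 * x$2)\<^sup>2"
    unfolding e p(1) by (simp add: power2_eq_square algebra_simps)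
  finally have *: "(p$1)\<^sup>2 * lor x x = (x$2)\<^sup>2 + (x$3)\<^sup>2 + (p$2 * x$3 - p$3 * x$2)\<^sup>2" .
  have "(p$1)\<^sup>2 * lor x x \<ge> 0" unfolding * by simp
  then show "lor x x \<ge> 0" using p(2) by (simp add: zero_le_mult_iff)
  assume "lor x x = 0"
  then have "(x$2)\<^sup>2 + (x$3)\<^sup>2 + (p$2 * x$3 - p$3 * x$2)\<^sup>2 = 0" using * by simp
  then have "x$2 = 0 \<and> x$3 = 0" by (smt (verit) zero_le_power2 power_eq_0_iff)
  then show "x = 0" using e p(2) by (simp add: vec3_eq_iff)
qed

lemma H2D: "p \<in> H2 \<Longrightarrow> lor p p = -1"
  by (simp add: H2_def)

text \<open>Reversed Cauchy-Schwarz: the Euclidean inequality bounds the spatial part, and the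
  spatial part of \<open>p\<close> is strictly shorter than \<open>p$1\<close>. Allowing
  \<open>lor y y = 0\<close> covers null vectors as well as points.\<close>

lemma lor_future_neg:
  assumes "p \<in> H2" "lor y y \<le> 0" "y$1 > 0"
  shows "lor y p < 0"
proof -
  have p: "p$1 * p$1 = 1 + p$2 * p$2 + p$3 * p$3" "p$1 > 0"
    using assms by (auto simp: H2_def lor_def)
  have "(p$2 * y$2 + p$3 * y$3)\<^sup>2 \<le> (p$2 * p$2 + p$3 * p$3) * (y$2 * y$2 + y$3 * y$3)"
    using zero_le_power2[of "p$2 * y$3 - p$3 * y$2"] by (simp add: power2_eq_square algebra_simps)
  also have "\<dots> \<le> (p$2 * p$2 + p$3 * p$3) * (y$1 * y$1)"
    using assms(2) by (intro mult_left_mono) (auto simp: lor_def)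
  also have "\<dots> < (p$1 * p$1) * (y$1 * y$1)"
    unfolding p(1) using assms(3) by (intro mult_strict_right_mono) auto
  finally have "(p$2 * y$2 + p$3 * y$3)\<^sup>2 < (p$1 * y$1)\<^sup>2"
    by (simp add: power2_eq_square algebra_simps)
  then have "p$2 * y$2 + p$3 * y$3 < p$1 * y$1"
    using p(2) assms(3) by (meson less_eq_real_def mult_pos_pos power_less_imp_less_base)
  then show ?thesis by (simp add: lor_def mult.commute)
qed

lemma H2_lor_neg: "p \<in> H2 \<Longrightarrow> q \<in> H2 \<Longrightarrow> lor p q < 0"
  using lor_future_neg[of q p] by (simp add: H2_def)

lemma H2_I:
  assumes "p \<in> H2" "lor y y = -1" "lor y p < 0"
  shows "y \<in> H2"
proof -
  have "y$1 > 0"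
  proof (rule ccontr)
    assume c: "\<not> y$1 > 0"
    have "y$1 \<noteq> 0"
    proof
      assume "y$1 = 0"
      then have "y$2 * y$2 + y$3 * y$3 = -1" using assms(2) by (simp add: lor_def)
      then show False using zero_le_square[of "y$2"] zero_le_square[of "y$3"] by linarith
    qed
    then have "lor (- y) p < 0"
      using c assms by (intro lor_future_neg) (auto simp: lor_simps)
    then show False using assms(3) by (simp add: lor_simps)
  qed
  then show ?thesis using assms(2) by (simp add: H2_def)
qed

lemma ex_unit_tangent:
  assumes "p \<in> H2"
  obtains n where "lor p n = 0" "lor n n = 1"
proof -
  have "p$1 * p$1 = 1 + p$2 * p$2 + p$3 * p$3"
    using assms by (auto simp: H2_def lor_def)
  then have pos: "p$1 * p$1 - p$3 * p$3 > 0"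
    using zero_le_square[of "p$2"] by linarith
  define r where "r = sqrt (p$1 * p$1 - p$3 * p$3)"
  have r: "r > 0" "r * r = p$1 * p$1 - p$3 * p$3" using pos by (auto simp: r_def)
  define n :: "real^3" where "n = vector [p$3 / r, 0, p$1 / r]"
  have "lor p n = 0" "lor n n = 1"
    using r pos by (auto simp: n_def lor_def field_simps)
  then show thesis by (rule that)
qed

text \<open>The Lorentz transformation taking one frame to another, written through the frame
  vectors so that it can be differentiated when the frames move, as in
  \<open>equidistant_case\<close>.\<close>

definition frame_map :: "real^3 \<Rightarrow> real^3 \<Rightarrow> real^3 \<Rightarrow> real^3 \<Rightarrow> real^3 \<Rightarrow> real^3 \<Rightarrow> real^3 \<Rightarrow> real^3" where
  "frame_map p n t p' n' t' x = - lor x p *\<^sub>R p' + lor x n *\<^sub>R n' + lor x t *\<^sub>R t'"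

lemma frame_map_lor:
  assumes "lframe p n t" "lframe p' n' t'"
  shows "lor (frame_map p n t p' n' t' x) (frame_map p n t p' n' t' y) = lor x y"
  unfolding frame_map_def lframe_lor[OF assms(1), of x y]
  using lframeD[OF assms(2)] by (simp add: lor_simps)

lemma frame_map_inverse:
  assumes "lframe p n t" "lframe p' n' t'"
  shows "frame_map p' n' t' p n t (frame_map p n t p' n' t' x) = x"
proof -
  have "frame_map p' n' t' p n t (frame_map p n t p' n' t' x) = - lor x p *\<^sub>R p + lor x n *\<^sub>R n + lor x t *\<^sub>R t"
    unfolding frame_map_def using lframeD[OF assms(2)] by (simp add: lor_simps)
  then show ?thesis using lframe_expand[OF assms(1), of x] by simp
qed

lemma frame_map_H2:
  assumes "lframe p n t" "lframe p' n' t'" "p \<in> H2" "p' \<in> H2" "x \<in> H2"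
  shows "frame_map p n t p' n' t' x \<in> H2"
proof (rule H2_I[OF \<open>p' \<in> H2\<close>])
  show "lor (frame_map p n t p' n' t' x) (frame_map p n t p' n' t' x) = - 1"
    using frame_map_lor[OF assms(1,2)] H2D[OF assms(5)] by simp
  have "lor (frame_map p n t p' n' t' x) p' = lor x p"
    using lframeD[OF assms(2)] by (simp add: frame_map_def lor_simps)
  then show "lor (frame_map p n t p' n' t' x) p' < 0"
    using H2_lor_neg[OF assms(5,3)] by simp
qed

lemma bij_betw_frame_map_H2:
  assumes "lframe p n t" "lframe p' n' t'" "p \<in> H2" "p' \<in> H2"
  shows "bij_betw (frame_map p n t p' n' t') H2 H2"
  by (rule bij_betw_byWitness[where f' = "frame_map p' n' t' p n t"])
    (use assms frame_map_inverse frame_map_H2 in auto)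

section \<open>Isometries of the product\<close>

lemma isometry_map_prod:
  assumes "bij_betw f H2 H2" "bij_betw g H2 H2"
    and "\<And>x y. lor (f x) (f y) = lor x y" "\<And>x y. lor (g x) (g y) = lor x y"
  shows "isometry (map_prod f g)"
  using assms unfolding isometry_def
  by (auto simp: pdist_def hdist_def intro: bij_betw_map_prod)

lemma isometry_swap: "isometry prod.swap"
  unfolding isometry_def
  by (auto simp: pdist_def hdist_def bij_betw_def inj_on_def image_iff add.commute)

lemma isometry_id: "isometry id"
  unfolding isometry_def by auto

text \<open>An injective linear endomorphism of \<open>real^3\<close> is surjective. Three
  functionals that separate the image of \<open>L\<close> therefore take arbitrary values on it,
  which replaces a dimension count for tangent spaces.\<close>

lemma linear_injective_coords:
  fixes L :: "real^3 \<Rightarrow> 'b::real_vector" and f g h :: "'b \<Rightarrow> real"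
  assumes "linear L" "inj L" "linear f" "linear g" "linear h"
    and ker: "\<And>v. f (L v) = 0 \<Longrightarrow> g (L v) = 0 \<Longrightarrow> h (L v) = 0 \<Longrightarrow> L v = 0"
  shows "\<exists>v. f (L v) = x \<and> g (L v) = y \<and> h (L v) = z"
proof -
  define K :: "real^3 \<Rightarrow> real^3" where "K v = vector [f (L v), g (L v), h (L v)]" for v
  have lin: "linear K"
  proof (rule linearI)
    show "K (v + w) = K v + K w" for v w
      using assms(1,3-5) by (simp add: K_def vec3_eq_iff linear_add)
    show "K (c *\<^sub>R v) = c *\<^sub>R K v" for c v
      using assms(1,3-5) by (simp add: K_def vec3_eq_iff linear_scale)
  qed
  have "inj K"
    unfolding linear_injective_0[OF lin]
  proof (intro allI impI)
    fix v assume "K v = 0"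
    then have "L v = 0" by (intro ker) (auto simp: K_def vec3_eq_iff)
    then show "v = 0" using assms(1,2) by (simp add: linear_injective_0)
  qed
  then have "surj K" using lin by (simp add: linear_injective_imp_surjective)
  then obtain v where "K v = vector [x, y, z]" by (metis surjD)
  then show ?thesis by (intro exI[of _ v]) (simp add: K_def vec3_eq_iff)
qed

section \<open>Second derivatives and moving frames\<close>

text \<open>The second difference is \<open>s^2 * G w\<close> up to a small multiple of
  \<open>s^2\<close>, and it is symmetric in \<open>v\<close> and \<open>w\<close>. This yields
  symmetry of second derivatives from their existence at the single point \<open>x\<close>.\<close>

lemma second_difference_estimate:
  fixes f :: "'a::real_normed_vector \<Rightarrow> real"
  assumes "open U" "x \<in> U" and f: "\<And>y. y \<in> U \<Longrightarrow> (f has_derivative F y) (at y)"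
    and G: "((\<lambda>y. F y v) has_derivative G) (at x)" and "e > 0"
  shows "\<exists>d>0. \<forall>s. 0 < s \<and> s < d \<longrightarrow>
    \<bar>f (x + s *\<^sub>R v + s *\<^sub>R w) - f (x + s *\<^sub>R v) - f (x + s *\<^sub>R w) + f x - s\<^sup>2 * G w\<bar> \<le> e * s\<^sup>2"
proof -
  define K where "K = norm v + norm w + 1"
  have K: "K > 0" by (simp add: K_def add_nonneg_pos)
  obtain r where r: "r > 0" "ball x r \<subseteq> U" using assms(1,2) openE by blast
  have lin: "linear G" using G has_derivative_linear by blast
  \<comment> \<open>Differentiability at \<open>x\<close> is applied twice, each time with error at
    most \<open>e' * (s * K)\<close>; the sum has to be \<open>s * e\<close>.\<close>
  define e' where "e' = e / (2 * K)"
  have "e' > 0" using K \<open>e > 0\<close> by (simp add: e'_def)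
  then obtain d where d: "d > 0"
      "\<And>y. norm (y - x) < d \<Longrightarrow> norm (F y v - F x v - G (y - x)) \<le> e' * norm (y - x)"
    using G unfolding has_derivative_at_alt by blast
  define d' where "d' = min d r / K"
  have "d' > 0" using d r K by (simp add: d'_def)
  moreover have "\<bar>f (x + s *\<^sub>R v + s *\<^sub>R w) - f (x + s *\<^sub>R v) - f (x + s *\<^sub>R w) + f x - s\<^sup>2 * G w\<bar> \<le> e * s\<^sup>2"
    if s: "0 < s" "s < d'" for s
  proof -
    have sK: "s * K < d" "s * K < r"
      using s K by (auto simp: d'_def field_simps)
    have near: "norm (\<tau> *\<^sub>R v + \<sigma> *\<^sub>R w) \<le> s * K" if "0 \<le> \<tau>" "\<tau> \<le> s" "0 \<le> \<sigma>" "\<sigma> \<le> s" for \<tau> \<sigma>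
    proof -
      have "norm (\<tau> *\<^sub>R v + \<sigma> *\<^sub>R w) \<le> \<tau> * norm v + \<sigma> * norm w"
        using that by (intro norm_triangle_le) simp
      also have "\<dots> \<le> s * norm v + s * norm w"
        using that by (intro add_mono mult_right_mono) auto
      also have "\<dots> \<le> s * K" using s by (simp add: K_def algebra_simps)
      finally show ?thesis .
    qed
    have inU: "x + \<tau> *\<^sub>R v + \<sigma> *\<^sub>R w \<in> U" if "0 \<le> \<tau>" "\<tau> \<le> s" "0 \<le> \<sigma>" "\<sigma> \<le> s" for \<tau> \<sigma>
    proof -
      have "x + \<tau> *\<^sub>R v + \<sigma> *\<^sub>R w \<in> ball x r"
        using near[OF that] sK(2) norm_minus_cancel[of "\<tau> *\<^sub>R v + \<sigma> *\<^sub>R w"]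
        unfolding mem_ball dist_norm by (simp add: algebra_simps)
      then show ?thesis using r by auto
    qed
    have der: "((\<lambda>\<tau>. f (x + \<tau> *\<^sub>R v + \<sigma> *\<^sub>R w)) has_real_derivative F (x + \<tau> *\<^sub>R v + \<sigma> *\<^sub>R w) v) (at \<tau>)"
      if "0 \<le> \<tau>" "\<tau> \<le> s" "0 \<le> \<sigma>" "\<sigma> \<le> s" for \<tau> \<sigma>
    proof -
      have "((\<lambda>\<tau>. f (x + \<tau> *\<^sub>R v + \<sigma> *\<^sub>R w)) has_derivative (\<lambda>h. F (x + \<tau> *\<^sub>R v + \<sigma> *\<^sub>R w) (h *\<^sub>R v))) (at \<tau>)"
        by (rule has_derivative_compose[of "\<lambda>\<tau>. x + \<tau> *\<^sub>R v + \<sigma> *\<^sub>R w", OF _ f[OF inU[OF that]]])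
          (auto intro!: derivative_eq_intros)
      moreover have "F (x + \<tau> *\<^sub>R v + \<sigma> *\<^sub>R w) (h *\<^sub>R v) = h * F (x + \<tau> *\<^sub>R v + \<sigma> *\<^sub>R w) v" for h
        using f[OF inU[OF that]] by (simp add: has_derivative_linear linear_scale)
      ultimately show ?thesis
        by (simp add: has_field_derivative_def mult.commute[of _ "F _ v"])
    qed
    \<comment> \<open>The difference in direction \<open>w\<close>. The mean value theorem in
      direction \<open>v\<close> turns it into a difference of first derivatives, which
      differentiability of \<open>F\<close> at \<open>x\<close> controls.\<close>
    define \<phi> where "\<phi> \<tau> = f (x + \<tau> *\<^sub>R v + s *\<^sub>R w) - f (x + \<tau> *\<^sub>R v)" for \<tau>
    have "(\<phi> has_real_derivative F (x + \<tau> *\<^sub>R v + s *\<^sub>R w) v - F (x + \<tau> *\<^sub>R v) v) (at \<tau>)"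
      if "0 \<le> \<tau>" "\<tau> \<le> s" for \<tau>
      unfolding \<phi>_def using der[of \<tau> s] der[of \<tau> 0] that s
      by (intro DERIV_diff) auto
    then obtain \<xi> where \<xi>: "0 < \<xi>" "\<xi> < s"
        "\<phi> s - \<phi> 0 = (s - 0) * (F (x + \<xi> *\<^sub>R v + s *\<^sub>R w) v - F (x + \<xi> *\<^sub>R v) v)"
      using MVT2[of 0 s \<phi> "\<lambda>\<tau>. F (x + \<tau> *\<^sub>R v + s *\<^sub>R w) v - F (x + \<tau> *\<^sub>R v) v"] s by auto
    have est: "\<bar>F (x + z) v - F x v - G z\<bar> \<le> e' * (s * K)" if "norm z \<le> s * K" for z
    proof -
      have "\<bar>F (x + z) v - F x v - G z\<bar> \<le> e' * norm z"
        using d(2)[of "x + z"] that sK(1) by simp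
      also have "\<dots> \<le> e' * (s * K)" using that \<open>e' > 0\<close> by simp
      finally show ?thesis .
    qed
    have "\<bar>F (x + \<xi> *\<^sub>R v + s *\<^sub>R w) v - F (x + \<xi> *\<^sub>R v) v - s * G w\<bar> \<le> 2 * (e' * (s * K))"
      using est[of "\<xi> *\<^sub>R v + s *\<^sub>R w"] est[of "\<xi> *\<^sub>R v"] near[of \<xi> s] near[of \<xi> 0] \<xi>(1,2) s
      by (simp add: linear_add[OF lin] linear_scale[OF lin] add.assoc[symmetric])
    also have "\<dots> = s * e" using K by (simp add: e'_def)
    finally have *: "\<bar>F (x + \<xi> *\<^sub>R v + s *\<^sub>R w) v - F (x + \<xi> *\<^sub>R v) v - s * G w\<bar> \<le> s * e" .
    have "f (x + s *\<^sub>R v + s *\<^sub>R w) - f (x + s *\<^sub>R v) - f (x + s *\<^sub>R w) + f x - s\<^sup>2 * G w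
       = s * (F (x + \<xi> *\<^sub>R v + s *\<^sub>R w) v - F (x + \<xi> *\<^sub>R v) v - s * G w)"
      using \<xi>(3) by (simp add: \<phi>_def algebra_simps power2_eq_square)
    then have "\<bar>f (x + s *\<^sub>R v + s *\<^sub>R w) - f (x + s *\<^sub>R v) - f (x + s *\<^sub>R w) + f x - s\<^sup>2 * G w\<bar>
       = s * \<bar>F (x + \<xi> *\<^sub>R v + s *\<^sub>R w) v - F (x + \<xi> *\<^sub>R v) v - s * G w\<bar>"
      using s by (simp add: abs_mult)
    also have "\<dots> \<le> s * (s * e)" using * s by (intro mult_left_mono) auto
    finally show ?thesis by (simp add: power2_eq_square algebra_simps)
  qed
  ultimately show ?thesis by blast
qed

lemma second_derivative_symmetric_real:
  fixes f :: "'a::real_normed_vector \<Rightarrow> real"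
  assumes U: "open U" "x \<in> U" and f: "\<And>y. y \<in> U \<Longrightarrow> (f has_derivative F y) (at y)"
    and G: "((\<lambda>y. F y v) has_derivative G) (at x)"
    and H: "((\<lambda>y. F y w) has_derivative H) (at x)"
  shows "G w = H v"
proof (rule ccontr)
  assume "G w \<noteq> H v"
  define e where "e = \<bar>G w - H v\<bar> / 3"
  have e: "e > 0" using \<open>G w \<noteq> H v\<close> by (simp add: e_def)
  obtain d1 where d1: "d1 > 0" "\<And>s. 0 < s \<Longrightarrow> s < d1 \<Longrightarrow>
      \<bar>f (x + s *\<^sub>R v + s *\<^sub>R w) - f (x + s *\<^sub>R v) - f (x + s *\<^sub>R w) + f x - s\<^sup>2 * G w\<bar> \<le> e * s\<^sup>2"
    using second_difference_estimate[OF U f G e] by metis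
  obtain d2 where d2: "d2 > 0" "\<And>s. 0 < s \<Longrightarrow> s < d2 \<Longrightarrow>
      \<bar>f (x + s *\<^sub>R w + s *\<^sub>R v) - f (x + s *\<^sub>R w) - f (x + s *\<^sub>R v) + f x - s\<^sup>2 * H v\<bar> \<le> e * s\<^sup>2"
    using second_difference_estimate[OF U f H e] by metis
  define s where "s = min d1 d2 / 2"
  have s: "0 < s" "s < d1" "s < d2" using d1(1) d2(1) by (auto simp: s_def)
  have sw: "x + s *\<^sub>R w + s *\<^sub>R v = x + s *\<^sub>R v + s *\<^sub>R w" by (simp add: algebra_simps)
  have "\<bar>s\<^sup>2 * G w - s\<^sup>2 * H v\<bar> \<le> 2 * (e * s\<^sup>2)"
    using d1(2)[OF s(1,2)] d2(2)[OF s(1,3)] unfolding sw by linarith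
  then have "s\<^sup>2 * \<bar>G w - H v\<bar> \<le> s\<^sup>2 * (2 * e)"
    unfolding right_diff_distrib[symmetric] abs_mult by (simp add: mult_ac)
  then have "\<bar>G w - H v\<bar> \<le> 2 * e" using s by simp
  then show False using e by (simp add: e_def)
qed

lemma second_derivative_symmetric:
  fixes f :: "'a::real_normed_vector \<Rightarrow> 'b::euclidean_space"
  assumes U: "open U" "x \<in> U" and f: "\<And>y. y \<in> U \<Longrightarrow> (f has_derivative F y) (at y)"
    and G: "((\<lambda>y. F y v) has_derivative G) (at x)"
    and H: "((\<lambda>y. F y w) has_derivative H) (at x)"
  shows "G w = H v"
proof (rule euclidean_eqI)
  fix b :: 'b
  show "G w \<bullet> b = H v \<bullet> b"
    by (rule second_derivative_symmetric_real[OF U, of "\<lambda>y. f y \<bullet> b" "\<lambda>y z. F y z \<bullet> b"])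
      (use f G H in \<open>auto intro!: has_derivative_inner_left\<close>)
qed

section \<open>Cartan's moving frames in the hyperbolic plane\<close>

lemma has_derivative_const_on_open:
  assumes "open U" "u \<in> U" "\<And>x. x \<in> U \<Longrightarrow> f x = c" "(f has_derivative f') (at u)"
  shows "f' v = 0"
proof -
  have "((\<lambda>_. c) has_derivative f') (at u)"
    by (rule has_derivative_transform_within_open[OF assms(4,1,2)]) (use assms(3) in auto)
  then have "f' = (\<lambda>_. 0)" using has_derivative_const has_derivative_unique by blast
  then show ?thesis by simp
qed

text \<open>The domain is not a surface: the frame will be pulled back from a factor to a
  three-dimensional chart, so the forms have kernels. With the derivatives as parameters, both
  factors instantiate the same calculus despite the different scalings of their normals.\<close>

locale moving_frame =
  fixes U :: "'a::real_normed_vector set"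
    and p n :: "'a \<Rightarrow> real^3" and p' n' :: "'a \<Rightarrow> 'a \<Rightarrow> real^3" and p'' n'' :: "'a \<Rightarrow> 'a \<Rightarrow> 'a \<Rightarrow> real^3"
  assumes U: "open U"
    and p_der: "u \<in> U \<Longrightarrow> (p has_derivative p' u) (at u)"
    and p_der2: "u \<in> U \<Longrightarrow> ((\<lambda>u. p' u v) has_derivative p'' u v) (at u)"
    and n_der: "u \<in> U \<Longrightarrow> (n has_derivative n' u) (at u)"
    and n_der2: "u \<in> U \<Longrightarrow> ((\<lambda>u. n' u v) has_derivative n'' u v) (at u)"
    and pp: "u \<in> U \<Longrightarrow> lor (p u) (p u) = -1"
    and pn: "u \<in> U \<Longrightarrow> lor (p u) (n u) = 0"
    and nn: "u \<in> U \<Longrightarrow> lor (n u) (n u) = 1"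
begin

text \<open>\<open>thn\<close> and \<open>tht\<close> form the coframe dual to \<open>(n, t)\<close>, \<open>om\<close> is the connection form; the last argument of
  a primed form is the direction of differentiation.\<close>

definition "t u = lcross (p u) (n u)"
definition "t' u v = lcross (p u) (n' u v) + lcross (p' u v) (n u)"
definition "thn u v = lor (p' u v) (n u)"
definition "tht u v = lor (p' u v) (t u)"
definition "om u v = lor (n' u v) (t u)"
definition "thn' u v w = lor (p' u v) (n' u w) + lor (p'' u v w) (n u)"
definition "tht' u v w = lor (p' u v) (t' u w) + lor (p'' u v w) (t u)"
definition "om' u v w = lor (n' u v) (t' u w) + lor (n'' u v w) (t u)"

lemma frame: "u \<in> U \<Longrightarrow> lframe (p u) (n u) (t u)"
  unfolding t_def by (intro lframe_lcross pp nn pn)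

lemma t_der: "u \<in> U \<Longrightarrow> (t has_derivative t' u) (at u)"
  unfolding t_def t'_def using lcross.FDERIV[OF p_der n_der] by simp

lemma thn_der: "u \<in> U \<Longrightarrow> ((\<lambda>u. thn u v) has_derivative thn' u v) (at u)"
  unfolding thn_def thn'_def using lor.FDERIV[OF p_der2 n_der] by simp

lemma tht_der: "u \<in> U \<Longrightarrow> ((\<lambda>u. tht u v) has_derivative tht' u v) (at u)"
  unfolding tht_def tht'_def using lor.FDERIV[OF p_der2 t_der] by simp

lemma om_der: "u \<in> U \<Longrightarrow> ((\<lambda>u. om u v) has_derivative om' u v) (at u)"
  unfolding om_def om'_def using lor.FDERIV[OF n_der2 t_der] by simp

lemma lor_const_der:
  assumes "u \<in> U" "\<And>u. u \<in> U \<Longrightarrow> lor (x u) (y u) = c"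
    "(x has_derivative x') (at u)" "(y has_derivative y') (at u)"
  shows "lor (x' v) (y u) = - lor (y' v) (x u)"
  using has_derivative_const_on_open[OF U assms(1,2) lor.FDERIV[OF assms(3,4)], of v]
  by (simp add: lor_commute)

lemma p'_expand: assumes u: "u \<in> U" shows "p' u v = thn u v *\<^sub>R n u + tht u v *\<^sub>R t u"
proof -
  have "lor (p' u v) (p u) = 0"
    using lor_const_der[OF u pp p_der[OF u] p_der[OF u], of v] by simp
  then show ?thesis using lframe_expand[OF frame[OF u], of "p' u v"] by (simp add: thn_def tht_def)
qed

lemma n'_expand: assumes u: "u \<in> U" shows "n' u v = thn u v *\<^sub>R p u + om u v *\<^sub>R t u"
proof -
  have "lor (n' u v) (n u) = 0"
    using lor_const_der[OF u nn n_der[OF u] n_der[OF u], of v] by simp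
  moreover have "lor (n' u v) (p u) = - thn u v"
    using lor_const_der[OF u pn p_der[OF u] n_der[OF u], of v] by (simp add: thn_def)
  ultimately show ?thesis using lframe_expand[OF frame[OF u], of "n' u v"] by (simp add: om_def)
qed

lemma t'_expand: assumes u: "u \<in> U" shows "t' u v = tht u v *\<^sub>R p u - om u v *\<^sub>R n u"
proof -
  note F = lframeD[OF frame]
  have "lor (t' u v) (t u) = 0"
    using lor_const_der[OF u F(3) t_der[OF u] t_der[OF u], of v] by simp
  moreover have "lor (t' u v) (p u) = - tht u v"
    using lor_const_der[OF u F(5) p_der[OF u] t_der[OF u], of v] by (simp add: tht_def)
  moreover have "lor (t' u v) (n u) = - om u v"
    using lor_const_der[OF u F(6) n_der[OF u] t_der[OF u], of v] by (simp add: om_def)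
  ultimately show ?thesis using lframe_expand[OF frame[OF u], of "t' u v"] by simp
qed

lemma p''_sym: "u \<in> U \<Longrightarrow> p'' u v w = p'' u w v"
  by (rule second_derivative_symmetric[OF U _ p_der p_der2 p_der2])

lemma n''_sym: "u \<in> U \<Longrightarrow> n'' u v w = n'' u w v"
  by (rule second_derivative_symmetric[OF U _ n_der n_der2 n_der2])

text \<open>\<open>thn' u w v - thn' u v w\<close> is the exterior derivative of \<open>thn\<close>
  on \<open>(v, w)\<close>. Second derivatives cancel by symmetry, and the frame expansions leave
  wedge products. The third equation expresses curvature \<open>-1\<close>.\<close>

lemma structure_equations:
  assumes u: "u \<in> U"
  shows "thn' u w v - thn' u v w = om u v * tht u w - om u w * tht u v"
    and "tht' u w v - tht' u v w = thn u v * om u w - thn u w * om u v"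
    and "om' u w v - om' u v w = thn u v * tht u w - thn u w * tht u v"
proof -
  note F = lframeD[OF frame[OF u]]
  show "thn' u w v - thn' u v w = om u v * tht u w - om u w * tht u v"
    unfolding thn'_def p''_sym[OF u, of v w] p'_expand[OF u] n'_expand[OF u]
    using F by (simp add: lor_simps)
  show "tht' u w v - tht' u v w = thn u v * om u w - thn u w * om u v"
    unfolding tht'_def p''_sym[OF u, of v w] p'_expand[OF u] t'_expand[OF u]
    using F by (simp add: lor_simps)
  show "om' u w v - om' u v w = thn u v * tht u w - thn u w * tht u v"
    unfolding om'_def n''_sym[OF u, of v w] n'_expand[OF u] t'_expand[OF u]
    using F by (simp add: lor_simps)
qed

end

section \<open>Hypersurfaces and their shape operators\<close>

lemma pmetric_simps:
  "pmetric (v + v') w = pmetric v w + pmetric v' w" "pmetric v (w + w') = pmetric v w + pmetric v w'"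
  "pmetric (r *\<^sub>R v) w = r * pmetric v w" "pmetric v (r *\<^sub>R w) = r * pmetric v w"
  "pmetric 0 w = 0" "pmetric v 0 = 0"
  by (simp_all add: pmetric_def lor_simps algebra_simps)

lemma pmetric_commute: "pmetric v w = pmetric w v"
  by (simp add: pmetric_def lor_commute)

lemma linear_pmetric_left: "linear (\<lambda>v. pmetric v w)"
  by (rule linearI) (simp_all add: pmetric_simps)

lemma smooth_on_has_derivative:
  assumes "smooth_on U f" "u \<in> U"
  shows "(f has_derivative frechet_derivative f (at u)) (at u)"
    and "((\<lambda>u. frechet_derivative f (at u) v) has_derivative
      frechet_derivative (\<lambda>u. frechet_derivative f (at u) v) (at u)) (at u)"
proof -
  have "ddl [] f differentiable (at u)" "ddl [v] f differentiable (at u)"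
    using assms unfolding smooth_on_def by blast+
  then show "(f has_derivative frechet_derivative f (at u)) (at u)"
    "((\<lambda>u. frechet_derivative f (at u) v) has_derivative
      frechet_derivative (\<lambda>u. frechet_derivative f (at u) v) (at u)) (at u)"
    by (simp_all add: frechet_derivative_works)
qed

text \<open>The rigidity principle behind every case. A chart domain may be disconnected, so a point
  is surrounded by the image of a ball, which is open in \<open>M\<close> because the inverse chart
  is continuous; connectedness of \<open>M\<close> does the rest.\<close>

lemma chart_zero_derivative_imp_constant:
  fixes f :: "pt \<Rightarrow> 'b::real_normed_vector"
  assumes M: "hypersurface M" "connected M"
    and f: "\<And>U \<phi> u. chart M U \<phi> \<Longrightarrow> u \<in> U \<Longrightarrow> ((\<lambda>u. f (\<phi> u)) has_derivative (\<lambda>_. 0)) (at u)"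
    and "x \<in> M" "y \<in> M"
  shows "f x = f y"
proof -
  have "f constant_on M"
  proof (rule locally_constant_imp_constant[OF M(2)])
    fix x assume "x \<in> M"
    then obtain U \<phi> where U: "chart M U \<phi>" "x \<in> \<phi> ` U"
      using M(1) by (auto simp: hypersurface_def)
    then obtain u where u: "u \<in> U" "x = \<phi> u" by auto
    have ch: "open U" "openin (top_of_set M) (\<phi> ` U)" "inj_on \<phi> U" "continuous_on (\<phi> ` U) (inv_into U \<phi>)"
      using U(1) by (auto simp: chart_def)
    obtain r where r: "r > 0" "ball u r \<subseteq> U" using ch(1) u(1) openE by blast
    have "openin (top_of_set (\<phi> ` U)) (\<phi> ` U \<inter> inv_into U \<phi> -` ball u r)"
      using continuous_openin_preimage_gen[OF ch(4)] open_ball by blast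
    moreover have "\<phi> ` U \<inter> inv_into U \<phi> -` ball u r = \<phi> ` ball u r"
      using r(2) ch(3) by (auto simp: inv_into_f_f subset_eq)
    ultimately have "openin (top_of_set (\<phi> ` U)) (\<phi> ` ball u r)" by simp
    then have op: "openin (top_of_set M) (\<phi> ` ball u r)"
      using ch(2) openin_trans by blast
    have "f (\<phi> w) = f (\<phi> u)" if "w \<in> ball u r" for w
    proof (rule has_derivative_zero_unique_connected[of "ball u r" "\<lambda>u. f (\<phi> u)"])
      show "((\<lambda>u. f (\<phi> u)) has_derivative (\<lambda>x. 0)) (at z)" if "z \<in> ball u r" for z
        using f[OF U(1)] that r(2) by blast
    qed (use that r in auto)
    then have "\<forall>y\<in>\<phi> ` ball u r. f y = f x" unfolding u(2) by blast
    moreover have "x \<in> \<phi> ` ball u r" using u(2) r(1) by simp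
    ultimately show "\<exists>T. openin (top_of_set M) T \<and> x \<in> T \<and> (\<forall>y\<in>T. f y = f x)"
      using op by blast
  qed
  then show ?thesis using assms(4,5) by (auto simp: constant_on_def)
qed

text \<open>Tangency as linear equations at a point, free of charts.
  \<open>tangent_space_tangential\<close> and \<open>ex_preimage\<close> relate it to chart
  velocities.\<close>

definition tangential :: "(pt \<Rightarrow> pt) \<Rightarrow> pt \<Rightarrow> pt \<Rightarrow> bool" where
  "tangential N x X \<longleftrightarrow> lor (fst x) (fst X) = 0 \<and> lor (snd x) (snd X) = 0 \<and> pmetric (N x) X = 0"

text \<open>The last clause builds spanning into the notion of a frame.\<close>

definition tframe :: "(pt \<Rightarrow> pt) \<Rightarrow> pt \<Rightarrow> pt \<Rightarrow> pt \<Rightarrow> pt \<Rightarrow> bool" where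
  "tframe N x E1 E2 E3 \<longleftrightarrow> tangential N x E1 \<and> tangential N x E2 \<and> tangential N x E3
    \<and> pmetric E1 E1 = 1 \<and> pmetric E2 E2 = 1 \<and> pmetric E3 E3 = 1
    \<and> pmetric E1 E2 = 0 \<and> pmetric E1 E3 = 0 \<and> pmetric E2 E3 = 0
    \<and> (\<forall>X. tangential N x X \<longrightarrow> X = pmetric X E1 *\<^sub>R E1 + pmetric X E2 *\<^sub>R E2 + pmetric X E3 *\<^sub>R E3)"

lemma tframe_of_lframes:
  assumes "lframe (fst x) n1 t1" "lframe (snd x) n2 t2" "a\<^sup>2 + b\<^sup>2 = 1" "N x = (b *\<^sub>R n1, a *\<^sub>R n2)"
  shows "tframe N x (t1, 0) (0, t2) (a *\<^sub>R n1, - b *\<^sub>R n2)"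
  unfolding tframe_def
proof (intro conjI allI impI)
  note F = lframeD[OF assms(1)] lframeD[OF assms(2)]
  show "tangential N x (t1, 0)" "tangential N x (0, t2)" "tangential N x (a *\<^sub>R n1, - b *\<^sub>R n2)"
    using F assms(4) by (auto simp: tangential_def pmetric_def lor_simps)
  show "pmetric (t1, 0) (t1, 0) = 1" "pmetric (0, t2) (0, t2) = 1"
    "pmetric (a *\<^sub>R n1, - b *\<^sub>R n2) (a *\<^sub>R n1, - b *\<^sub>R n2) = 1"
    "pmetric (t1, 0) (0, t2) = 0" "pmetric (t1, 0) (a *\<^sub>R n1, - b *\<^sub>R n2) = 0"
    "pmetric (0, t2) (a *\<^sub>R n1, - b *\<^sub>R n2) = 0"
    using F assms(3) by (auto simp: pmetric_def lor_simps power2_eq_square)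
  fix X assume X: "tangential N x X"
  define c where "c = lor (fst X) n1"
  define d where "d = lor (snd X) n2"
  have bc: "b * c + a * d = 0"
    using X assms(4) by (simp add: tangential_def pmetric_def lor_simps c_def d_def lor_commute)
  \<comment> \<open>\<open>(c, d)\<close> is orthogonal to the unit vector \<open>(b, a)\<close> of
    the plane, hence a multiple of \<open>(a, - b)\<close>; \<open>m\<close> is the factor.\<close>
  define m where "m = a * c - b * d"
  have c: "c = a * m"
  proof -
    have "c = (a\<^sup>2 + b\<^sup>2) * c" using assms(3) by simp
    also have "\<dots> = a * (a * c) + b * (b * c)" by (simp add: power2_eq_square algebra_simps)
    also have "b * c = - (a * d)" using bc by linarith
    finally show ?thesis by (simp add: m_def algebra_simps)
  qed
  have d: "d = - b * m"
  proof -
    have "d = (a\<^sup>2 + b\<^sup>2) * d" using assms(3) by simp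
    also have "\<dots> = b * (b * d) + a * (a * d)" by (simp add: power2_eq_square algebra_simps)
    also have "a * d = - (b * c)" using bc by linarith
    finally show ?thesis by (simp add: m_def algebra_simps)
  qed
  have fX: "fst X = (a * m) *\<^sub>R n1 + lor (fst X) t1 *\<^sub>R t1" and sX: "snd X = (- b * m) *\<^sub>R n2 + lor (snd X) t2 *\<^sub>R t2"
    using lframe_expand[OF assms(1), of "fst X"] lframe_expand[OF assms(2), of "snd X"] X
    unfolding c[symmetric] d[symmetric] by (simp_all add: tangential_def lor_commute c_def d_def)
  have pm: "pmetric X (a *\<^sub>R n1, - b *\<^sub>R n2) = m" "pmetric X (t1, 0) = lor (fst X) t1" "pmetric X (0, t2) = lor (snd X) t2"
    by (simp_all add: pmetric_def lor_simps c_def d_def m_def)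
  show "X = pmetric X (t1, 0) *\<^sub>R (t1, 0) + pmetric X (0, t2) *\<^sub>R (0, t2) +
      pmetric X (a *\<^sub>R n1, - b *\<^sub>R n2) *\<^sub>R (a *\<^sub>R n1, - b *\<^sub>R n2)"
    unfolding pm
  proof (rule prod_eqI)
    show "fst X = fst (lor (fst X) t1 *\<^sub>R (t1, 0) + lor (snd X) t2 *\<^sub>R (0, t2) + m *\<^sub>R (a *\<^sub>R n1, - b *\<^sub>R n2))"
      by (subst fX) (simp add: mult.commute)
    show "snd X = snd (lor (fst X) t1 *\<^sub>R (t1, 0) + lor (snd X) t2 *\<^sub>R (0, t2) + m *\<^sub>R (a *\<^sub>R n1, - b *\<^sub>R n2))"
      by (subst sX) (simp add: mult.commute)
  qed
qed

lemma orthonormal_rows_imp_columns: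
  fixes x1 :: real
  assumes "x1*x1 + x2*x2 + x3*x3 = 1" "y1*y1 + y2*y2 + y3*y3 = 1" "z1*z1 + z2*z2 + z3*z3 = 1"
    "x1*y1 + x2*y2 + x3*y3 = 0" "x1*z1 + x2*z2 + x3*z3 = 0" "y1*z1 + y2*z2 + y3*z3 = 0"
  shows "x1*x1 + y1*y1 + z1*z1 = 1" "x2*x2 + y2*y2 + z2*z2 = 1" "x3*x3 + y3*y3 + z3*z3 = 1"
    "x1*x2 + y1*y2 + z1*z2 = 0" "x1*x3 + y1*y3 + z1*z3 = 0" "x2*x3 + y2*y3 + z2*z3 = 0"
proof -
  define A :: "real^3^3" where "A = vector [vector [x1, x2, x3], vector [y1, y2, y3], vector [z1, z2, z3]]"
  have "A ** transpose A = mat 1"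
    using assms by (simp add: vec3_eq_iff matrix_matrix_mult_def mat_def transpose_def sum_3 A_def mult.commute)
  then have "transpose A ** A = mat 1" by (rule matrix_left_right_inverse1)
  then show "x1*x1 + y1*y1 + z1*z1 = 1" "x2*x2 + y2*y2 + z2*z2 = 1" "x3*x3 + y3*y3 + z3*z3 = 1"
    "x1*x2 + y1*y2 + z1*z2 = 0" "x1*x3 + y1*y3 + z1*z3 = 0" "x2*x3 + y2*y3 + z2*z3 = 0"
    by (simp_all add: vec3_eq_iff matrix_matrix_mult_def mat_def transpose_def sum_3 A_def mult.commute)
qed

section \<open>The shape operator in a prescribed frame\<close>

locale cpc_hypersurface =
  fixes M :: "pt set" and N :: "pt \<Rightarrow> pt" and C k1 k2 k3 :: real
  assumes hyp: "hypersurface M" and conn: "connected M" and normal: "unit_normal M N"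
    and cpc: "\<And>x. x \<in> M \<Longrightarrow> \<exists>e1 e2 e3.
     pmetric e1 e1 = 1 \<and> pmetric e2 e2 = 1 \<and> pmetric e3 e3 = 1 \<and>
     pmetric e1 e2 = 0 \<and> pmetric e1 e3 = 0 \<and> pmetric e2 e3 = 0 \<and>
     principal_dir M N x k1 e1 \<and> principal_dir M N x k2 e2 \<and> principal_dir M N x k3 e3"
    and angle: "\<And>x. x \<in> M \<Longrightarrow> pmetric (Pstr (N x)) (N x) = C"
begin

lemma M_H2: "x \<in> M \<Longrightarrow> fst x \<in> H2" "x \<in> M \<Longrightarrow> snd x \<in> H2"
  using hyp by (auto simp: hypersurface_def)

lemma N_orth: "x \<in> M \<Longrightarrow> lor (fst x) (fst (N x)) = 0" "x \<in> M \<Longrightarrow> lor (snd x) (snd (N x)) = 0"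
  using normal by (auto simp: unit_normal_def)

lemma N_norms:
  assumes "x \<in> M"
  shows "lor (fst (N x)) (fst (N x)) = (1 + C) / 2" "lor (snd (N x)) (snd (N x)) = (1 - C) / 2"
proof -
  have "pmetric (N x) (N x) = 1" using normal assms by (auto simp: unit_normal_def)
  then show "lor (fst (N x)) (fst (N x)) = (1 + C) / 2" "lor (snd (N x)) (snd (N x)) = (1 - C) / 2"
    using angle[OF assms] by (simp_all add: pmetric_def Pstr_def lor_simps)
qed

lemma chartD:
  assumes "chart M U \<phi>" "u \<in> U"
  shows "open U" "\<phi> u \<in> M" "inj (frechet_derivative \<phi> (at u))"
    "(\<phi> has_derivative frechet_derivative \<phi> (at u)) (at u)"
    "((\<lambda>u. frechet_derivative \<phi> (at u) v) has_derivative
      frechet_derivative (\<lambda>u. frechet_derivative \<phi> (at u) v) (at u)) (at u)"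
    "((\<lambda>u. N (\<phi> u)) has_derivative frechet_derivative (N \<circ> \<phi>) (at u)) (at u)"
    "((\<lambda>u. frechet_derivative (N \<circ> \<phi>) (at u) v) has_derivative
      frechet_derivative (\<lambda>u. frechet_derivative (N \<circ> \<phi>) (at u) v) (at u)) (at u)"
proof -
  have s: "smooth_on U \<phi>" "smooth_on U (N \<circ> \<phi>)"
    using assms normal by (auto simp: chart_def unit_normal_def)
  show "open U" "\<phi> u \<in> M" "inj (frechet_derivative \<phi> (at u))"
    using assms by (auto simp: chart_def)
  show "(\<phi> has_derivative frechet_derivative \<phi> (at u)) (at u)"
    "((\<lambda>u. frechet_derivative \<phi> (at u) v) has_derivative
      frechet_derivative (\<lambda>u. frechet_derivative \<phi> (at u) v) (at u)) (at u)"
    by (rule smooth_on_has_derivative[OF s(1) assms(2)])+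
  show "((\<lambda>u. N (\<phi> u)) has_derivative frechet_derivative (N \<circ> \<phi>) (at u)) (at u)"
    "((\<lambda>u. frechet_derivative (N \<circ> \<phi>) (at u) v) has_derivative
      frechet_derivative (\<lambda>u. frechet_derivative (N \<circ> \<phi>) (at u) v) (at u)) (at u)"
    using smooth_on_has_derivative[OF s(2) assms(2)] by (simp_all add: o_def)
qed

lemma ex_chart: "x \<in> M \<Longrightarrow> \<exists>U \<phi> u. chart M U \<phi> \<and> u \<in> U \<and> \<phi> u = x"
  using hyp unfolding hypersurface_def by (metis imageE)

lemma tangential_derivative:
  assumes "chart M U \<phi>" "u \<in> U"
  shows "tangential N (\<phi> u) (frechet_derivative \<phi> (at u) v)"
proof -
  note c = chartD[OF assms]
  have 1: "((\<lambda>u. lor (fst (\<phi> u)) (fst (\<phi> u))) has_derivative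
     (\<lambda>v. lor (fst (\<phi> u)) (fst (frechet_derivative \<phi> (at u) v)) + lor (fst (frechet_derivative \<phi> (at u) v)) (fst (\<phi> u)))) (at u)"
    using c(4) by (intro lor.FDERIV has_derivative_fst)
  have 2: "((\<lambda>u. lor (snd (\<phi> u)) (snd (\<phi> u))) has_derivative
     (\<lambda>v. lor (snd (\<phi> u)) (snd (frechet_derivative \<phi> (at u) v)) + lor (snd (frechet_derivative \<phi> (at u) v)) (snd (\<phi> u)))) (at u)"
    using c(4) by (intro lor.FDERIV has_derivative_snd)
  have "lor (fst (\<phi> u)) (fst (frechet_derivative \<phi> (at u) v)) = 0"
    using has_derivative_const_on_open[OF c(1) assms(2) _ 1, of "-1" v] chartD(2)[OF assms(1)] M_H2 H2D
    by (simp add: lor_commute)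
  moreover have "lor (snd (\<phi> u)) (snd (frechet_derivative \<phi> (at u) v)) = 0"
    using has_derivative_const_on_open[OF c(1) assms(2) _ 2, of "-1" v] chartD(2)[OF assms(1)] M_H2 H2D
    by (simp add: lor_commute)
  moreover have "frechet_derivative \<phi> (at u) v \<in> tangent_space M (\<phi> u)"
    unfolding tangent_space_def using assms by blast
  then have "pmetric (N (\<phi> u)) (frechet_derivative \<phi> (at u) v) = 0"
    using normal c(2) by (auto simp: unit_normal_def)
  ultimately show ?thesis by (simp add: tangential_def)
qed

lemma tangent_space_tangential: "X \<in> tangent_space M x \<Longrightarrow> tangential N x X"
  unfolding tangent_space_def using tangential_derivative by fastforce

lemma ex_coords:
  assumes "chart M U \<phi>" "u \<in> U" "tframe N (\<phi> u) E1 E2 E3"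
  shows "\<exists>v. pmetric (frechet_derivative \<phi> (at u) v) E1 = y1 \<and> pmetric (frechet_derivative \<phi> (at u) v) E2 = y2
    \<and> pmetric (frechet_derivative \<phi> (at u) v) E3 = y3"
proof (rule linear_injective_coords)
  note c = chartD[OF assms(1,2)]
  show "linear (frechet_derivative \<phi> (at u))" "inj (frechet_derivative \<phi> (at u))"
    using c has_derivative_linear by blast+
  fix v assume "pmetric (frechet_derivative \<phi> (at u) v) E1 = 0" "pmetric (frechet_derivative \<phi> (at u) v) E2 = 0"
    "pmetric (frechet_derivative \<phi> (at u) v) E3 = 0"
  then show "frechet_derivative \<phi> (at u) v = 0"
    using assms(3) tangential_derivative[OF assms(1,2), of v] unfolding tframe_def
    by (metis add.right_neutral scale_zero_left)
qed (rule linear_pmetric_left)+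

lemma ex_preimage:
  assumes "chart M U \<phi>" "u \<in> U" "tframe N (\<phi> u) E1 E2 E3" "tangential N (\<phi> u) X"
  shows "\<exists>v. frechet_derivative \<phi> (at u) v = X"
proof -
  obtain v where v: "pmetric (frechet_derivative \<phi> (at u) v) E1 = pmetric X E1"
    "pmetric (frechet_derivative \<phi> (at u) v) E2 = pmetric X E2"
    "pmetric (frechet_derivative \<phi> (at u) v) E3 = pmetric X E3"
    using ex_coords[OF assms(1-3)] by blast
  have "X = pmetric X E1 *\<^sub>R E1 + pmetric X E2 *\<^sub>R E2 + pmetric X E3 *\<^sub>R E3"
    using assms(3,4) unfolding tframe_def by blast
  moreover have "frechet_derivative \<phi> (at u) v = pmetric X E1 *\<^sub>R E1 + pmetric X E2 *\<^sub>R E2 + pmetric X E3 *\<^sub>R E3"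
    using assms(3) tangential_derivative[OF assms(1,2), of v] v unfolding tframe_def by metis
  ultimately have "frechet_derivative \<phi> (at u) v = X" by simp
  then show ?thesis ..
qed

text \<open>Carries the pointwise principal directions over to a frame chosen in advance, keeping
  only the trace and the trace of the square, which do not depend on those directions. One matrix
  serves all charts because \<open>principal_dir\<close> speaks of all charts at once.\<close>

lemma shape_matrix:
  assumes "x \<in> M" and E: "tframe N x E1 E2 E3"
  obtains h11 h12 h13 h22 h23 h33 where
    "\<And>U \<phi> u v. \<lbrakk>chart M U \<phi>; u \<in> U; \<phi> u = x\<rbrakk> \<Longrightarrow>
       (let X = frechet_derivative \<phi> (at u) v; Y = frechet_derivative (N \<circ> \<phi>) (at u) v in
        pmetric Y E1 = - (h11 * pmetric X E1 + h12 * pmetric X E2 + h13 * pmetric X E3) \<and>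
        pmetric Y E2 = - (h12 * pmetric X E1 + h22 * pmetric X E2 + h23 * pmetric X E3) \<and>
        pmetric Y E3 = - (h13 * pmetric X E1 + h23 * pmetric X E2 + h33 * pmetric X E3))"
    "h11 + h22 + h33 = k1 + k2 + k3"
    "h11\<^sup>2 + h22\<^sup>2 + h33\<^sup>2 + 2 * h12\<^sup>2 + 2 * h13\<^sup>2 + 2 * h23\<^sup>2 = k1\<^sup>2 + k2\<^sup>2 + k3\<^sup>2"
proof -
  obtain e1 e2 e3 where on: "pmetric e1 e1 = 1" "pmetric e2 e2 = 1" "pmetric e3 e3 = 1"
      "pmetric e1 e2 = 0" "pmetric e1 e3 = 0" "pmetric e2 e3 = 0"
    and pd: "principal_dir M N x k1 e1" "principal_dir M N x k2 e2" "principal_dir M N x k3 e3"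
    using cpc[OF assms(1)] by blast
  define x1 x2 x3 where "x1 = pmetric e1 E1" "x2 = pmetric e1 E2" "x3 = pmetric e1 E3"
  define y1 y2 y3 where "y1 = pmetric e2 E1" "y2 = pmetric e2 E2" "y3 = pmetric e2 E3"
  define z1 z2 z3 where "z1 = pmetric e3 E1" "z2 = pmetric e3 E2" "z3 = pmetric e3 E3"
  note defs = x1_x2_x3_def y1_y2_y3_def z1_z2_z3_def
  have tan: "tangential N x e1" "tangential N x e2" "tangential N x e3"
    using pd tangent_space_tangential by (auto simp: principal_dir_def)
  then have ex: "e1 = x1 *\<^sub>R E1 + x2 *\<^sub>R E2 + x3 *\<^sub>R E3" "e2 = y1 *\<^sub>R E1 + y2 *\<^sub>R E2 + y3 *\<^sub>R E3"
      "e3 = z1 *\<^sub>R E1 + z2 *\<^sub>R E2 + z3 *\<^sub>R E3"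
    using E unfolding tframe_def defs by blast+
  have Eon: "pmetric E1 E1 = 1" "pmetric E2 E2 = 1" "pmetric E3 E3 = 1"
      "pmetric E1 E2 = 0" "pmetric E1 E3 = 0" "pmetric E2 E3 = 0" 
      "pmetric E2 E1 = 0" "pmetric E3 E1 = 0" "pmetric E3 E2 = 0"
    using E pmetric_commute[of E2 E1] pmetric_commute[of E3 E1] pmetric_commute[of E3 E2] unfolding tframe_def by simp_all
  have rows: "x1*x1 + x2*x2 + x3*x3 = 1" "y1*y1 + y2*y2 + y3*y3 = 1" "z1*z1 + z2*z2 + z3*z3 = 1"
    "x1*y1 + x2*y2 + x3*y3 = 0" "x1*z1 + x2*z2 + x3*z3 = 0" "y1*z1 + y2*z2 + y3*z3 = 0"
    using on[unfolded ex] by (simp_all add: pmetric_simps Eon mult.commute)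
  note cols = orthonormal_rows_imp_columns[OF rows]
  have ETan: "E1 \<in> tangent_space M x" "E2 \<in> tangent_space M x" "E3 \<in> tangent_space M x"
  proof -
    obtain U \<phi> u where c: "chart M U \<phi>" "u \<in> U" "\<phi> u = x" using ex_chart[OF assms(1)] by blast
    have "X \<in> tangent_space M x" if X: "tangential N x X" for X
    proof -
      obtain v where "frechet_derivative \<phi> (at u) v = X"
        using ex_preimage[OF c(1,2), of E1 E2 E3 X] c(3) E X by blast
      then show ?thesis unfolding tangent_space_def using c by blast
    qed
    then show "E1 \<in> tangent_space M x" "E2 \<in> tangent_space M x" "E3 \<in> tangent_space M x"
      using E unfolding tframe_def by blast+
  qed
  \<comment> \<open>Spectral decomposition: the curvatures weighted by products of components of the
    principal directions.\<close>
  define h11 where "h11 = k1*x1*x1 + k2*y1*y1 + k3*z1*z1"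
  define h12 where "h12 = k1*x1*x2 + k2*y1*y2 + k3*z1*z2"
  define h13 where "h13 = k1*x1*x3 + k2*y1*y3 + k3*z1*z3"
  define h22 where "h22 = k1*x2*x2 + k2*y2*y2 + k3*z2*z2"
  define h23 where "h23 = k1*x2*x3 + k2*y2*y3 + k3*z2*z3"
  define h33 where "h33 = k1*x3*x3 + k2*y3*y3 + k3*z3*z3"
  note hdefs = h11_def h12_def h13_def h22_def h23_def h33_def
  show thesis
  proof (rule that[of h11 h12 h13 h22 h23 h33])
    have "h11 + h22 + h33 = k1 * (x1*x1 + x2*x2 + x3*x3) + k2 * (y1*y1 + y2*y2 + y3*y3) + k3 * (z1*z1 + z2*z2 + z3*z3)"
      unfolding hdefs by algebra
    then show "h11 + h22 + h33 = k1 + k2 + k3" using rows by simp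
    \<comment> \<open>The squared norm of the matrix expands into squared inner products of the
      rows; orthonormality removes the mixed ones.\<close>
    have "h11\<^sup>2 + h22\<^sup>2 + h33\<^sup>2 + 2 * h12\<^sup>2 + 2 * h13\<^sup>2 + 2 * h23\<^sup>2 =
      k1\<^sup>2 * (x1*x1 + x2*x2 + x3*x3)\<^sup>2 + k2\<^sup>2 * (y1*y1 + y2*y2 + y3*y3)\<^sup>2 + k3\<^sup>2 * (z1*z1 + z2*z2 + z3*z3)\<^sup>2
      + 2 * k1 * k2 * (x1*y1 + x2*y2 + x3*y3)\<^sup>2 + 2 * k1 * k3 * (x1*z1 + x2*z2 + x3*z3)\<^sup>2
      + 2 * k2 * k3 * (y1*z1 + y2*z2 + y3*z3)\<^sup>2"
      unfolding hdefs by algebra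
    then show "h11\<^sup>2 + h22\<^sup>2 + h33\<^sup>2 + 2 * h12\<^sup>2 + 2 * h13\<^sup>2 + 2 * h23\<^sup>2 = k1\<^sup>2 + k2\<^sup>2 + k3\<^sup>2"
      unfolding rows by simp
    fix U \<phi> u v assume c: "chart M U \<phi>" "u \<in> U" "\<phi> u = x"
    note cd = chartD[OF c(1,2)]
    define D where "D = frechet_derivative \<phi> (at u)"
    define DN where "DN = frechet_derivative (N \<circ> \<phi>) (at u)"
    have lin: "linear D" "linear DN"
      using cd(4,6) has_derivative_linear unfolding D_def DN_def by blast+
    note pre = ex_preimage[OF c(1,2), unfolded c(3), OF E, folded D_def]
    obtain v1 v2 v3 where v: "D v1 = e1" "D v2 = e2" "D v3 = e3"
      using pre[OF tan(1)] pre[OF tan(2)] pre[OF tan(3)] by blast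
    have pdv: "pmetric (DN v1 + k1 *\<^sub>R e1) X = 0" "pmetric (DN v2 + k2 *\<^sub>R e2) X = 0"
        "pmetric (DN v3 + k3 *\<^sub>R e3) X = 0" if "X \<in> tangent_space M x" for X
      using pd v c that unfolding principal_dir_def D_def DN_def by metis+
    define w1 w2 w3 where "w1 = pmetric (D v) E1" "w2 = pmetric (D v) E2" "w3 = pmetric (D v) E3"
    have Dv: "D v = w1 *\<^sub>R E1 + w2 *\<^sub>R E2 + w3 *\<^sub>R E3"
      using E tangential_derivative[OF c(1,2), of v] c(3) unfolding tframe_def w1_w2_w3_def D_def by blast
    \<comment> \<open>Components of the velocity in the principal basis. Injectivity of
      \<open>D\<close> lifts this decomposition to the parameter space, where linearity of
      \<open>DN\<close> applies.\<close>
    define c1 c2 c3 where "c1 = x1*w1 + x2*w2 + x3*w3" "c2 = y1*w1 + y2*w2 + y3*w3" "c3 = z1*w1 + z2*w2 + z3*w3"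
    have cw: "c1 * x1 + c2 * y1 + c3 * z1 = w1" "c1 * x2 + c2 * y2 + c3 * z2 = w2" "c1 * x3 + c2 * y3 + c3 * z3 = w3"
    proof -
      have "c1 * x1 + c2 * y1 + c3 * z1 = w1 * (x1*x1 + y1*y1 + z1*z1) + w2 * (x1*x2 + y1*y2 + z1*z2) + w3 * (x1*x3 + y1*y3 + z1*z3)"
        unfolding c1_c2_c3_def by algebra
      then show "c1 * x1 + c2 * y1 + c3 * z1 = w1" using cols by simp
      have "c1 * x2 + c2 * y2 + c3 * z2 = w1 * (x1*x2 + y1*y2 + z1*z2) + w2 * (x2*x2 + y2*y2 + z2*z2) + w3 * (x2*x3 + y2*y3 + z2*z3)"
        unfolding c1_c2_c3_def by algebra
      then show "c1 * x2 + c2 * y2 + c3 * z2 = w2" using cols by simp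
      have "c1 * x3 + c2 * y3 + c3 * z3 = w1 * (x1*x3 + y1*y3 + z1*z3) + w2 * (x2*x3 + y2*y3 + z2*z3) + w3 * (x3*x3 + y3*y3 + z3*z3)"
        unfolding c1_c2_c3_def by algebra
      then show "c1 * x3 + c2 * y3 + c3 * z3 = w3" using cols by simp
    qed
    have "D (c1 *\<^sub>R v1 + c2 *\<^sub>R v2 + c3 *\<^sub>R v3) = (c1 * x1 + c2 * y1 + c3 * z1) *\<^sub>R E1
        + (c1 * x2 + c2 * y2 + c3 * z2) *\<^sub>R E2 + (c1 * x3 + c2 * y3 + c3 * z3) *\<^sub>R E3"
      by (simp add: linear_add[OF lin(1)] linear_scale[OF lin(1)] v ex algebra_simps)
    then have "D (c1 *\<^sub>R v1 + c2 *\<^sub>R v2 + c3 *\<^sub>R v3) = D v" unfolding cw Dv .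
    then have vv: "v = c1 *\<^sub>R v1 + c2 *\<^sub>R v2 + c3 *\<^sub>R v3"
      using cd(3) unfolding D_def by (metis injD)
    have DNv: "pmetric (DN v) X = - (c1 * k1 * pmetric e1 X + c2 * k2 * pmetric e2 X + c3 * k3 * pmetric e3 X)"
      if "X \<in> tangent_space M x" for X
    proof -
      have "pmetric (DN v1) X = - k1 * pmetric e1 X" "pmetric (DN v2) X = - k2 * pmetric e2 X"
        "pmetric (DN v3) X = - k3 * pmetric e3 X"
        using pdv[OF that] by (simp_all add: pmetric_simps)
      then show ?thesis
        unfolding vv by (simp add: linear_add[OF lin(2)] linear_scale[OF lin(2)] pmetric_simps)
    qed
    have "pmetric (DN v) E1 = - (h11 * w1 + h12 * w2 + h13 * w3)"
      unfolding DNv[OF ETan(1)] x1_x2_x3_def(1)[symmetric] y1_y2_y3_def(1)[symmetric] z1_z2_z3_def(1)[symmetric]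
        c1_c2_c3_def hdefs by algebra
    moreover have "pmetric (DN v) E2 = - (h12 * w1 + h22 * w2 + h23 * w3)"
      unfolding DNv[OF ETan(2)] x1_x2_x3_def(2)[symmetric] y1_y2_y3_def(2)[symmetric] z1_z2_z3_def(2)[symmetric]
        c1_c2_c3_def hdefs by algebra
    moreover have "pmetric (DN v) E3 = - (h13 * w1 + h23 * w2 + h33 * w3)"
      unfolding DNv[OF ETan(3)] x1_x2_x3_def(3)[symmetric] y1_y2_y3_def(3)[symmetric] z1_z2_z3_def(3)[symmetric]
        c1_c2_c3_def hdefs by algebra
    ultimately show "let X = frechet_derivative \<phi> (at u) v; Y = frechet_derivative (N \<circ> \<phi>) (at u) v in
        pmetric Y E1 = - (h11 * pmetric X E1 + h12 * pmetric X E2 + h13 * pmetric X E3) \<and>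
        pmetric Y E2 = - (h12 * pmetric X E1 + h22 * pmetric X E2 + h23 * pmetric X E3) \<and>
        pmetric Y E3 = - (h13 * pmetric X E1 + h23 * pmetric X E2 + h33 * pmetric X E3)"
      unfolding Let_def w1_w2_w3_def D_def DN_def by blast
  qed
qed

end

section \<open>Generic product angle\<close>

locale cpc_generic = cpc_hypersurface +
  assumes C: "-1 < C" "C < 1"
begin

definition a :: real where "a = sqrt ((1 - C) / 2)"
definition b :: real where "b = sqrt ((1 + C) / 2)"
definition n1 :: "pt \<Rightarrow> real^3" where "n1 x = (1 / b) *\<^sub>R fst (N x)"
definition n2 :: "pt \<Rightarrow> real^3" where "n2 x = (1 / a) *\<^sub>R snd (N x)"
definition t1 :: "pt \<Rightarrow> real^3" where "t1 x = lcross (fst x) (n1 x)"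
definition t2 :: "pt \<Rightarrow> real^3" where "t2 x = lcross (snd x) (n2 x)"

lemma ab: "a > 0" "b > 0" "a\<^sup>2 = (1 - C) / 2" "b\<^sup>2 = (1 + C) / 2"
  using C by (auto simp: a_def b_def)

lemma ab_sum: "a\<^sup>2 + b\<^sup>2 = 1"
  by (simp add: ab field_simps)

lemma N_eq: "N x = (b *\<^sub>R n1 x, a *\<^sub>R n2 x)"
  using ab by (simp add: n1_def n2_def)

lemma lframe1: assumes "x \<in> M" shows "lframe (fst x) (n1 x) (t1 x)"
  unfolding t1_def
proof (rule lframe_lcross)
  show "lor (fst x) (fst x) = -1" using M_H2 H2D assms by blast
  show "lor (fst x) (n1 x) = 0" using N_orth assms by (simp add: n1_def lor_simps)
  show "lor (n1 x) (n1 x) = 1"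
    using N_norms[OF assms] ab by (simp add: n1_def lor_simps power2_eq_square[symmetric] field_simps)
qed

lemma lframe2: assumes "x \<in> M" shows "lframe (snd x) (n2 x) (t2 x)"
  unfolding t2_def
proof (rule lframe_lcross)
  show "lor (snd x) (snd x) = -1" using M_H2 H2D assms by blast
  show "lor (snd x) (n2 x) = 0" using N_orth assms by (simp add: n2_def lor_simps)
  show "lor (n2 x) (n2 x) = 1"
    using N_norms[OF assms] ab by (simp add: n2_def lor_simps power2_eq_square[symmetric] field_simps)
qed

lemma adapted_tframe:
  "x \<in> M \<Longrightarrow> tframe N x (t1 x, 0) (0, t2 x) (a *\<^sub>R n1 x, - b *\<^sub>R n2 x)"
  by (intro tframe_of_lframes lframe1 lframe2 ab_sum N_eq)

end

locale cpc_chart = cpc_generic +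
  fixes U \<phi>
  assumes chart: "chart M U \<phi>"
begin

abbreviation "D u \<equiv> frechet_derivative \<phi> (at u)"
abbreviation "DN u \<equiv> frechet_derivative (N \<circ> \<phi>) (at u)"

sublocale F1: moving_frame U "\<lambda>u. fst (\<phi> u)" "\<lambda>u. n1 (\<phi> u)" "\<lambda>u v. fst (D u v)" "\<lambda>u v. (1 / b) *\<^sub>R fst (DN u v)"
  "\<lambda>u v w. fst (frechet_derivative (\<lambda>u. D u v) (at u) w)" "\<lambda>u v w. (1 / b) *\<^sub>R fst (frechet_derivative (\<lambda>u. DN u v) (at u) w)"
proof
  show "open U" using chart by (simp add: chart_def)
  fix u v assume u: "u \<in> U"
  note c = chartD[OF chart u]
  show "((\<lambda>u. fst (\<phi> u)) has_derivative (\<lambda>v. fst (D u v))) (at u)"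
    "((\<lambda>u. fst (D u v)) has_derivative (\<lambda>w. fst (frechet_derivative (\<lambda>u. D u v) (at u) w))) (at u)"
    by (intro has_derivative_fst c)+
  show "((\<lambda>u. n1 (\<phi> u)) has_derivative (\<lambda>v. (1 / b) *\<^sub>R fst (DN u v))) (at u)"
    "((\<lambda>u. (1 / b) *\<^sub>R fst (DN u v)) has_derivative (\<lambda>w. (1 / b) *\<^sub>R fst (frechet_derivative (\<lambda>u. DN u v) (at u) w))) (at u)"
    unfolding n1_def by (intro has_derivative_scaleR_right has_derivative_fst c)+
  show "lor (fst (\<phi> u)) (fst (\<phi> u)) = - 1" "lor (fst (\<phi> u)) (n1 (\<phi> u)) = 0" "lor (n1 (\<phi> u)) (n1 (\<phi> u)) = 1"
    using lframeD[OF lframe1[OF c(2)]] by blast+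
qed

sublocale F2: moving_frame U "\<lambda>u. snd (\<phi> u)" "\<lambda>u. n2 (\<phi> u)" "\<lambda>u v. snd (D u v)" "\<lambda>u v. (1 / a) *\<^sub>R snd (DN u v)"
  "\<lambda>u v w. snd (frechet_derivative (\<lambda>u. D u v) (at u) w)" "\<lambda>u v w. (1 / a) *\<^sub>R snd (frechet_derivative (\<lambda>u. DN u v) (at u) w)"
proof
  show "open U" using chart by (simp add: chart_def)
  fix u v assume u: "u \<in> U"
  note c = chartD[OF chart u]
  show "((\<lambda>u. snd (\<phi> u)) has_derivative (\<lambda>v. snd (D u v))) (at u)"
    "((\<lambda>u. snd (D u v)) has_derivative (\<lambda>w. snd (frechet_derivative (\<lambda>u. D u v) (at u) w))) (at u)"
    by (intro has_derivative_snd c)+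
  show "((\<lambda>u. n2 (\<phi> u)) has_derivative (\<lambda>v. (1 / a) *\<^sub>R snd (DN u v))) (at u)"
    "((\<lambda>u. (1 / a) *\<^sub>R snd (DN u v)) has_derivative (\<lambda>w. (1 / a) *\<^sub>R snd (frechet_derivative (\<lambda>u. DN u v) (at u) w))) (at u)"
    unfolding n2_def by (intro has_derivative_scaleR_right has_derivative_snd c)+
  show "lor (snd (\<phi> u)) (snd (\<phi> u)) = - 1" "lor (snd (\<phi> u)) (n2 (\<phi> u)) = 0" "lor (n2 (\<phi> u)) (n2 (\<phi> u)) = 1"
    using lframeD[OF lframe2[OF c(2)]] by blast+
qed

lemma t_eq: "F1.t u = t1 (\<phi> u)" "F2.t u = t2 (\<phi> u)"
  by (simp_all add: F1.t_def F2.t_def t1_def t2_def)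

text \<open>The form dual to \<open>(a n1, - b n2)\<close>, the tangent direction that mixes the
  factors. Orthogonality to \<open>N\<close> makes the normal components of both factors multiples
  of it.\<close>

definition nu where "nu u v = F1.thn u v / a"

lemma thn_nu:
  assumes "u \<in> U"
  shows "F1.thn u v = a * nu u v" "F2.thn u v = - b * nu u v"
proof -
  show *: "F1.thn u v = a * nu u v" using ab by (simp add: nu_def)
  have "pmetric (b *\<^sub>R n1 (\<phi> u), a *\<^sub>R n2 (\<phi> u)) (D u v) = 0"
    using tangential_derivative[OF chart assms, of v] N_eq[of "\<phi> u"] unfolding tangential_def by metis
  then have "b * F1.thn u v + a * F2.thn u v = 0"
    by (simp add: pmetric_def lor_simps F1.thn_def F2.thn_def lor_commute)
  then have "a * (F2.thn u v + b * nu u v) = 0" unfolding * by (simp add: algebra_simps)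
  then show "F2.thn u v = - b * nu u v" using ab by simp
qed

lemma pmetric_D:
  assumes "u \<in> U"
  shows "pmetric (D u v) (t1 (\<phi> u), 0) = F1.tht u v" "pmetric (D u v) (0, t2 (\<phi> u)) = F2.tht u v"
    "pmetric (D u v) (a *\<^sub>R n1 (\<phi> u), - b *\<^sub>R n2 (\<phi> u)) = nu u v"
proof -
  show "pmetric (D u v) (t1 (\<phi> u), 0) = F1.tht u v" "pmetric (D u v) (0, t2 (\<phi> u)) = F2.tht u v"
    by (simp_all add: pmetric_def F1.tht_def F2.tht_def t_eq lor_simps)
  have "pmetric (D u v) (a *\<^sub>R n1 (\<phi> u), - b *\<^sub>R n2 (\<phi> u)) = a * F1.thn u v - b * F2.thn u v"
    by (simp add: pmetric_def F1.thn_def F2.thn_def lor_simps)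
  also have "\<dots> = (a\<^sup>2 + b\<^sup>2) * nu u v"
    unfolding thn_nu[OF assms] by (simp add: power2_eq_square algebra_simps)
  finally show "pmetric (D u v) (a *\<^sub>R n1 (\<phi> u), - b *\<^sub>R n2 (\<phi> u)) = nu u v"
    using ab_sum by simp
qed

text \<open>Both parts of \<open>N\<close> have constant length, so their derivatives have no
  component along \<open>n1\<close> or \<open>n2\<close>. This is what makes
  \<open>(a n1, - b n2)\<close> a direction of curvature \<open>0\<close>.\<close>

lemma pmetric_DN:
  assumes "u \<in> U"
  shows "pmetric (DN u v) (t1 (\<phi> u), 0) = b * F1.om u v" "pmetric (DN u v) (0, t2 (\<phi> u)) = a * F2.om u v"
    "pmetric (DN u v) (a *\<^sub>R n1 (\<phi> u), - b *\<^sub>R n2 (\<phi> u)) = 0"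
proof -
  have e: "fst (DN u v) = b *\<^sub>R (F1.thn u v *\<^sub>R fst (\<phi> u) + F1.om u v *\<^sub>R F1.t u)"
    "snd (DN u v) = a *\<^sub>R (F2.thn u v *\<^sub>R snd (\<phi> u) + F2.om u v *\<^sub>R F2.t u)"
    unfolding F1.n'_expand[OF assms, symmetric] F2.n'_expand[OF assms, symmetric] using ab by simp_all
  show "pmetric (DN u v) (t1 (\<phi> u), 0) = b * F1.om u v" "pmetric (DN u v) (0, t2 (\<phi> u)) = a * F2.om u v"
    using ab by (simp_all add: pmetric_def F1.om_def F2.om_def t_eq lor_simps)
  show "pmetric (DN u v) (a *\<^sub>R n1 (\<phi> u), - b *\<^sub>R n2 (\<phi> u)) = 0"
    unfolding pmetric_def e
    using lframeD[OF F1.frame[OF assms]] lframeD[OF F2.frame[OF assms]]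
    by (simp add: lor_simps)
qed

lemma ex_dual:
  assumes "u \<in> U"
  shows "\<exists>v. F1.tht u v = y1 \<and> F2.tht u v = y2 \<and> nu u v = y3"
  using ex_coords[OF chart assms adapted_tframe[OF chartD(2)[OF chart assms]], of y1 y2 y3]
  unfolding pmetric_D[OF assms] .

end

context cpc_generic begin

text \<open>The weights \<open>a\<close> and \<open>b\<close> at \<mu> encode the symmetry of the
  shape operator: both off-diagonal entries become \<open>- a * b * \<mu>\<close>. Quantifying over
  all charts makes the coefficients functions of the point alone.\<close>

definition shape_at :: "pt \<Rightarrow> real \<Rightarrow> real \<Rightarrow> real \<Rightarrow> bool" where
  "shape_at x \<alpha> \<mu> \<delta> \<longleftrightarrow> (\<forall>U \<phi> u v. chart M U \<phi> \<and> u \<in> U \<and> \<phi> u = x \<longrightarrow>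
     (let p' = fst (frechet_derivative \<phi> (at u) v); q' = snd (frechet_derivative \<phi> (at u) v);
          N' = frechet_derivative (N \<circ> \<phi>) (at u) v in
      lor ((1 / b) *\<^sub>R fst N') (t1 x) = \<alpha> * lor p' (t1 x) + a * \<mu> * lor q' (t2 x) \<and>
      lor ((1 / a) *\<^sub>R snd N') (t2 x) = b * \<mu> * lor p' (t1 x) + \<delta> * lor q' (t2 x)))"

lemma ex_shape:
  assumes x: "x \<in> M"
  shows "\<exists>\<alpha> \<mu> \<delta>. shape_at x \<alpha> \<mu> \<delta> \<and> b * \<alpha> + a * \<delta> = - (k1 + k2 + k3)
    \<and> b\<^sup>2 * \<alpha>\<^sup>2 + a\<^sup>2 * \<delta>\<^sup>2 + 2 * a\<^sup>2 * b\<^sup>2 * \<mu>\<^sup>2 = k1\<^sup>2 + k2\<^sup>2 + k3\<^sup>2"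
proof -
  obtain h11 h12 h13 h22 h23 h33 where H:
    "\<And>U \<phi> u v. \<lbrakk>chart M U \<phi>; u \<in> U; \<phi> u = x\<rbrakk> \<Longrightarrow>
       (let X = frechet_derivative \<phi> (at u) v; Y = frechet_derivative (N \<circ> \<phi>) (at u) v in
        pmetric Y (t1 x, 0) = - (h11 * pmetric X (t1 x, 0) + h12 * pmetric X (0, t2 x) + h13 * pmetric X (a *\<^sub>R n1 x, - b *\<^sub>R n2 x)) \<and>
        pmetric Y (0, t2 x) = - (h12 * pmetric X (t1 x, 0) + h22 * pmetric X (0, t2 x) + h23 * pmetric X (a *\<^sub>R n1 x, - b *\<^sub>R n2 x)) \<and>
        pmetric Y (a *\<^sub>R n1 x, - b *\<^sub>R n2 x) = - (h13 * pmetric X (t1 x, 0) + h23 * pmetric X (0, t2 x) + h33 * pmetric X (a *\<^sub>R n1 x, - b *\<^sub>R n2 x)))"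
    and tr: "h11 + h22 + h33 = k1 + k2 + k3"
    "h11\<^sup>2 + h22\<^sup>2 + h33\<^sup>2 + 2 * h12\<^sup>2 + 2 * h13\<^sup>2 + 2 * h23\<^sup>2 = k1\<^sup>2 + k2\<^sup>2 + k3\<^sup>2"
    by (rule shape_matrix[OF x adapted_tframe[OF x]]) (rule that; assumption)
  have zero: "h13 = 0" "h23 = 0" "h33 = 0"
  proof -
    obtain U \<phi> u where c: "chart M U \<phi>" "u \<in> U" "\<phi> u = x" using ex_chart[OF x] by blast
    interpret cpc_chart M N C k1 k2 k3 U \<phi> by unfold_locales (rule c(1))
    \<comment> \<open>The last row of the matrix, to be tested on the basis dual to the three
      forms.\<close>
    have 0: "h13 * F1.tht u v + h23 * F2.tht u v + h33 * nu u v = 0" for v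
      using H[OF c, of v] pmetric_DN[OF c(2), of v] pmetric_D[OF c(2), of v] unfolding Let_def c(3) by simp
    obtain v1 v2 v3 where "F1.tht u v1 = 1 \<and> F2.tht u v1 = 0 \<and> nu u v1 = 0"
      "F1.tht u v2 = 0 \<and> F2.tht u v2 = 1 \<and> nu u v2 = 0" "F1.tht u v3 = 0 \<and> F2.tht u v3 = 0 \<and> nu u v3 = 1"
      using ex_dual[OF c(2)] by metis
    then show "h13 = 0" "h23 = 0" "h33 = 0"
      using 0[of v1] 0[of v2] 0[of v3] by simp_all
  qed
  define \<alpha> where "\<alpha> = - h11 / b"
  define \<mu> where "\<mu> = - h12 / (a * b)"
  define \<delta> where "\<delta> = - h22 / a"
  have h: "h11 = - b * \<alpha>" "h12 = - a * b * \<mu>" "h22 = - a * \<delta>"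
    using ab by (simp_all add: \<alpha>_def \<mu>_def \<delta>_def)
  have "shape_at x \<alpha> \<mu> \<delta>"
    unfolding shape_at_def
  proof (intro allI impI, elim conjE)
    fix U \<phi> u v assume c: "chart M U \<phi>" "u \<in> U" "\<phi> u = x"
    interpret cpc_chart M N C k1 k2 k3 U \<phi> by unfold_locales (rule c(1))
    have "b * F1.om u v = b * \<alpha> * F1.tht u v + a * b * \<mu> * F2.tht u v"
      "a * F2.om u v = a * b * \<mu> * F1.tht u v + a * \<delta> * F2.tht u v"
      using H[OF c, of v] pmetric_DN[OF c(2), of v] pmetric_D[OF c(2), of v] unfolding Let_def c(3) zero h by simp_all
    then have "b * F1.om u v = b * (\<alpha> * F1.tht u v + a * \<mu> * F2.tht u v)"
      "a * F2.om u v = a * (b * \<mu> * F1.tht u v + \<delta> * F2.tht u v)"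
      by (simp_all add: algebra_simps)
    then have "F1.om u v = \<alpha> * F1.tht u v + a * \<mu> * F2.tht u v"
      "F2.om u v = b * \<mu> * F1.tht u v + \<delta> * F2.tht u v"
      using ab by (metis less_numeral_extra(3) mult_left_cancel)+
    then show "let p' = fst (D u v); q' = snd (D u v); N' = DN u v in
      lor ((1 / b) *\<^sub>R fst N') (t1 x) = \<alpha> * lor p' (t1 x) + a * \<mu> * lor q' (t2 x) \<and>
      lor ((1 / a) *\<^sub>R snd N') (t2 x) = b * \<mu> * lor p' (t1 x) + \<delta> * lor q' (t2 x)"
      unfolding F1.om_def F2.om_def F1.tht_def F2.tht_def t_eq c(3) Let_def by blast
  qed
  moreover have "b * \<alpha> + a * \<delta> = - (k1 + k2 + k3)"
    using tr(1) unfolding zero h by simp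
  moreover have "b\<^sup>2 * \<alpha>\<^sup>2 + a\<^sup>2 * \<delta>\<^sup>2 + 2 * a\<^sup>2 * b\<^sup>2 * \<mu>\<^sup>2 = k1\<^sup>2 + k2\<^sup>2 + k3\<^sup>2"
    using tr(2) unfolding zero h by (simp add: power_mult_distrib)
  ultimately show ?thesis by blast
qed

end

section \<open>The structure equations along a chart\<close>

text \<open>The determinant of three linear forms on three vectors, indexed by
  \<open>1, 2, 3\<close>, for Cramer's rule.\<close>

definition det3 :: "(nat \<Rightarrow> real) \<Rightarrow> (nat \<Rightarrow> real) \<Rightarrow> (nat \<Rightarrow> real) \<Rightarrow> real" where
  "det3 f g h = f 1 * (g 2 * h 3 - g 3 * h 2) - f 2 * (g 1 * h 3 - g 3 * h 1) + f 3 * (g 1 * h 2 - g 2 * h 1)"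

locale cpc_shape = cpc_generic +
  fixes al mu de :: "pt \<Rightarrow> real"
  assumes nonempty: "M \<noteq> {}"
    and shape: "x \<in> M \<Longrightarrow> shape_at x (al x) (mu x) (de x)"
    and trace: "x \<in> M \<Longrightarrow> b * al x + a * de x = - (k1 + k2 + k3)"
    and trace2: "x \<in> M \<Longrightarrow> b\<^sup>2 * (al x)\<^sup>2 + a\<^sup>2 * (de x)\<^sup>2 + 2 * a\<^sup>2 * b\<^sup>2 * (mu x)\<^sup>2 = k1\<^sup>2 + k2\<^sup>2 + k3\<^sup>2"
begin

definition T :: real where "T = - (k1 + k2 + k3)"
text \<open>The second elementary symmetric function of the curvatures divided by
  \<open>a * b\<close>; as one curvature is \<open>0\<close>, this is the rescaled determinant of
  the remaining block.\<close>

definition Q :: real where "Q = (T\<^sup>2 - (k1\<^sup>2 + k2\<^sup>2 + k3\<^sup>2)) / (2 * a * b)"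

lemma T: "x \<in> M \<Longrightarrow> b * al x + a * de x = T"
  using trace by (simp add: T_def)

lemma Q: assumes "x \<in> M" shows "al x * de x - a * b * (mu x)\<^sup>2 = Q"
proof -
  have "T\<^sup>2 - (k1\<^sup>2 + k2\<^sup>2 + k3\<^sup>2) = (2 * a * b) * (al x * de x - a * b * (mu x)\<^sup>2)"
    unfolding T[OF assms, symmetric] trace2[OF assms, symmetric] by algebra
  then show ?thesis using ab(1,2) by (simp add: Q_def)
qed

end

locale cpc_shape_chart = cpc_shape M N C k1 k2 k3 al mu de + cpc_chart M N C k1 k2 k3 U \<phi>
  for M N C k1 k2 k3 al mu de U \<phi>
begin

lemma phi_M: "u \<in> U \<Longrightarrow> \<phi> u \<in> M"
  using chartD(2)[OF chart] .

lemma om_eq: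
  assumes "u \<in> U"
  shows "F1.om u v = al (\<phi> u) * F1.tht u v + a * mu (\<phi> u) * F2.tht u v"
    "F2.om u v = b * mu (\<phi> u) * F1.tht u v + de (\<phi> u) * F2.tht u v"
  using shape[OF phi_M[OF assms], unfolded shape_at_def Let_def, rule_format, of U \<phi> u v] chart assms
  unfolding F1.om_def F2.om_def F1.tht_def F2.tht_def t_eq by blast+

lemma nu_der: "u \<in> U \<Longrightarrow> ((\<lambda>u. nu u v) has_derivative (\<lambda>w. F1.thn' u v w / a)) (at u)"
  unfolding nu_def using F1.thn_der[of u v] ab(1,2) by (auto intro!: derivative_eq_intros)

lemma forms_differentiable:
  assumes "u \<in> U"
  shows "(\<lambda>u. F1.tht u v) differentiable (at u)" "(\<lambda>u. F2.tht u v) differentiable (at u)"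
    "(\<lambda>u. F1.om u v) differentiable (at u)" "(\<lambda>u. F2.om u v) differentiable (at u)"
    "(\<lambda>u. nu u v) differentiable (at u)"
  using F1.tht_der[OF assms] F2.tht_der[OF assms] F1.om_der[OF assms] F2.om_der[OF assms] nu_der[OF assms]
  unfolding differentiable_def by blast+

text \<open>The coefficients were chosen point by point. Cramer's rule expresses them as quotients
  of determinants of the forms, and the forms are differentiable.\<close>

lemma coefficients_differentiable:
  assumes u: "u \<in> U"
  shows "(\<lambda>u. al (\<phi> u)) differentiable (at u)" "(\<lambda>u. mu (\<phi> u)) differentiable (at u)"
    "(\<lambda>u. de (\<phi> u)) differentiable (at u)"
proof -
  obtain v1 v2 v3 where v: "F1.tht u v1 = 1 \<and> F2.tht u v1 = 0 \<and> nu u v1 = 0"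
    "F1.tht u v2 = 0 \<and> F2.tht u v2 = 1 \<and> nu u v2 = 0" "F1.tht u v3 = 0 \<and> F2.tht u v3 = 0 \<and> nu u v3 = 1"
    using ex_dual[OF u] by metis
  \<comment> \<open>The vectors are frozen at \<open>u\<close>; the denominator \<open>d\<close>
    equals \<open>1\<close> there and is nonzero on the open set \<open>W\<close>.\<close>
  define V :: "nat \<Rightarrow> real^3" where "V i = (if i = 1 then v1 else if i = 2 then v2 else v3)" for i
  define d where "d w = det3 (\<lambda>i. F1.tht w (V i)) (\<lambda>i. F2.tht w (V i)) (\<lambda>i. nu w (V i))" for w
  define g1 where "g1 w = det3 (\<lambda>i. F1.om w (V i)) (\<lambda>i. F2.tht w (V i)) (\<lambda>i. nu w (V i))" for w
  define g2 where "g2 w = det3 (\<lambda>i. F1.tht w (V i)) (\<lambda>i. F1.om w (V i)) (\<lambda>i. nu w (V i))" for w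
  define g3 where "g3 w = det3 (\<lambda>i. F1.tht w (V i)) (\<lambda>i. F2.om w (V i)) (\<lambda>i. nu w (V i))" for w
  have diff: "d differentiable (at w)" "g1 differentiable (at w)" "g2 differentiable (at w)" "g3 differentiable (at w)"
    if "w \<in> U" for w
    unfolding d_def[abs_def] g1_def[abs_def] g2_def[abs_def] g3_def[abs_def] det3_def
    by (intro differentiable_add differentiable_diff differentiable_mult forms_differentiable[OF that])+
  have g: "g1 w = al (\<phi> w) * d w" "g2 w = a * mu (\<phi> w) * d w" "g3 w = de (\<phi> w) * d w" if "w \<in> U" for w
    unfolding d_def g1_def g2_def g3_def det3_def om_eq[OF that] by algebra+
  define W where "W = {w \<in> U. d w \<noteq> 0}"
  have "continuous_on U d"
    using diff(1) by (meson continuous_at_imp_continuous_on differentiable_imp_continuous_within)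
  then have "open W"
    using continuous_open_preimage[OF _ F1.U, of d "- {0}"] open_delete[OF open_UNIV, of "0::real"]
    by (simp add: W_def Compl_eq_Diff_UNIV vimage_def Int_def)
  have "d u = 1" by (simp add: d_def det3_def V_def v)
  then have "u \<in> W" using u by (simp add: W_def)
  have quot: "f differentiable (at u)"
    if "g differentiable (at u)" "\<And>w. w \<in> W \<Longrightarrow> g w / d w = f w" for f g :: "real^3 \<Rightarrow> real"
  proof -
    have "(\<lambda>w. g w / d w) differentiable (at u)"
      using that(1) diff(1)[OF u] \<open>d u = 1\<close> by (intro differentiable_divide) auto
    then obtain L where "((\<lambda>w. g w / d w) has_derivative L) (at u)" by (auto simp: differentiable_def)
    then have "(f has_derivative L) (at u)"
      by (rule has_derivative_transform_within_open[OF _ \<open>open W\<close> \<open>u \<in> W\<close>]) (rule that(2))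
    then show ?thesis by (auto simp: differentiable_def)
  qed
  show "(\<lambda>u. al (\<phi> u)) differentiable (at u)" "(\<lambda>u. de (\<phi> u)) differentiable (at u)"
    by (rule quot[OF diff(2)[OF u]], simp add: W_def g) (rule quot[OF diff(4)[OF u]], simp add: W_def g)
  have "(\<lambda>u. a * mu (\<phi> u)) differentiable (at u)"
    by (rule quot[OF diff(3)[OF u]]) (simp add: W_def g)
  then have "(\<lambda>u. (1 / a) * (a * mu (\<phi> u))) differentiable (at u)"
    by (rule differentiable_mult[OF differentiable_const])
  then show "(\<lambda>u. mu (\<phi> u)) differentiable (at u)" using ab(1,2) by simp
qed

definition "al' u = frechet_derivative (\<lambda>u. al (\<phi> u)) (at u)"
definition "mu' u = frechet_derivative (\<lambda>u. mu (\<phi> u)) (at u)"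
definition "de' u = frechet_derivative (\<lambda>u. de (\<phi> u)) (at u)"

lemma coefficients_der:
  assumes "u \<in> U"
  shows "((\<lambda>u. al (\<phi> u)) has_derivative al' u) (at u)" "((\<lambda>u. mu (\<phi> u)) has_derivative mu' u) (at u)"
    "((\<lambda>u. de (\<phi> u)) has_derivative de' u) (at u)"
  using coefficients_differentiable[OF assms] frechet_derivative_works
  unfolding al'_def mu'_def de'_def by blast+

lemma der_T: assumes u: "u \<in> U" shows "b * al' u v + a * de' u v = 0"
proof (rule has_derivative_const_on_open[OF F1.U u, where c = T])
  show "((\<lambda>u. b * al (\<phi> u) + a * de (\<phi> u)) has_derivative (\<lambda>v. b * al' u v + a * de' u v)) (at u)"
    using coefficients_der[OF u] by (auto intro!: derivative_eq_intros)
qed (rule T[OF phi_M])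

lemma der_Q:
  assumes u: "u \<in> U"
  shows "al' u v * de (\<phi> u) + al (\<phi> u) * de' u v - 2 * a * b * mu (\<phi> u) * mu' u v = 0"
proof (rule has_derivative_const_on_open[OF F1.U u, where c = Q])
  show "((\<lambda>u. al (\<phi> u) * de (\<phi> u) - a * b * (mu (\<phi> u))\<^sup>2) has_derivative
      (\<lambda>v. al' u v * de (\<phi> u) + al (\<phi> u) * de' u v - 2 * a * b * mu (\<phi> u) * mu' u v)) (at u)"
    using coefficients_der[OF u] by (auto intro!: derivative_eq_intros simp: fun_eq_iff algebra_simps)
qed (rule Q[OF phi_M])

lemma om'_eq:
  assumes u: "u \<in> U"
  shows "F1.om' u w v = al' u v * F1.tht u w + al (\<phi> u) * F1.tht' u w v
      + a * (mu' u v * F2.tht u w + mu (\<phi> u) * F2.tht' u w v)"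
    "F2.om' u w v = b * (mu' u v * F1.tht u w + mu (\<phi> u) * F1.tht' u w v)
      + de' u v * F2.tht u w + de (\<phi> u) * F2.tht' u w v"
proof -
  note der = coefficients_der[OF u] F1.tht_der[OF u, of w] F2.tht_der[OF u, of w]
    F1.om_der[OF u, of w] F2.om_der[OF u, of w]
  have "((\<lambda>u. F1.om u w - (al (\<phi> u) * F1.tht u w + a * mu (\<phi> u) * F2.tht u w)) has_derivative
    (\<lambda>v. F1.om' u w v - (al' u v * F1.tht u w + al (\<phi> u) * F1.tht' u w v
      + a * (mu' u v * F2.tht u w + mu (\<phi> u) * F2.tht' u w v)))) (at u)"
    by (rule derivative_eq_intros der refl)+ (simp add: fun_eq_iff algebra_simps)
  from has_derivative_const_on_open[OF F1.U u _ this, of 0 v]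
  show "F1.om' u w v = al' u v * F1.tht u w + al (\<phi> u) * F1.tht' u w v
      + a * (mu' u v * F2.tht u w + mu (\<phi> u) * F2.tht' u w v)"
    using om_eq by simp
  have "((\<lambda>u. F2.om u w - (b * mu (\<phi> u) * F1.tht u w + de (\<phi> u) * F2.tht u w)) has_derivative
    (\<lambda>v. F2.om' u w v - (b * (mu' u v * F1.tht u w + mu (\<phi> u) * F1.tht' u w v)
      + de' u v * F2.tht u w + de (\<phi> u) * F2.tht' u w v))) (at u)"
    by (rule derivative_eq_intros der refl)+ (simp add: fun_eq_iff algebra_simps)
  from has_derivative_const_on_open[OF F1.U u _ this, of 0 v]
  show "F2.om' u w v = b * (mu' u v * F1.tht u w + mu (\<phi> u) * F1.tht' u w v)
      + de' u v * F2.tht u w + de (\<phi> u) * F2.tht' u w v"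
    using om_eq by simp
qed

text \<open>Exterior differentiation of \<open>om_eq\<close>: the structure equations replace the
  derivatives of all forms, so only those of the coefficients remain. The pairs
  \<open>(v3, v1)\<close> and \<open>(v3, v2)\<close> give the Riccati system,
  \<open>(v1, v2)\<close> the mixed identities.\<close>

lemma codazzi:
  assumes u: "u \<in> U"
    and v1: "F1.tht u v1 = 1" "F2.tht u v1 = 0" "nu u v1 = 0"
    and v2: "F1.tht u v2 = 0" "F2.tht u v2 = 1" "nu u v2 = 0"
    and v3: "F1.tht u v3 = 0" "F2.tht u v3 = 0" "nu u v3 = 1"
  shows "al' u v3 = a * (1 - (al (\<phi> u))\<^sup>2 + b\<^sup>2 * (mu (\<phi> u))\<^sup>2)"
    "mu' u v3 = mu (\<phi> u) * (b * de (\<phi> u) - a * al (\<phi> u))"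
    "de' u v3 = - b * (1 - (de (\<phi> u))\<^sup>2 + a\<^sup>2 * (mu (\<phi> u))\<^sup>2)"
    "al' u v2 = a * mu' u v1" "de' u v1 = b * mu' u v2"
proof -
  note S = F1.structure_equations[OF u] F2.structure_equations[OF u]
  have I: "F1.thn u v * F1.tht u w - F1.thn u w * F1.tht u v
    = al' u v * F1.tht u w - al' u w * F1.tht u v + al (\<phi> u) * (F1.thn u v * F1.om u w - F1.thn u w * F1.om u v)
      + a * (mu' u v * F2.tht u w - mu' u w * F2.tht u v + mu (\<phi> u) * (F2.thn u v * F2.om u w - F2.thn u w * F2.om u v))"
    for v w
    unfolding S(2,3,5)[symmetric] om'_eq[OF u] by algebra
  have II: "F2.thn u v * F2.tht u w - F2.thn u w * F2.tht u v
    = b * (mu' u v * F1.tht u w - mu' u w * F1.tht u v + mu (\<phi> u) * (F1.thn u v * F1.om u w - F1.thn u w * F1.om u v))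
      + de' u v * F2.tht u w - de' u w * F2.tht u v + de (\<phi> u) * (F2.thn u v * F2.om u w - F2.thn u w * F2.om u v)"
    for v w
    unfolding S(2,5,6)[symmetric] om'_eq[OF u] by algebra
  note I' = I[unfolded thn_nu[OF u] om_eq[OF u]] and II' = II[unfolded thn_nu[OF u] om_eq[OF u]]
  show "al' u v3 = a * (1 - (al (\<phi> u))\<^sup>2 + b\<^sup>2 * (mu (\<phi> u))\<^sup>2)"
    using I'[of v3 v1] unfolding v1 v2 v3 by (simp add: power2_eq_square algebra_simps)
  have "a * mu' u v3 = a * (mu (\<phi> u) * (b * de (\<phi> u) - a * al (\<phi> u)))"
    using I'[of v3 v2] unfolding v1 v2 v3 by (simp add: algebra_simps)
  then show "mu' u v3 = mu (\<phi> u) * (b * de (\<phi> u) - a * al (\<phi> u))" using ab(1,2) by simp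
  show "de' u v3 = - b * (1 - (de (\<phi> u))\<^sup>2 + a\<^sup>2 * (mu (\<phi> u))\<^sup>2)"
    using II'[of v3 v2] unfolding v1 v2 v3 by (simp add: power2_eq_square algebra_simps)
  show "al' u v2 = a * mu' u v1"
    using I'[of v1 v2] unfolding v1 v2 v3 by simp
  show "de' u v1 = b * mu' u v2"
    using II'[of v1 v2] unfolding v1 v2 v3 by simp
qed

text \<open>Injectivity of \<open>D\<close> makes \<open>v1, v2, v3\<close> a basis of the parameter
  space, dual to the three forms.\<close>

lemma nu_linear_coords:
  assumes u: "u \<in> U" and L: "linear L"
    and v1: "F1.tht u v1 = 1" "F2.tht u v1 = 0" "nu u v1 = 0"
    and v2: "F1.tht u v2 = 0" "F2.tht u v2 = 1" "nu u v2 = 0"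
    and v3: "F1.tht u v3 = 0" "F2.tht u v3 = 0" "nu u v3 = 1"
  shows "(L v :: real) = F1.tht u v * L v1 + F2.tht u v * L v2 + nu u v * L v3"
proof -
  have linD: "linear (D u)" using chartD(4)[OF chart u] has_derivative_linear by blast
  have D: "D u w = F1.tht u w *\<^sub>R (t1 (\<phi> u), 0) + F2.tht u w *\<^sub>R (0, t2 (\<phi> u)) + nu u w *\<^sub>R (a *\<^sub>R n1 (\<phi> u), - b *\<^sub>R n2 (\<phi> u))" for w
    using adapted_tframe[OF phi_M[OF u]] tangential_derivative[OF chart u, of w]
    unfolding tframe_def pmetric_D[OF u, symmetric] by blast
  have Dv: "D u v1 = (t1 (\<phi> u), 0)" "D u v2 = (0, t2 (\<phi> u))" "D u v3 = (a *\<^sub>R n1 (\<phi> u), - b *\<^sub>R n2 (\<phi> u))"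
    by (subst D, simp add: v1 v2 v3)+
  have "D u (F1.tht u v *\<^sub>R v1 + F2.tht u v *\<^sub>R v2 + nu u v *\<^sub>R v3) = F1.tht u v *\<^sub>R D u v1 + F2.tht u v *\<^sub>R D u v2 + nu u v *\<^sub>R D u v3"
    by (simp add: linear_add[OF linD] linear_scale[OF linD])
  also have "\<dots> = D u v"
    unfolding Dv by (rule D[symmetric])
  finally have "F1.tht u v *\<^sub>R v1 + F2.tht u v *\<^sub>R v2 + nu u v *\<^sub>R v3 = v"
    by (rule injD[OF chartD(3)[OF chart u]])
  from arg_cong[OF this, of L, symmetric] show ?thesis
    by (simp add: linear_add[OF L] linear_scale[OF L])
qed

end

section \<open>Algebraic consequences of the Riccati system\<close>

context cpc_shape begin

lemma chart_at:
  assumes "x \<in> M"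
  obtains U \<phi> u where "cpc_shape_chart M N C k1 k2 k3 al mu de U \<phi>" "u \<in> U" "\<phi> u = x"
proof -
  obtain U \<phi> u where c: "chart M U \<phi>" "u \<in> U" "\<phi> u = x" using ex_chart[OF assms] by blast
  have "cpc_shape_chart M N C k1 k2 k3 al mu de U \<phi>" by unfold_locales (rule c(1))
  then show thesis using c that by blast
qed

text \<open>\<open>T\<close> and \<open>Q\<close> are differentiated along \<open>v3\<close> and the
  Riccati system is inserted. In the second relation the cubic terms recombine into
  \<open>Q\<close>, which leaves an equation linear in \<open>al\<close> and
  \<open>de\<close>.\<close>

lemma curvature_relations:
  assumes "x \<in> M"
  shows "(de x)\<^sup>2 - (al x)\<^sup>2 = (a\<^sup>2 - b\<^sup>2) * (mu x)\<^sup>2"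
    "a * de x - b * al x = Q * (a * al x - b * de x)"
proof -
  obtain U \<phi> u where c: "cpc_shape_chart M N C k1 k2 k3 al mu de U \<phi>" "u \<in> U" "\<phi> u = x"
    using chart_at[OF assms] .
  interpret cpc_shape_chart M N C k1 k2 k3 al mu de U \<phi> by (rule c(1))
  obtain v1 v2 v3 where v: "F1.tht u v1 = 1" "F2.tht u v1 = 0" "nu u v1 = 0"
    "F1.tht u v2 = 0" "F2.tht u v2 = 1" "nu u v2 = 0" "F1.tht u v3 = 0" "F2.tht u v3 = 0" "nu u v3 = 1"
    using ex_dual[OF c(2)] by metis
  note cod = codazzi[OF c(2) v, unfolded c(3)]
  have "b * (a * (1 - (al x)\<^sup>2 + b\<^sup>2 * (mu x)\<^sup>2)) + a * (- b * (1 - (de x)\<^sup>2 + a\<^sup>2 * (mu x)\<^sup>2)) = 0"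
    using der_T[OF c(2), of v3] unfolding cod .
  then have "(a * b) * ((de x)\<^sup>2 - (al x)\<^sup>2 - (a\<^sup>2 - b\<^sup>2) * (mu x)\<^sup>2) = 0" by algebra
  then show "(de x)\<^sup>2 - (al x)\<^sup>2 = (a\<^sup>2 - b\<^sup>2) * (mu x)\<^sup>2" using ab(1,2) by simp
  have "a * (1 - (al x)\<^sup>2 + b\<^sup>2 * (mu x)\<^sup>2) * de x + al x * (- b * (1 - (de x)\<^sup>2 + a\<^sup>2 * (mu x)\<^sup>2))
    - 2 * a * b * mu x * (mu x * (b * de x - a * al x)) = 0"
    using der_Q[OF c(2), of v3] unfolding cod c(3) .
  then show "a * de x - b * al x = Q * (a * al x - b * de x)"
    unfolding Q[OF assms, symmetric] by algebra
qed

text \<open>For constant \<open>al\<close> and \<open>de\<close> two Riccati equations become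
  algebraic. Constancy of \<open>Q\<close> gives that \<open>mu\<close> times its derivative is
  \<open>0\<close>, and the third Riccati equation evaluates that derivative.\<close>

lemma constant_curvature_relations:
  assumes const: "\<And>x. x \<in> M \<Longrightarrow> al x = A" "\<And>x. x \<in> M \<Longrightarrow> de x = B" and "x \<in> M"
  shows "A\<^sup>2 = 1 + b\<^sup>2 * (mu x)\<^sup>2" "B\<^sup>2 = 1 + a\<^sup>2 * (mu x)\<^sup>2" "mu x = 0 \<or> b * B = a * A"
proof -
  obtain U \<phi> u where c: "cpc_shape_chart M N C k1 k2 k3 al mu de U \<phi>" "u \<in> U" "\<phi> u = x"
    using chart_at[OF assms(3)] .
  interpret cpc_shape_chart M N C k1 k2 k3 al mu de U \<phi> by (rule c(1))
  obtain v1 v2 v3 where v: "F1.tht u v1 = 1" "F2.tht u v1 = 0" "nu u v1 = 0"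
    "F1.tht u v2 = 0" "F2.tht u v2 = 1" "nu u v2 = 0" "F1.tht u v3 = 0" "F2.tht u v3 = 0" "nu u v3 = 1"
    using ex_dual[OF c(2)] by metis
  note cod = codazzi[OF c(2) v, unfolded c(3) const[OF assms(3)]]
  have 0: "al' u v3 = 0" "de' u v3 = 0"
    using has_derivative_const_on_open[OF F1.U c(2) _ coefficients_der(1)[OF c(2)], of A v3]
      has_derivative_const_on_open[OF F1.U c(2) _ coefficients_der(3)[OF c(2)], of B v3]
      const phi_M by blast+
  show "A\<^sup>2 = 1 + b\<^sup>2 * (mu x)\<^sup>2" "B\<^sup>2 = 1 + a\<^sup>2 * (mu x)\<^sup>2"
    using cod(1,3) 0 ab(1,2) by simp_all
  have "mu x * mu' u v3 = 0"
    using der_Q[OF c(2), of v3] ab(1,2) unfolding 0 c(3) by simp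
  then show "mu x = 0 \<or> b * B = a * A" unfolding cod(2) by simp
qed

text \<open>Here the Riccati system is degenerate. One finds \<open>d\<alpha> = a \<mu>\<^sup>2 \<nu>\<close>, and symmetry of the second
  derivative of \<open>\<alpha>\<close> against \<open>d\<nu> = - \<mu> \<theta>\<^sub>1 \<and> \<theta>\<^sub>2\<close> forces \<open>\<mu>\<^sup>3 = 0\<close>.\<close>
lemma minimal_case:
  assumes "a = b" "T = 0" "Q = -1" "x \<in> M"
  shows "mu x = 0"
proof -
  have ab2: "a\<^sup>2 = 1/2" "b\<^sup>2 = 1/2" "a * b = 1/2" using ab_sum assms(1) by (simp_all add: power2_eq_square)
  have de: "de y = - al y" if "y \<in> M" for y
  proof -
    have "b * (al y + de y) = 0" using T[OF that] assms by (simp add: algebra_simps)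
    then show ?thesis using ab(1,2) by simp
  qed
  have sq: "(al y)\<^sup>2 + (mu y)\<^sup>2 / 2 = 1" if "y \<in> M" for y
    using Q[OF that] unfolding de[OF that] ab2 assms(3) by (simp add: power2_eq_square)
  obtain U \<phi> u where c: "cpc_shape_chart M N C k1 k2 k3 al mu de U \<phi>" "u \<in> U" "\<phi> u = x"
    using chart_at[OF assms(4)] .
  interpret cpc_shape_chart M N C k1 k2 k3 al mu de U \<phi> by (rule c(1))
  have der_al: "al' w v = a * (mu (\<phi> w))\<^sup>2 * nu w v" if w: "w \<in> U" for w v
  proof -
    obtain v1 v2 v3 where v: "F1.tht w v1 = 1" "F2.tht w v1 = 0" "nu w v1 = 0"
      "F1.tht w v2 = 0" "F2.tht w v2 = 1" "nu w v2 = 0" "F1.tht w v3 = 0" "F2.tht w v3 = 0" "nu w v3 = 1"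
      using ex_dual[OF w] by metis
    note cod = codazzi[OF w v]
    define m where "m = mu (\<phi> w)"
    define l where "l = al (\<phi> w)"
    have s: "l\<^sup>2 + m\<^sup>2 / 2 = 1" using sq[OF phi_M[OF w]] by (simp add: m_def l_def)
    have dT: "de' w z = - al' w z" for z
    proof -
      have "b * (al' w z + de' w z) = 0" using der_T[OF w, of z] assms(1) by (simp add: algebra_simps)
      then show ?thesis using ab(1,2) by simp
    qed
    have dQ: "2 * l * al' w z + m * mu' w z = 0" for z
    proof -
      have "2 * a * b * m * mu' w z = m * mu' w z" using ab2(3) by simp
      then show ?thesis
        using der_Q[OF w, of z] unfolding dT de[OF phi_M[OF w]] m_def[symmetric] l_def[symmetric] by algebra
    qed
    have 2: "al' w v2 = a * mu' w v1" "al' w v1 = - a * mu' w v2"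
      using cod(4,5) dT[of v1] assms(1) by simp_all
    have e1: "2 * l * a * mu' w v1 + m * mu' w v2 = 0" and e2: "- 2 * l * a * mu' w v2 + m * mu' w v1 = 0"
      using dQ[of v1, unfolded 2] dQ[of v2, unfolded 2] by algebra+
    \<comment> \<open>A homogeneous linear system for the derivatives of \<open>mu\<close> along
      \<open>v1\<close> and \<open>v2\<close>. Its determinant is, up to sign, \<open>2\<close> by
      \<open>sq\<close>.\<close>
    have "(4 * a\<^sup>2 * l\<^sup>2 + m\<^sup>2) * mu' w v1 = 0" "(4 * a\<^sup>2 * l\<^sup>2 + m\<^sup>2) * mu' w v2 = 0"
      using e1 e2 by algebra+
    moreover have "4 * a\<^sup>2 * l\<^sup>2 + m\<^sup>2 = 2" unfolding ab2 using s by simp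
    ultimately have "mu' w v1 = 0" "mu' w v2 = 0" by simp_all
    then have 0: "al' w v1 = 0" "al' w v2 = 0" using 2 by simp_all
    have "al' w v3 = a * m\<^sup>2"
      unfolding cod(1) m_def[symmetric] l_def[symmetric] ab2 using s by simp
    moreover have "linear (al' w)" using coefficients_der(1)[OF w] has_derivative_linear by blast
    ultimately show ?thesis
      using nu_linear_coords[OF w _ v, of "al' w" v] 0 by (simp add: m_def)
  qed
  obtain v1 v2 where v: "F1.tht u v1 = 1" "F2.tht u v1 = 0" "nu u v1 = 0"
      "F1.tht u v2 = 0" "F2.tht u v2 = 1" "nu u v2 = 0"
    using ex_dual[OF c(2)] by metis
  have der2: "((\<lambda>w. a * (mu (\<phi> w))\<^sup>2 * nu w v) has_derivative
      (\<lambda>z. a * (mu x)\<^sup>2 * (F1.thn' u v z / a) + 2 * a * mu x * mu' u z * nu u v)) (at u)" for v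
    by (rule derivative_eq_intros coefficients_der[OF c(2)] nu_der[OF c(2)] refl)+
      (simp add: c(3) fun_eq_iff)
  have "((\<lambda>w. al (\<phi> w)) has_derivative (\<lambda>v. a * (mu (\<phi> w))\<^sup>2 * nu w v)) (at w)" if "w \<in> U" for w
    using coefficients_der(1)[OF that] der_al[OF that] by (metis (no_types, lifting) ext)
  from second_derivative_symmetric[OF F1.U c(2) this der2[of v1] der2[of v2]]
  have "a * (mu x)\<^sup>2 * (F1.thn' u v1 v2 / a) + 2 * a * mu x * mu' u v2 * nu u v1
      = a * (mu x)\<^sup>2 * (F1.thn' u v2 v1 / a) + 2 * a * mu x * mu' u v1 * nu u v2" .
  then have "(mu x)\<^sup>2 * (F1.thn' u v2 v1 - F1.thn' u v1 v2) = 0"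
    using v ab(1,2) by auto
  moreover have "F1.thn' u v2 v1 - F1.thn' u v1 v2 = - a * mu x"
    unfolding F1.structure_equations[OF c(2)] om_eq[OF c(2)] v c(3) by simp
  ultimately show ?thesis using ab(1,2) by simp
qed

text \<open>The trace and the second relation of \<open>curvature_relations\<close> are linear in
  \<open>al\<close> and \<open>de\<close>, with determinant \<open>2 * a * b + Q\<close>. Where it
  is nonzero, Cramer's rule yields the constants \<open>A\<close> and \<open>B\<close>.\<close>

lemma alternative:
  "(\<forall>x\<in>M. mu x = 0 \<and> (al x)\<^sup>2 = 1 \<and> (de x)\<^sup>2 = 1) \<or>
   (a = b \<and> (\<exists>A. \<forall>x\<in>M. mu x \<noteq> 0 \<and> al x = A \<and> de x = A \<and> A\<^sup>2 = 1 + (mu x)\<^sup>2 / 2))"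
proof (cases "2 * a * b + Q = 0")
  case False
  define A where "A = T * (a + b * Q) / (2 * a * b + Q)"
  define B where "B = T * (b + a * Q) / (2 * a * b + Q)"
  have const: "al x = A" "de x = B" if "x \<in> M" for x
  proof -
    have "(2 * a * b + Q) * al x = T * (a + b * Q)" "(2 * a * b + Q) * de x = T * (b + a * Q)"
      using curvature_relations(2)[OF that] T[OF that] ab_sum by algebra+
    then show "al x = A" "de x = B" using False by (simp_all add: A_def B_def field_simps)
  qed
  have rel: "A\<^sup>2 = 1 + b\<^sup>2 * (mu x)\<^sup>2" "B\<^sup>2 = 1 + a\<^sup>2 * (mu x)\<^sup>2" "mu x = 0 \<or> b * B = a * A"
    if "x \<in> M" for x
    using constant_curvature_relations[of A B x] const that by blast+
  show ?thesis
  proof (cases "A\<^sup>2 = 1")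
    case True
    have "mu x = 0" if "x \<in> M" for x using rel(1)[OF that] True ab(1,2) by simp
    then have "\<forall>x\<in>M. mu x = 0 \<and> (al x)\<^sup>2 = 1 \<and> (de x)\<^sup>2 = 1"
      using rel(1,2) const by fastforce
    then show ?thesis ..
  next
    case False
    then have mu0: "mu x \<noteq> 0" if "x \<in> M" for x using rel(1)[OF that] by auto
    obtain x0 where x0: "x0 \<in> M" using nonempty by blast
    have e: "b * B = a * A" using rel(3)[OF x0] mu0[OF x0] by simp
    have "b\<^sup>2 * (1 + a\<^sup>2 * (mu x0)\<^sup>2) = a\<^sup>2 * (1 + b\<^sup>2 * (mu x0)\<^sup>2)"
      unfolding rel(1,2)[OF x0, symmetric] using e by algebra
    then have "a\<^sup>2 = b\<^sup>2" by (simp add: algebra_simps)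
    then have eq: "a = b" using ab(1,2) by simp
    then have "A = B" using e ab(1,2) by simp
    moreover have "b\<^sup>2 = 1 / 2" using eq ab_sum by simp
    ultimately have "\<forall>x\<in>M. mu x \<noteq> 0 \<and> al x = A \<and> de x = A \<and> A\<^sup>2 = 1 + (mu x)\<^sup>2 / 2"
      using mu0 const rel(1) by simp
    then show ?thesis using eq by blast
  qed
next
  case True
  then have Q': "Q = - 2 * a * b" by simp
  obtain x0 where x0: "x0 \<in> M" using nonempty by blast
  note c0 = curvature_relations[OF x0]
  \<comment> \<open>For \<open>Q = - 2 * a * b\<close> the linear relation degenerates to
    \<open>(a\<^sup>2 - b\<^sup>2) * T = 0\<close>. With \<open>T = 0\<close> the quadratic relation
    then makes a sum of squares vanish, hence \<open>Q = 0\<close>, which is absurd.\<close>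
  have eq: "a = b"
  proof (rule ccontr)
    assume "a \<noteq> b"
    then have "a\<^sup>2 - b\<^sup>2 \<noteq> 0" using ab(1,2) by simp
    have "(a\<^sup>2 - b\<^sup>2) * (b * al x0 + a * de x0) = 0"
      using c0(2) ab_sum unfolding Q' by algebra
    then have t: "b * al x0 + a * de x0 = 0" using \<open>a\<^sup>2 - b\<^sup>2 \<noteq> 0\<close> by simp
    have "(a\<^sup>2 - b\<^sup>2) * ((al x0)\<^sup>2 + a\<^sup>2 * (mu x0)\<^sup>2) = 0"
      using c0(1) t by algebra
    then have "(al x0)\<^sup>2 + (a * mu x0)\<^sup>2 = 0"
      using \<open>a\<^sup>2 - b\<^sup>2 \<noteq> 0\<close> by (simp add: power_mult_distrib)
    then have "al x0 = 0" "mu x0 = 0" using ab(1,2) by (simp_all add: sum_power2_eq_zero_iff)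
    then have "Q = 0" using Q[OF x0] by simp
    then show False using Q' ab(1,2) by simp
  qed
  then have ab2: "a * b = 1 / 2" "b\<^sup>2 = 1/2" using ab_sum by (simp_all add: power2_eq_square)
  then have Q1: "Q = -1" using Q' by simp
  \<comment> \<open>A nonzero trace forces \<open>al = de\<close>, and then the Riccati relation and
    \<open>Q = -1\<close> prescribe values of \<open>(al x)\<^sup>2\<close> that differ by
    \<open>2\<close>.\<close>
  have "T = 0"
  proof (rule ccontr)
    assume "T \<noteq> 0"
    have const: "al x = T / (2 * a)" "de x = T / (2 * a)" if "x \<in> M" for x
    proof -
      have "(de x - al x) * (de x + al x) = 0"
        using curvature_relations(1)[OF that] unfolding eq by (simp add: algebra_simps power2_eq_square)
      moreover have s: "b * (al x + de x) = T" using T[OF that] eq by (simp add: algebra_simps)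
      ultimately have "de x = al x" using \<open>T \<noteq> 0\<close> by (auto simp: add.commute)
      then show "al x = T / (2 * a)" "de x = T / (2 * a)" using s ab(1,2) eq by (simp_all add: field_simps)
    qed
    have "(T / (2 * a))\<^sup>2 = 1 + b\<^sup>2 * (mu x0)\<^sup>2"
      using constant_curvature_relations(1)[of "T / (2 * a)" "T / (2 * a)" x0] const x0 by blast
    moreover have "(T / (2 * a))\<^sup>2 - (1 / 2) * (mu x0)\<^sup>2 = -1"
      using Q[OF x0] unfolding const[OF x0] Q1 ab2 by (simp add: power2_eq_square)
    ultimately show False unfolding ab2 by simp
  qed
  have mu0: "mu x = 0" if "x \<in> M" for x by (rule minimal_case[OF eq \<open>T = 0\<close> Q1 that])
  moreover have "(al x)\<^sup>2 = 1 \<and> (de x)\<^sup>2 = 1" if "x \<in> M" for x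
  proof -
    have "b * (al x + de x) = 0" using T[OF that] eq \<open>T = 0\<close> by (simp add: algebra_simps)
    then have "de x = - al x" using ab(1,2) by simp
    then show ?thesis using Q[OF that] mu0[OF that] Q1 by (simp add: power2_eq_square)
  qed
  ultimately show ?thesis by blast
qed

text \<open>A differentiable function with constant nonzero square cannot change sign: the
  derivative of the square is \<open>2 f f'\<close>, and \<open>f\<close> has no zeros.\<close>

lemma constant_of_square:
  fixes f :: "pt \<Rightarrow> real"
  assumes "\<And>x. x \<in> M \<Longrightarrow> (f x)\<^sup>2 = c" "c \<noteq> 0"
    and "\<And>U \<phi> u. chart M U \<phi> \<Longrightarrow> u \<in> U \<Longrightarrow> (\<lambda>u. f (\<phi> u)) differentiable (at u)"
    and "x \<in> M" "y \<in> M"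
  shows "f x = f y"
proof (rule chart_zero_derivative_imp_constant[OF hyp conn _ assms(4,5)])
  fix U \<phi> u assume c: "chart M U \<phi>" "u \<in> U"
  obtain L where L: "((\<lambda>u. f (\<phi> u)) has_derivative L) (at u)"
    using assms(3)[OF c] by (auto simp: differentiable_def)
  have L2: "((\<lambda>u. (f (\<phi> u))\<^sup>2) has_derivative (\<lambda>v. 2 * f (\<phi> u) * L v)) (at u)"
    using L by (auto intro!: derivative_eq_intros)
  have "L v = 0" for v
  proof -
    have "2 * f (\<phi> u) * L v = 0"
      using has_derivative_const_on_open[OF chartD(1)[OF c] c(2) _ L2, of c v] assms(1) chartD(2)[OF c(1)] by blast
    moreover have "f (\<phi> u) \<noteq> 0" using assms(1)[OF chartD(2)[OF c]] assms(2) by auto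
    ultimately show ?thesis by simp
  qed
  then have "L = (\<lambda>_. 0)" by auto
  then show "((\<lambda>u. f (\<phi> u)) has_derivative (\<lambda>_. 0)) (at u)" using L by simp
qed

lemma coefficients_differentiable_chart:
  assumes "chart M U \<phi>" "u \<in> U"
  shows "(\<lambda>u. al (\<phi> u)) differentiable (at u)" "(\<lambda>u. mu (\<phi> u)) differentiable (at u)"
    "(\<lambda>u. de (\<phi> u)) differentiable (at u)"
proof -
  interpret cpc_shape_chart M N C k1 k2 k3 al mu de U \<phi> by unfold_locales (rule assms)
  show "(\<lambda>u. al (\<phi> u)) differentiable (at u)" "(\<lambda>u. mu (\<phi> u)) differentiable (at u)"
    "(\<lambda>u. de (\<phi> u)) differentiable (at u)"
    using coefficients_differentiable[OF assms(2)] by blast+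
qed

end

section \<open>Open parts and horocycles\<close>

lemma lor_lcross_lcross: "lor (lcross c d) (lcross s r) = lor c r * lor d s - lor c s * lor d r"
  by (simp add: lor_def algebra_simps)

lemma lcross_lcross: "lcross (lcross x y) z = lor y z *\<^sub>R x - lor x z *\<^sub>R y"
  by (simp add: vec3_eq_iff lor_def algebra_simps)

lemma lor_lcross_swap: "lor (lcross x e) y = - lor (lcross x y) e"
  by (simp add: lor_def algebra_simps)

lemma H2_eqI:
  assumes "p \<in> H2" "p' \<in> H2" "p$2 = p'$2" "p$3 = p'$3"
  shows "p = p'"
proof -
  have "(p$1)\<^sup>2 = (p'$1)\<^sup>2" "p$1 > 0" "p'$1 > 0"
    using assms by (auto simp: H2_def lor_def power2_eq_square)
  then have "p$1 = p'$1" by (simp add: power2_eq_iff_nonneg)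
  then show ?thesis using assms by (simp add: vec3_eq_iff)
qed

text \<open>The difference of the points is parallel to \<open>lcross w e\<close> and orthogonal to
  their sum, whereas by the sign conditions \<open>lcross w e\<close> is not orthogonal to the
  sum.\<close>

lemma H2_unique_on_side:
  assumes "lor q q = lor q' q'" "lor q w = lor q' w" "lor q e = lor q' e"
    "lor (lcross w e) q > 0" "lor (lcross w e) q' > 0"
  shows "q = q'"
proof -
  define d where "d = q - q'"
  define s where "s = q + q'"
  have "lcross (lcross w e) d = 0"
    using assms(2,3) by (simp add: lcross_lcross d_def lor_simps lor_commute)
  then have "lor (lcross w e) r * lor d s - lor (lcross w e) s * lor d r = 0" for r
    unfolding lor_lcross_lcross[symmetric] by (simp add: lor_simps)
  moreover have "lor d s = 0"
    using assms(1) by (simp add: d_def s_def lor_simps lor_commute)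
  moreover have "lor (lcross w e) s > 0"
    using assms(4,5) by (simp add: s_def lor_simps)
  ultimately have "lor d r = 0" for r by (metis diff_0 mult_zero_right mult_eq_0_iff neg_equal_0_iff_equal less_irrefl)
  then have "d = 0" by (rule lor_nondegenerate)
  then show ?thesis by (simp add: d_def)
qed

text \<open>Both sets are three-dimensional, so invariance of domain applies once \<open>X\<close> is locally
  injected into \<open>\<real>\<^sup>3\<close>: a point \<open>(p, q)\<close> is recovered from \<open>p\<close> and one linear coordinate of \<open>q\<close>,
  because \<open>q\<close> lies on a plane section of the hyperboloid.\<close>
lemma openin_local_fibration:
  fixes M X :: "pt set" and W :: "real^3 \<Rightarrow> real^3"
  assumes MX: "M \<subseteq> X" "X \<subseteq> H2 \<times> H2"
    and charts: "\<And>x. x \<in> M \<Longrightarrow> \<exists>(U::(real^3) set) \<phi>. open U \<and> continuous_on U \<phi> \<and> inj_on \<phi> U \<and> \<phi> ` U \<subseteq> M \<and> x \<in> \<phi> ` U"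
    and W: "continuous_on UNIV W"
    and fib: "\<And>p q q'. (p, q) \<in> X \<Longrightarrow> (p, q') \<in> X \<Longrightarrow> lor q (W p) = lor q' (W p)"
    and indep: "\<And>p q. (p, q) \<in> M \<Longrightarrow> lcross (W p) q \<noteq> 0"
  shows "openin (top_of_set X) M"
proof (subst openin_subopen, intro ballI)
  fix x assume x: "x \<in> M"
  obtain p0 q0 where pq: "x = (p0, q0)" by (cases x)
  obtain U :: "(real^3) set" and \<phi> where ch: "open U" "continuous_on U \<phi>" "inj_on \<phi> U" "\<phi> ` U \<subseteq> M" "x \<in> \<phi> ` U"
    using charts[OF x] by blast
  obtain z where z: "lor (lcross (W p0) q0) z \<noteq> 0"
    using lor_nondegenerate[of "lcross (W p0) q0"] indep[of p0 q0] x pq by blast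
  \<comment> \<open>The sign of \<open>e\<close> puts \<open>q0\<close> on the side described by
    \<open>S\<close>, where a plane section is parametrized injectively by
    \<open>lor q e\<close>.\<close>
  define e where "e = (if lor (lcross (W p0) q0) z < 0 then z else - z)"
  have e: "lor (lcross (W p0) e) q0 > 0"
    using z unfolding lor_lcross_swap[of _ e] by (auto simp: e_def lor_simps)
  define S where "S = {y::pt. 0 < lor (lcross (W (fst y)) e) (snd y)}"
  have Wf: "continuous_on UNIV (\<lambda>y::pt. W (fst y))"
    using continuous_on_compose[OF continuous_on_fst[OF continuous_on_id] continuous_on_subset[OF W subset_UNIV]]
    by (simp add: o_def)
  have "open S"
    unfolding S_def
    by (intro open_Collect_less lor.continuous_on lcross.continuous_on Wf continuous_intros)
  \<comment> \<open>The hyperboloid sheet is a graph over its last two coordinates, which therefore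
    determine \<open>p\<close>.\<close>
  define \<Psi> :: "pt \<Rightarrow> real^3" where "\<Psi> y = vector [fst y $ 2, fst y $ 3, lor (snd y) e]" for y
  have c\<Psi>: "continuous_on A \<Psi>" for A
  proof -
    have "\<Psi> y = fst y $ 2 *\<^sub>R axis 1 1 + fst y $ 3 *\<^sub>R axis 2 1 + lor (snd y) e *\<^sub>R axis 3 1" for y
      by (simp add: \<Psi>_def vec3_eq_iff axis_def)
    then show ?thesis by (simp add: continuous_intros lor.continuous_on)
  qed
  have inj: "inj_on \<Psi> (X \<inter> S)"
  proof (rule inj_onI)
    fix y y' assume y: "y \<in> X \<inter> S" "y' \<in> X \<inter> S" "\<Psi> y = \<Psi> y'"
    obtain p q p' q' where eq: "y = (p, q)" "y' = (p', q')" by (cases y, cases y')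
    have H: "p \<in> H2" "q \<in> H2" "p' \<in> H2" "q' \<in> H2" using y eq MX by auto
    have "p = p'" using y(3) H by (intro H2_eqI) (auto simp: \<Psi>_def eq vec3_eq_iff)
    moreover have "q = q'"
    proof (rule H2_unique_on_side[where w = "W p" and e = e])
      show "lor q q = lor q' q'" using H H2D by simp
      show "lor q (W p) = lor q' (W p)" using y eq \<open>p = p'\<close> by (intro fib) auto
      show "lor q e = lor q' e" using y(3) by (simp add: \<Psi>_def eq vec3_eq_iff)
      show "lor (lcross (W p) e) q > 0" "lor (lcross (W p) e) q' > 0"
        using y eq \<open>p = p'\<close> by (auto simp: S_def)
    qed
    ultimately show "y = y'" by (simp add: eq)
  qed
  define V where "V = U \<inter> \<phi> -` S"
  have "open V" unfolding V_def using ch(2,1) \<open>open S\<close> by (rule continuous_open_preimage)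
  have V: "\<phi> v \<in> X \<inter> S" if "v \<in> V" for v using that ch(4) MX by (auto simp: V_def)
  have "open ((\<Psi> \<circ> \<phi>) ` V)"
  proof (rule invariance_of_domain[OF _ \<open>open V\<close>])
    show "continuous_on V (\<Psi> \<circ> \<phi>)"
      by (rule continuous_on_compose[OF continuous_on_subset[OF ch(2)] c\<Psi>]) (auto simp: V_def)
    show "inj_on (\<Psi> \<circ> \<phi>) V"
    proof (rule comp_inj_on[OF inj_on_subset[OF ch(3)] inj_on_subset[OF inj]])
      show "V \<subseteq> U" by (auto simp: V_def)
      show "\<phi> ` V \<subseteq> X \<inter> S" using V by blast
    qed
  qed
  then have "open (S \<inter> \<Psi> -` ((\<Psi> \<circ> \<phi>) ` V))"
    using continuous_open_preimage[OF c\<Psi> \<open>open S\<close>] by blast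
  then have "openin (top_of_set X) (X \<inter> (S \<inter> \<Psi> -` ((\<Psi> \<circ> \<phi>) ` V)))" by (rule openin_open_Int)
  moreover have "x \<in> X \<inter> (S \<inter> \<Psi> -` ((\<Psi> \<circ> \<phi>) ` V))"
  proof -
    have "x \<in> S" using e pq by (simp add: S_def)
    then show ?thesis using ch(5) x MX by (auto simp: V_def)
  qed
  moreover have "X \<inter> (S \<inter> \<Psi> -` ((\<Psi> \<circ> \<phi>) ` V)) \<subseteq> M"
  proof
    fix y assume y: "y \<in> X \<inter> (S \<inter> \<Psi> -` ((\<Psi> \<circ> \<phi>) ` V))"
    then obtain v where v: "v \<in> V" "\<Psi> y = \<Psi> (\<phi> v)" by auto
    have "y = \<phi> v" using inj_onD[OF inj v(2)] y V[OF v(1)] by auto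
    then show "y \<in> M" using v(1) ch(4) by (auto simp: V_def)
  qed
  ultimately show "\<exists>T. openin (top_of_set X) T \<and> x \<in> T \<and> T \<subseteq> M" by blast
qed

text \<open>Composing the charts of \<open>M\<close> with \<open>f\<close> gives continuous
  injections, which is what invariance of domain asks for.\<close>

lemma open_part_image:
  fixes M X :: "pt set" and W :: "real^3 \<Rightarrow> real^3"
  assumes M: "hypersurface M" and f: "continuous_on UNIV f" "inj_on f (H2 \<times> H2)"
    and "f ` M \<subseteq> X" "X \<subseteq> H2 \<times> H2" "continuous_on UNIV W"
    and "\<And>p q q'. (p, q) \<in> X \<Longrightarrow> (p, q') \<in> X \<Longrightarrow> lor q (W p) = lor q' (W p)"
    and "\<And>p q. (p, q) \<in> f ` M \<Longrightarrow> lcross (W p) q \<noteq> 0"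
  shows "open_part (f ` M) X"
  unfolding open_part_def
proof
  show "openin (top_of_set X) (f ` M)"
  proof (rule openin_local_fibration[where W = W])
    fix x assume "x \<in> f ` M"
    then obtain y where y: "y \<in> M" "x = f y" by blast
    then obtain U \<phi> where c: "chart M U \<phi>" "y \<in> \<phi> ` U" using M by (auto simp: hypersurface_def)
    have cc: "open U" "\<phi> ` U \<subseteq> M" "inj_on \<phi> U" using c(1) by (auto simp: chart_def)
    have "continuous_on U \<phi>"
    proof -
      have "ddl [] \<phi> differentiable (at u)" if "u \<in> U" for u
        using c(1) that unfolding chart_def smooth_on_def by blast
      then show ?thesis
        by (auto intro!: continuous_at_imp_continuous_on differentiable_imp_continuous_within)
    qed
    then have "continuous_on U (f \<circ> \<phi>)"
      using f(1) by (meson continuous_on_compose continuous_on_subset subset_UNIV)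
    moreover have "inj_on (f \<circ> \<phi>) U"
      by (rule comp_inj_on[OF cc(3) inj_on_subset[OF f(2)]]) (use cc(2) M in \<open>auto simp: hypersurface_def\<close>)
    ultimately show "\<exists>(U::(real^3) set) \<phi>. open U \<and> continuous_on U \<phi> \<and> inj_on \<phi> U \<and> \<phi> ` U \<subseteq> f ` M \<and> x \<in> \<phi> ` U"
      using cc c(2) y by (intro exI[of _ U] exI[of _ "f \<circ> \<phi>"]) auto
  qed (fact assms)+
qed fact

section \<open>Busemann functions and horocyclic coordinates\<close>

definition nullvec :: "real^3" where "nullvec = vector [1, 0, 1]"

lemma lor_nullvec: "lor p nullvec = p$3 - p$1"
  by (simp add: nullvec_def lor_def)

lemma nullvec_null: "lor nullvec nullvec = 0"
  by (simp add: lor_nullvec) (simp add: nullvec_def)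

lemma H2_nullvec_neg: "p \<in> H2 \<Longrightarrow> lor p nullvec < 0"
  using lor_future_neg[of p nullvec] nullvec_null by (simp add: nullvec_def lor_commute)

text \<open>\<open>hgam\<close> is a horocycle centred at the null direction \<open>nullvec\<close>,
  and \<open>P s r\<close> travels along the geodesics orthogonal to it, so the Busemann function
  \<open>ln (- lor p nullvec)\<close> sees only \<open>s\<close>.\<close>

lemma horocyclic_point:
  defines "P s r \<equiv> cosh s *\<^sub>R hgam r + sinh s *\<^sub>R hN r"
  shows "P s r \<in> H2" "ln (- lor (P s r) nullvec) = - s"
proof -
  have 1: "cosh s * cosh s = 1 + sinh s * sinh s"
    using cosh_square_eq[of s] by (simp add: power2_eq_square)
  have "lor (P s r) (P s r) = - (cosh s * cosh s) + sinh s * sinh s"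
    by (simp add: P_def lor_def hgam_def hN_def power2_eq_square field_simps)
  then have a: "lor (P s r) (P s r) = -1" using 1 by simp
  have e: "lor (P s r) nullvec = - exp (- s)"
    unfolding cosh_minus_sinh[symmetric] by (simp add: P_def lor_nullvec hgam_def hN_def field_simps)
  then show "ln (- lor (P s r) nullvec) = - s" by simp
  have "P s r $ 1 = cosh s + r\<^sup>2 / 2 * exp (- s)"
    by (simp add: P_def hgam_def hN_def cosh_minus_sinh[symmetric] field_simps)
  moreover have "r\<^sup>2 / 2 * exp (- s) \<ge> 0" by simp
  ultimately have "P s r $ 1 > 0" using cosh_real_pos[of s] by linarith
  then show "P s r \<in> H2" using a by (simp add: H2_def)
qed

lemma horocyclic_coordinates:
  assumes "p \<in> H2"
  defines "s \<equiv> - ln (- lor p nullvec)"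
  shows "\<exists>r. p = cosh s *\<^sub>R hgam r + sinh s *\<^sub>R hN r"
proof -
  define m where "m = p$1 - p$3"
  have m: "m > 0" using H2_nullvec_neg[OF assms(1)] by (simp add: lor_nullvec m_def)
  have "s = - ln m" by (simp add: s_def lor_nullvec m_def)
  then have cs: "cosh s = (1 / m + m) / 2" "sinh s = (1 / m - m) / 2"
    using m by (simp_all add: cosh_field_def sinh_field_def exp_minus field_simps)
  have h: "p$1 * p$1 = 1 + p$2 * p$2 + p$3 * p$3" using assms(1) by (simp add: H2_def lor_def)
  \<comment> \<open>The model point has second coordinate \<open>r * exp (- s)\<close>, and
    \<open>m\<close> is \<open>exp (- s)\<close>.\<close>
  define r where "r = p$2 / m"
  have r: "p$2 = r * m" using m by (simp add: r_def)
  have "(p$1 + p$3) * m = 1 + r\<^sup>2 * m\<^sup>2"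
    using h unfolding r m_def by (simp add: algebra_simps power2_eq_square)
  then have sum: "p$1 + p$3 = 1 / m + r\<^sup>2 * m" using m by (simp add: field_simps power2_eq_square)
  then have p13: "p$1 = (1 / m + r\<^sup>2 * m + m) / 2" "p$3 = (1 / m + r\<^sup>2 * m - m) / 2"
    by (simp_all add: m_def)
  have "p = cosh s *\<^sub>R hgam r + sinh s *\<^sub>R hN r"
    using m by (simp add: vec3_eq_iff hgam_def hN_def p13 r cs) (simp add: field_simps power2_eq_square)
  then show ?thesis ..
qed

text \<open>Both Busemann functions are linear in \<open>t\<close>. Eliminating \<open>t\<close>
  leaves one equation, and the two horocycle parameters range freely.\<close>

lemma M_c_11_eq:
  assumes "0 < c" "c < 1"
  shows "M_c_11 c = {(p, q). p \<in> H2 \<and> q \<in> H2 \<and> sqrt (1 - c) * ln (- lor p nullvec) = sqrt c * ln (- lor q nullvec)}"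
proof (intro set_eqI iffI)
  fix x assume "x \<in> M_c_11 c"
  then show "x \<in> {(p, q). p \<in> H2 \<and> q \<in> H2 \<and> sqrt (1 - c) * ln (- lor p nullvec) = sqrt c * ln (- lor q nullvec)}"
    by (auto simp: M_c_11_def horocyclic_point)
next
  fix x assume "x \<in> {(p, q). p \<in> H2 \<and> q \<in> H2 \<and> sqrt (1 - c) * ln (- lor p nullvec) = sqrt c * ln (- lor q nullvec)}"
  then obtain p q where x: "x = (p, q)" "p \<in> H2" "q \<in> H2" "sqrt (1 - c) * ln (- lor p nullvec) = sqrt c * ln (- lor q nullvec)"
    by auto
  define t where "t = - ln (- lor p nullvec) / sqrt c"
  have "sqrt c * t = - ln (- lor p nullvec)" "sqrt (1 - c) * t = - ln (- lor q nullvec)"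
    using assms x(4) by (simp_all add: t_def)
  then show "x \<in> M_c_11 c"
    using horocyclic_coordinates[OF x(2)] horocyclic_coordinates[OF x(3)] x(1)
    unfolding M_c_11_def by (metis (mono_tags, lifting) mem_Collect_eq)
qed

text \<open>\<open>hNt\<close> is the opposite normal of the horocycle, so the two models differ by
  the direction of travel in the second factor.\<close>

lemma hNt_eq: "cosh s *\<^sub>R hgam r + sinh s *\<^sub>R hNt r = cosh (- s) *\<^sub>R hgam r + sinh (- s) *\<^sub>R hN r"
  by (simp add: vec3_eq_iff hNt_def hN_def field_simps)

lemma M_c_1m1_eq:
  assumes "0 < c" "c < 1"
  shows "M_c_1m1 c = {(p, q). p \<in> H2 \<and> q \<in> H2 \<and> sqrt (1 - c) * ln (- lor p nullvec) = - (sqrt c * ln (- lor q nullvec))}"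
proof (intro set_eqI iffI)
  fix x assume "x \<in> M_c_1m1 c"
  then show "x \<in> {(p, q). p \<in> H2 \<and> q \<in> H2 \<and> sqrt (1 - c) * ln (- lor p nullvec) = - (sqrt c * ln (- lor q nullvec))}"
    unfolding M_c_1m1_def hNt_eq by (auto simp: horocyclic_point simp del: cosh_minus sinh_minus)
next
  fix x assume "x \<in> {(p, q). p \<in> H2 \<and> q \<in> H2 \<and> sqrt (1 - c) * ln (- lor p nullvec) = - (sqrt c * ln (- lor q nullvec))}"
  then obtain p q where x: "x = (p, q)" "p \<in> H2" "q \<in> H2" "sqrt (1 - c) * ln (- lor p nullvec) = - (sqrt c * ln (- lor q nullvec))"
    by auto
  define t where "t = - ln (- lor p nullvec) / sqrt c"
  have "sqrt c * t = - ln (- lor p nullvec)" "- (sqrt (1 - c) * t) = - ln (- lor q nullvec)"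
    using assms x(4) by (simp_all add: t_def)
  then show "x \<in> M_c_1m1 c"
    using horocyclic_coordinates[OF x(2)] horocyclic_coordinates[OF x(3)] x(1)
    unfolding M_c_1m1_def hNt_eq by (metis (mono_tags, lifting) mem_Collect_eq)
qed

section \<open>Curves of constant curvature\<close>

text \<open>\<open>f\<close> and \<open>g\<close> are the sine and versine of curvature \<open>- k\<close>.\<close>
lemma ex_generalized_sine:
  fixes k :: real
  shows "\<exists>f g :: real \<Rightarrow> real. (\<forall>s. (f has_real_derivative 1 + k * g s) (at s)) \<and>
    (\<forall>s. (g has_real_derivative f s) (at s)) \<and> (\<forall>s. (f s)\<^sup>2 = 2 * g s + k * (g s)\<^sup>2 \<and> g s \<ge> 0) \<and>
    (\<forall>x y. y \<ge> 0 \<longrightarrow> x\<^sup>2 = 2 * y + k * y\<^sup>2 \<longrightarrow> (\<exists>s. f s = x \<and> g s = y))"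
proof -
  consider "k > 0" | "k = 0" | "k < 0" by linarith
  then show ?thesis
  proof cases
    case 1
    define c where "c = sqrt k"
    have c: "c > 0" "k = c\<^sup>2" using 1 by (auto simp: c_def)
    define f where "f s = sinh (c * s) / c" for s
    define g where "g s = (cosh (c * s) - 1) / c\<^sup>2" for s
    have "(f has_real_derivative 1 + k * g s) (at s)" for s
      unfolding f_def g_def using c by (auto intro!: derivative_eq_intros)
    moreover have "(g has_real_derivative f s) (at s)" for s
      unfolding f_def g_def using c by (auto intro!: derivative_eq_intros simp: power2_eq_square)
    moreover have "(f s)\<^sup>2 = 2 * g s + k * (g s)\<^sup>2" "g s \<ge> 0" for s
    proof -
      have "(f s)\<^sup>2 = (cosh (c * s) ^ 2 - 1) / c\<^sup>2"
        by (simp add: f_def power_divide cosh_square_eq)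
      also have "\<dots> = 2 * g s + k * (g s)\<^sup>2"
        unfolding g_def c(2) using c(1) by (simp add: field_simps power2_eq_square)
      finally show "(f s)\<^sup>2 = 2 * g s + k * (g s)\<^sup>2" .
      show "g s \<ge> 0" using cosh_real_ge_1[of "c * s"] by (simp add: g_def)
    qed
    moreover have "\<exists>s. f s = x \<and> g s = y" if "y \<ge> 0" "x\<^sup>2 = 2 * y + k * y\<^sup>2" for x y
    proof -
      define s where "s = arsinh (c * x) / c"
      have s: "c * s = arsinh (c * x)" using c by (simp add: s_def)
      have "(c * x)\<^sup>2 + 1 = (1 + k * y)\<^sup>2"
        using that(2) unfolding power_mult_distrib c(2) by (simp add: power2_eq_square algebra_simps)
      moreover have "1 + k * y \<ge> 0" using that 1 by simp
      ultimately have "cosh (c * s) = 1 + k * y" unfolding s by (simp add: cosh_arsinh_real)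
      then have "g s = y" using c by (simp add: g_def)
      moreover have "f s = x" unfolding f_def s using c by simp
      ultimately show ?thesis by blast
    qed
    ultimately show ?thesis by blast
  next
    case 2
    have "\<exists>s. s = x \<and> s\<^sup>2 / 2 = y" if "y \<ge> 0" "x\<^sup>2 = 2 * y + k * y\<^sup>2" for x y :: real
      using that 2 by simp
    then show ?thesis
      by (intro exI[of _ "\<lambda>s. s"] exI[of _ "\<lambda>s. s\<^sup>2 / 2"]) (auto simp: 2 intro!: derivative_eq_intros)
  next
    case 3
    define c where "c = sqrt (- k)"
    have c: "c > 0" "k = - c\<^sup>2" using 3 by (auto simp: c_def)
    define f where "f s = sin (c * s) / c" for s
    define g where "g s = (1 - cos (c * s)) / c\<^sup>2" for s
    have "(f has_real_derivative 1 + k * g s) (at s)" for s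
      unfolding f_def g_def using c by (auto intro!: derivative_eq_intros)
    moreover have "(g has_real_derivative f s) (at s)" for s
      unfolding f_def g_def using c by (auto intro!: derivative_eq_intros simp: power2_eq_square)
    moreover have "(f s)\<^sup>2 = 2 * g s + k * (g s)\<^sup>2" "g s \<ge> 0" for s
    proof -
      have "(f s)\<^sup>2 = (1 - cos (c * s) ^ 2) / c\<^sup>2"
        by (simp add: f_def power_divide sin_squared_eq)
      also have "\<dots> = 2 * g s + k * (g s)\<^sup>2"
        unfolding g_def c(2) using c(1) by (simp add: field_simps power2_eq_square)
      finally show "(f s)\<^sup>2 = 2 * g s + k * (g s)\<^sup>2" .
      show "g s \<ge> 0" by (simp add: g_def)
    qed
    moreover have "\<exists>s. f s = x \<and> g s = y" if "y \<ge> 0" "x\<^sup>2 = 2 * y + k * y\<^sup>2" for x y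
    proof -
      have "(1 + k * y)\<^sup>2 + (c * x)\<^sup>2 = 1"
        using that(2) c(2) by algebra
      then obtain t where t: "1 + k * y = cos t" "c * x = sin t"
        using sincos_total_2pi by metis
      have "f (t / c) = x" using c t(2) by (simp add: f_def field_simps)
      moreover have "g (t / c) = y" using c t(1) by (simp add: g_def field_simps)
      ultimately show ?thesis by blast
    qed
    ultimately show ?thesis by blast
  qed
qed

text \<open>With \<open>w = p0 - \<alpha> n0\<close> as acceleration at \<open>p0\<close>, the
  section is swept out by \<open>p0 + f t0 + g w\<close>. It is a circle, a horocycle or an
  equidistant curve (a geodesic for \<open>\<alpha> = 0\<close>) according to the sign of
  \<open>k\<close>.\<close>

lemma const_curv_curve_level:
  assumes p0: "p0 \<in> H2" and F: "lframe p0 n0 t0"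
  shows "const_curv_curve {x \<in> H2. lor x (\<alpha> *\<^sub>R p0 - n0) = - \<alpha>}"
proof -
  define k where "k = 1 - \<alpha>\<^sup>2"
  obtain f g :: "real \<Rightarrow> real" where fg: "\<And>s. (f has_real_derivative 1 + k * g s) (at s)"
    "\<And>s. (g has_real_derivative f s) (at s)" "\<And>s. (f s)\<^sup>2 = 2 * g s + k * (g s)\<^sup>2" "\<And>s. g s \<ge> 0"
    "\<And>x y. y \<ge> 0 \<Longrightarrow> x\<^sup>2 = 2 * y + k * y\<^sup>2 \<Longrightarrow> \<exists>s. f s = x \<and> g s = y"
    using ex_generalized_sine[of k] by blast
  note FD = lframeD[OF F]
  define w where "w = p0 - \<alpha> *\<^sub>R n0"
  \<comment> \<open>Combinations of \<open>1, f, g\<close> are closed under differentiation, since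
    \<open>f' = 1 + k g\<close> and \<open>g' = f\<close>; this yields smoothness to all
    orders.\<close>
  define lin where "lin A B E s = A + f s *\<^sub>R B + g s *\<^sub>R E" for A B E :: "real^3" and s
  define \<gamma> where "\<gamma> = lin p0 t0 w"
  have der: "(lin A B E has_derivative (\<lambda>h. h *\<^sub>R lin B E (k *\<^sub>R B) s)) (at s)" for A B E s
  proof -
    have "(lin A B E has_vector_derivative lin B E (k *\<^sub>R B) s) (at s)"
      unfolding lin_def[abs_def] using fg(1,2)[of s]
      by (auto intro!: derivative_eq_intros simp: has_real_derivative_iff_has_vector_derivative algebra_simps)
    then show ?thesis by (simp add: has_vector_derivative_def)
  qed
  have fre: "frechet_derivative (lin A B E) (at s) h = h *\<^sub>R lin B E (k *\<^sub>R B) s" for A B E s h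
    using frechet_derivative_at[OF der] by metis
  have scal: "(\<lambda>s. h *\<^sub>R lin A B E s) = lin (h *\<^sub>R A) (h *\<^sub>R B) (h *\<^sub>R E)" for h A B E
    by (simp add: lin_def fun_eq_iff algebra_simps)
  have ddl_lin: "\<exists>A B E. ddl vs \<gamma> = lin A B E" for vs
  proof (induction vs)
    case Nil
    then show ?case by (auto simp: \<gamma>_def)
  next
    case (Cons v vs)
    then obtain A B E where "ddl vs \<gamma> = lin A B E" by blast
    then have "ddl (v # vs) \<gamma> = lin (v *\<^sub>R B) (v *\<^sub>R E) (v *\<^sub>R k *\<^sub>R B)"
      by (simp add: fre scal)
    then show ?case by blast
  qed
  have "smooth_on UNIV \<gamma>"
    unfolding smooth_on_def using ddl_lin der by (metis differentiableI)
  have d1: "ddl [1] \<gamma> = lin t0 w (k *\<^sub>R t0)"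
    by (simp add: \<gamma>_def fre)
  have d2: "ddl [1, 1] \<gamma> = lin w (k *\<^sub>R t0) (k *\<^sub>R w)"
    using d1 by (simp add: fre)
  have ff: "f s * f s = 2 * g s + k * (g s * g s)" for s
    using fg(3)[of s] by (simp add: power2_eq_square)
  have ww: "lor w w = - k" "lor w t0 = 0" "lor t0 w = 0" "lor p0 w = -1" "lor w p0 = -1" "lor w n0 = - \<alpha>" "lor n0 w = - \<alpha>"
    using FD by (simp_all add: w_def lor_simps k_def power2_eq_square)
  have on: "lor (\<gamma> s) (\<gamma> s) = -1" for s
  proof -
    have "lor (\<gamma> s) (\<gamma> s) = -1 - 2 * g s + f s * f s - k * (g s * g s)"
      using FD ww by (simp add: \<gamma>_def lin_def lor_simps algebra_simps)
    then show ?thesis unfolding ff by simp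
  qed
  have H: "\<gamma> s \<in> H2" for s
  proof (rule H2_I[OF p0 on])
    show "lor (\<gamma> s) p0 < 0" using FD ww fg(4)[of s] by (simp add: \<gamma>_def lin_def lor_simps)
  qed
  have speed: "lor (ddl [1] \<gamma> s) (ddl [1] \<gamma> s) = 1" for s
  proof -
    have "lor (ddl [1] \<gamma> s) (ddl [1] \<gamma> s) = (1 + k * g s) * (1 + k * g s) - k * (f s * f s)"
      unfolding d1 using FD ww by (simp add: lin_def lor_simps algebra_simps)
    then show ?thesis unfolding ff by (simp add: algebra_simps)
  qed
  have curv: "lor (ddl [1,1] \<gamma> s - \<gamma> s) (ddl [1,1] \<gamma> s - \<gamma> s) = \<alpha>\<^sup>2" for s
  proof -
    have eq: "ddl [1,1] \<gamma> s - \<gamma> s = - (\<alpha>\<^sup>2 * f s) *\<^sub>R t0 - \<alpha> *\<^sub>R n0 - (\<alpha>\<^sup>2 * g s) *\<^sub>R w"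
      unfolding d2 by (simp add: \<gamma>_def lin_def k_def w_def algebra_simps)
    have "lor (ddl [1,1] \<gamma> s - \<gamma> s) (ddl [1,1] \<gamma> s - \<gamma> s)
      = \<alpha>\<^sup>2 + \<alpha>\<^sup>2 * \<alpha>\<^sup>2 * (f s * f s) - 2 * \<alpha>\<^sup>2 * \<alpha>\<^sup>2 * g s - \<alpha>\<^sup>2 * \<alpha>\<^sup>2 * k * (g s * g s)"
      unfolding eq using FD ww by (simp add: lor_simps power2_eq_square algebra_simps)
    then show ?thesis unfolding ff by (simp add: algebra_simps)
  qed
  have "{x \<in> H2. lor x (\<alpha> *\<^sub>R p0 - n0) = - \<alpha>} = \<gamma> ` UNIV"
  proof (intro set_eqI iffI)
    fix x assume "x \<in> \<gamma> ` UNIV"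
    then obtain s where s: "x = \<gamma> s" by blast
    have "lor x (\<alpha> *\<^sub>R p0 - n0) = - \<alpha>"
      unfolding s using FD ww by (simp add: \<gamma>_def lin_def lor_simps algebra_simps)
    then show "x \<in> {x \<in> H2. lor x (\<alpha> *\<^sub>R p0 - n0) = - \<alpha>}" using H s by simp
  next
    fix x assume "x \<in> {x \<in> H2. lor x (\<alpha> *\<^sub>R p0 - n0) = - \<alpha>}"
    then have x: "x \<in> H2" "lor x (\<alpha> *\<^sub>R p0 - n0) = - \<alpha>" by auto
    define y where "y = - lor x p0 - 1"
    have p: "lor x p0 = - (1 + y)" by (simp add: y_def)
    have n: "lor x n0 = - \<alpha> * y" using x(2) by (simp add: lor_simps p algebra_simps)
    have "- ((1 + y) * (1 + y)) + \<alpha>\<^sup>2 * (y * y) + lor x t0 * lor x t0 = -1"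
      using lframe_lor[OF F, of x x] H2D[OF x(1)] unfolding p n by algebra
    then have t: "(lor x t0)\<^sup>2 = 2 * y + k * y\<^sup>2"
      by (simp add: k_def power2_eq_square algebra_simps)
    \<comment> \<open>\<open>1 + y\<close> is the hyperbolic cosine of a distance. A value of
      \<open>y\<close> between \<open>-1\<close> and \<open>0\<close> would make a sum of two
      squares negative.\<close>
    have "y \<ge> 0"
    proof (rule ccontr)
      assume "\<not> y \<ge> 0"
      moreover have "1 + y > 0" using H2_lor_neg[OF x(1) p0] p by simp
      ultimately have "2 * y + y * y < 0"
        using mult_neg_pos[of y "2 + y"] by (simp add: algebra_simps)
      moreover have "2 * y + y * y = (lor x t0)\<^sup>2 + (\<alpha> * y)\<^sup>2"
        using t by (simp add: k_def power2_eq_square algebra_simps)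
      ultimately show False using zero_le_power2[of "lor x t0"] zero_le_power2[of "\<alpha> * y"] by linarith
    qed
    then obtain s where s: "f s = lor x t0" "g s = y" using fg(5) t by blast
    have "x = (1 + y) *\<^sub>R p0 + (- \<alpha> * y) *\<^sub>R n0 + lor x t0 *\<^sub>R t0"
      using lframe_expand[OF F, of x] unfolding p n by (simp add: add.commute)
    also have "\<dots> = \<gamma> s" by (simp add: \<gamma>_def lin_def s w_def algebra_simps)
    finally show "x \<in> \<gamma> ` UNIV" by simp
  qed
  then show ?thesis
    unfolding const_curv_curve_def using \<open>smooth_on UNIV \<gamma>\<close> H speed curv
    by (intro exI[of _ \<gamma>] exI[of _ UNIV] exI[of _ \<alpha>]) auto
qed

section \<open>The horocyclic case\<close>

lemma future_null:
  assumes "p \<in> H2" "lor l l = 0" "lor l p < 0"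
  shows "l$1 > 0"
proof (rule ccontr)
  assume c: "\<not> l$1 > 0"
  show False
  proof (cases "l$1 = 0")
    case True
    then have "l$2 * l$2 + l$3 * l$3 = 0" using assms(2) by (simp add: lor_def)
    then have "l = 0" using True by (simp add: vec3_eq_iff sum_squares_eq_zero_iff)
    then show False using assms(3) by (simp add: lor_simps)
  next
    case False
    then have "lor (- l) p < 0" using c assms by (intro lor_future_neg) (auto simp: lor_simps)
    then show False using assms(3) by (simp add: lor_simps)
  qed
qed

text \<open>A derivative proportional to \<open>h\<close> fixes the direction of \<open>h\<close>
  and changes only its scale, at logarithmic rate \<kappa>; the first coordinate measures the
  scale.\<close>

lemma proportional_derivative:
  fixes h :: "'a::real_normed_vector \<Rightarrow> real^3"
  assumes h: "(h has_derivative (\<lambda>v. \<kappa> v *\<^sub>R h u)) (at u)" and pos: "h u $ 1 > 0"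
  shows "((\<lambda>w. (1 / h w $ 1) *\<^sub>R h w) has_derivative (\<lambda>_. 0)) (at u)"
    and "((\<lambda>w. ln (h w $ 1)) has_derivative \<kappa>) (at u)"
proof -
  have 1: "((\<lambda>w. h w $ 1) has_derivative (\<lambda>v. \<kappa> v * h u $ 1)) (at u)"
    using bounded_linear.has_derivative[OF bounded_linear_vec_nth h, of 1] by simp
  have 2: "((\<lambda>w. 1 / h w $ 1) has_derivative (\<lambda>v. - \<kappa> v / h u $ 1)) (at u)"
    using 1 pos by (auto intro!: derivative_eq_intros simp: fun_eq_iff field_simps power2_eq_square)
  show "((\<lambda>w. (1 / h w $ 1) *\<^sub>R h w) has_derivative (\<lambda>_. 0)) (at u)"
    using has_derivative_scaleR[OF 2 h] by (simp add: mult.commute)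
  show "((\<lambda>w. ln (h w $ 1)) has_derivative \<kappa>) (at u)"
    by (rule derivative_eq_intros 1 h refl pos)+ (use pos in \<open>auto simp: fun_eq_iff field_simps\<close>)
qed

text \<open>With \<open>m\<close> for \<open>thn\<close>, \<tau> for \<open>tht\<close> and
  connection form \<open>e * \<tau>\<close>, the parts of \<open>p'\<close> and \<open>e n'\<close>
  along \<open>t\<close> cancel and a multiple of the null vector \<open>p - e n\<close>
  remains.\<close>

lemma scaled_null_identity:
  fixes p n t :: "'a::real_vector"
  assumes "e * e = 1"
  shows "(m *\<^sub>R n + \<tau> *\<^sub>R t) - e *\<^sub>R (m *\<^sub>R p + (e * \<tau>) *\<^sub>R t) = (- (e * m)) *\<^sub>R (p - e *\<^sub>R n)"
proof -
  have e: "e * (e * \<tau>) = \<tau>" "e * (e * m) = m" using assms by (simp_all flip: mult.assoc)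
  show ?thesis by (simp add: scaleR_add_right scaleR_diff_right e mult.commute[of _ e] mult.assoc)
qed

lemma continuous_on_frame_map: "continuous_on A (frame_map p n t p' n' t')"
  unfolding frame_map_def[abs_def] by (intro continuous_intros lor.continuous_on)

lemma continuous_on_map_prod:
  assumes "continuous_on UNIV f" "continuous_on UNIV g"
  shows "continuous_on UNIV (map_prod f g)"
  unfolding map_prod_def case_prod_unfold
  by (intro continuous_on_Pair continuous_on_compose2[OF assms(1)] continuous_on_compose2[OF assms(2)] continuous_intros) auto

lemma isometry_inj: "isometry f \<Longrightarrow> inj_on f (H2 \<times> H2)"
  by (simp add: isometry_def bij_betw_def)

lemma standard_lframe: "lframe (axis 1 1) (axis 3 1) (axis 2 1)" and standard_H2: "axis 1 1 \<in> H2"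
  by (simp_all add: lframe_def lor_def axis_def H2_def)

text \<open>Sends the null direction \<open>p - e n\<close> to the point at infinity fixed by the model horocycle.\<close>
definition horo_map :: "real \<Rightarrow> real^3 \<Rightarrow> real^3 \<Rightarrow> real^3 \<Rightarrow> real^3 \<Rightarrow> real^3" where
  "horo_map e p n t = frame_map p (- e *\<^sub>R n) t (axis 1 1) (axis 3 1) (axis 2 1)"

lemma horo_map:
  assumes F: "lframe p n t" and e: "e\<^sup>2 = 1" and p: "p \<in> H2"
  shows "bij_betw (horo_map e p n t) H2 H2" "lor (horo_map e p n t x) (horo_map e p n t y) = lor x y"
    "lor (horo_map e p n t x) nullvec = lor x (p - e *\<^sub>R n)" "continuous_on A (horo_map e p n t)"
proof -
  note FD = lframeD[OF F]
  have F': "lframe p (- e *\<^sub>R n) t"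
    using FD e by (simp add: lframe_def lor_simps power2_eq_square)
  show "bij_betw (horo_map e p n t) H2 H2"
    unfolding horo_map_def by (rule bij_betw_frame_map_H2[OF F' standard_lframe p standard_H2])
  show l: "lor (horo_map e p n t x) (horo_map e p n t y) = lor x y" for x y
    unfolding horo_map_def by (rule frame_map_lor[OF F' standard_lframe])
  have "horo_map e p n t (p - e *\<^sub>R n) = nullvec"
    using FD e by (simp add: horo_map_def frame_map_def lor_simps power2_eq_square[symmetric] nullvec_def vec3_eq_iff axis_def)
  then show "lor (horo_map e p n t x) nullvec = lor x (p - e *\<^sub>R n)"
    using l[of x "p - e *\<^sub>R n"] by simp
  show "continuous_on A (horo_map e p n t)"
    unfolding horo_map_def by (rule continuous_on_frame_map)
qed

context cpc_shape begin

lemma horocyclic_case: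
  assumes flat: "\<forall>x\<in>M. mu x = 0 \<and> (al x)\<^sup>2 = 1 \<and> (de x)\<^sup>2 = 1"
  shows "\<exists>f. isometry f \<and> (\<exists>c. 0 < c \<and> c < 1 \<and> (open_part (f ` M) (M_c_1m1 c) \<or> open_part (f ` M) (M_c_11 c)))"
proof -
  obtain x0 where x0: "x0 \<in> M" using nonempty by blast
  define e1 where "e1 = al x0"
  define e2 where "e2 = de x0"
  have e: "e1\<^sup>2 = 1" "e2\<^sup>2 = 1" using flat x0 by (auto simp: e1_def e2_def)
  then have ee: "e1 * e1 = 1" "e2 * e2 = 1" by (simp_all add: power2_eq_square)
  have al: "al x = e1" if "x \<in> M" for x
    unfolding e1_def by (rule constant_of_square[OF _ _ coefficients_differentiable_chart(1) that x0, where c = 1])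
      (use flat in auto)
  have de: "de x = e2" if "x \<in> M" for x
    unfolding e2_def by (rule constant_of_square[OF _ _ coefficients_differentiable_chart(3) that x0, where c = 1])
      (use flat in auto)
  define L where "L x = fst x - e1 *\<^sub>R n1 x" for x
  define R where "R x = snd x - e2 *\<^sub>R n2 x" for x
  have LR: "L x $ 1 > 0" "R x $ 1 > 0" "lor (fst x) (L x) = -1" "lor (snd x) (R x) = -1" if x: "x \<in> M" for x
  proof -
    note FD = lframeD[OF lframe1[OF x]] lframeD[OF lframe2[OF x]]
    show l: "lor (fst x) (L x) = -1" "lor (snd x) (R x) = -1"
      using FD by (simp_all add: L_def R_def lor_simps)
    show "L x $ 1 > 0"
      by (rule future_null[OF M_H2(1)[OF x]]) (use l FD ee in \<open>simp_all add: L_def lor_simps lor_commute\<close>)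
    show "R x $ 1 > 0"
      by (rule future_null[OF M_H2(2)[OF x]]) (use l FD ee in \<open>simp_all add: R_def lor_simps lor_commute\<close>)
  qed
  have der: "\<exists>\<nu>. ((\<lambda>u. L (\<phi> u)) has_derivative (\<lambda>v. (- (e1 * a) * \<nu> v) *\<^sub>R L (\<phi> u))) (at u) \<and>
      ((\<lambda>u. R (\<phi> u)) has_derivative (\<lambda>v. (e2 * b * \<nu> v) *\<^sub>R R (\<phi> u))) (at u)"
    if c: "chart M U \<phi>" "u \<in> U" for U \<phi> u
  proof -
    interpret cpc_shape_chart M N C k1 k2 k3 al mu de U \<phi> by unfold_locales (rule c(1))
    have om: "F1.om u v = e1 * F1.tht u v" "F2.om u v = e2 * F2.tht u v" for v
      using om_eq[OF c(2), of v] flat phi_M[OF c(2)] al de by simp_all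
    have "((\<lambda>u. L (\<phi> u)) has_derivative (\<lambda>v. fst (D u v) - e1 *\<^sub>R ((1 / b) *\<^sub>R fst (DN u v)))) (at u)"
      unfolding L_def by (intro has_derivative_diff has_derivative_scaleR_right F1.p_der[OF c(2)] F1.n_der[OF c(2)])
    moreover have "fst (D u v) - e1 *\<^sub>R ((1 / b) *\<^sub>R fst (DN u v)) = (- (e1 * a) * nu u v) *\<^sub>R L (\<phi> u)" for v
      unfolding F1.p'_expand[OF c(2)] F1.n'_expand[OF c(2)] om scaled_null_identity[OF ee(1)] thn_nu[OF c(2)] L_def
      by (simp add: mult.assoc)
    ultimately have 1: "((\<lambda>u. L (\<phi> u)) has_derivative (\<lambda>v. (- (e1 * a) * nu u v) *\<^sub>R L (\<phi> u))) (at u)" by simp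
    have "((\<lambda>u. R (\<phi> u)) has_derivative (\<lambda>v. snd (D u v) - e2 *\<^sub>R ((1 / a) *\<^sub>R snd (DN u v)))) (at u)"
      unfolding R_def by (intro has_derivative_diff has_derivative_scaleR_right F2.p_der[OF c(2)] F2.n_der[OF c(2)])
    moreover have "snd (D u v) - e2 *\<^sub>R ((1 / a) *\<^sub>R snd (DN u v)) = (e2 * b * nu u v) *\<^sub>R R (\<phi> u)" for v
      unfolding F2.p'_expand[OF c(2)] F2.n'_expand[OF c(2)] om scaled_null_identity[OF ee(2)] thn_nu[OF c(2)] R_def
      by (simp add: mult.assoc)
    ultimately have "((\<lambda>u. R (\<phi> u)) has_derivative (\<lambda>v. (e2 * b * nu u v) *\<^sub>R R (\<phi> u))) (at u)" by simp
    with 1 show ?thesis by blast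
  qed
  \<comment> \<open>\<open>L\<close> and \<open>R\<close> scale at rates
    \<open>- (e1 * a) * \<nu>\<close> and \<open>e2 * b * \<nu>\<close>; the weights
    \<open>e1 * b\<close> and \<open>e2 * a\<close> make these cancel.\<close>
  define G where "G x = ((1 / L x $ 1) *\<^sub>R L x, (1 / R x $ 1) *\<^sub>R R x, e1 * b * ln (L x $ 1) + e2 * a * ln (R x $ 1))" for x
  have G: "G x = G x0" if "x \<in> M" for x
  proof (rule chart_zero_derivative_imp_constant[OF hyp conn _ that x0])
    fix U \<phi> u assume c: "chart M U \<phi>" "u \<in> U"
    obtain \<nu> where \<nu>: "((\<lambda>u. L (\<phi> u)) has_derivative (\<lambda>v. (- (e1 * a) * \<nu> v) *\<^sub>R L (\<phi> u))) (at u)"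
      "((\<lambda>u. R (\<phi> u)) has_derivative (\<lambda>v. (e2 * b * \<nu> v) *\<^sub>R R (\<phi> u))) (at u)"
      using der[OF c] by blast
    note x = LR[OF chartD(2)[OF c]]
    note PL = proportional_derivative[OF \<nu>(1) x(1)] and PR = proportional_derivative[OF \<nu>(2) x(2)]
    have "((\<lambda>u. e1 * b * ln (L (\<phi> u) $ 1) + e2 * a * ln (R (\<phi> u) $ 1)) has_derivative
       (\<lambda>v. e1 * b * (- (e1 * a) * \<nu> v) + e2 * a * (e2 * b * \<nu> v))) (at u)"
      by (intro has_derivative_add has_derivative_mult_right PL PR)
    moreover have "e1 * b * (- (e1 * a) * \<nu> v) + e2 * a * (e2 * b * \<nu> v) = 0" for v
    proof -
      have "e1 * b * (- (e1 * a) * \<nu> v) + e2 * a * (e2 * b * \<nu> v) = (e2 * e2 - e1 * e1) * (a * b * \<nu> v)"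
        by (simp add: algebra_simps)
      then show ?thesis using ee by simp
    qed
    ultimately have 3: "((\<lambda>u. e1 * b * ln (L (\<phi> u) $ 1) + e2 * a * ln (R (\<phi> u) $ 1)) has_derivative (\<lambda>v. 0)) (at u)"
      by (simp only:)
    show "((\<lambda>u. G (\<phi> u)) has_derivative (\<lambda>_. 0)) (at u)"
      unfolding G_def using has_derivative_Pair[OF PL(1) has_derivative_Pair[OF PR(1) 3]] by (simp add: zero_prod_def)
  qed
  \<comment> \<open>\<open>L x0\<close> is parallel to \<open>L x\<close>, and
    \<open>lor (fst x) (L x) = -1\<close>, so pairing with \<open>L x0\<close> reads off the ratio
    of the scales. Basing the functions at \<open>x0\<close> makes the level
    \<open>0\<close>.\<close>
  have rel: "e1 * b * ln (- lor (fst x) (L x0)) + e2 * a * ln (- lor (snd x) (R x0)) = 0" if x: "x \<in> M" for x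
  proof -
    note l = LR[OF x] and l0 = LR[OF x0]
    have g: "(1 / L x0 $ 1) *\<^sub>R L x0 = (1 / L x $ 1) *\<^sub>R L x" "(1 / R x0 $ 1) *\<^sub>R R x0 = (1 / R x $ 1) *\<^sub>R R x"
      "e1 * b * ln (L x $ 1) + e2 * a * ln (R x $ 1) = e1 * b * ln (L x0 $ 1) + e2 * a * ln (R x0 $ 1)"
      using G[OF x] by (simp_all add: G_def)
    have "L x0 = (L x0 $ 1) *\<^sub>R ((1 / L x0 $ 1) *\<^sub>R L x0)" using l0(1) by simp
    also have "\<dots> = (L x0 $ 1 / L x $ 1) *\<^sub>R L x" unfolding g by simp
    finally have "lor (fst x) (L x0) = lor (fst x) ((L x0 $ 1 / L x $ 1) *\<^sub>R L x)" by (rule arg_cong)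
    then have 1: "- lor (fst x) (L x0) = L x0 $ 1 / L x $ 1" using l by (simp add: lor_simps)
    have "R x0 = (R x0 $ 1) *\<^sub>R ((1 / R x0 $ 1) *\<^sub>R R x0)" using l0(2) by simp
    also have "\<dots> = (R x0 $ 1 / R x $ 1) *\<^sub>R R x" unfolding g by simp
    finally have "lor (snd x) (R x0) = lor (snd x) ((R x0 $ 1 / R x $ 1) *\<^sub>R R x)" by (rule arg_cong)
    then have 2: "- lor (snd x) (R x0) = R x0 $ 1 / R x $ 1" using l by (simp add: lor_simps)
    show ?thesis
      unfolding 1 2 using g(3) l l0 by (simp add: ln_div algebra_simps)
  qed
  define f1 where "f1 = horo_map e1 (fst x0) (n1 x0) (t1 x0)"
  define f2 where "f2 = horo_map e2 (snd x0) (n2 x0) (t2 x0)"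
  define f where "f = map_prod f1 f2"
  note h1 = horo_map[OF lframe1[OF x0] e(1) M_H2(1)[OF x0], folded f1_def L_def]
    and h2 = horo_map[OF lframe2[OF x0] e(2) M_H2(2)[OF x0], folded f2_def R_def]
  have iso: "isometry f" unfolding f_def by (rule isometry_map_prod) (fact h1 h2)+
  have cont: "continuous_on UNIV f" unfolding f_def by (intro continuous_on_map_prod h1 h2)
  \<comment> \<open>Matches the weights \<open>b\<close> and \<open>a\<close> of \<open>rel\<close>
    with \<open>sqrt (1 - c)\<close> and \<open>sqrt c\<close> in the model equations.\<close>
  define c where "c = a\<^sup>2"
  have c: "0 < c" "c < 1" "sqrt c = a" "sqrt (1 - c) = b"
  proof -
    show "0 < c" using ab(1) by (simp add: c_def)
    have "b\<^sup>2 > 0" using ab(2) by simp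
    then show "c < 1" using ab_sum unfolding c_def by linarith
    have "1 - c = b\<^sup>2" using ab_sum by (simp add: c_def)
    then show "sqrt c = a" "sqrt (1 - c) = b" using ab(1,2) by (simp_all add: c_def)
  qed
  have inH: "f1 (fst x) \<in> H2" "f2 (snd x) \<in> H2" if "x \<in> M" for x
    using h1(1) h2(1) M_H2[OF that] bij_betwE by blast+
  have indep: "lcross nullvec q \<noteq> 0" if "q \<in> H2" for q
  proof
    assume "lcross nullvec q = 0"
    then have "(lor nullvec q)\<^sup>2 = 0"
      using lor_lcross_self[of nullvec q] nullvec_null by (simp add: lor_simps)
    then show False using H2_nullvec_neg[OF that] by (simp add: lor_commute)
  qed
  have fib: "lor q nullvec = lor q' nullvec"
    if "q \<in> H2" "q' \<in> H2" "sqrt c * ln (- lor q nullvec) = sqrt c * ln (- lor q' nullvec)" for q q'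
    using that(3) c(1) H2_nullvec_neg[OF that(1)] H2_nullvec_neg[OF that(2)] by simp
  have indepM: "lcross nullvec q \<noteq> 0" if "(p, q) \<in> f ` M" for p q
    using that inH indep by (auto simp: f_def)
  \<comment> \<open>Opposite signs lead to \<open>M_c_11\<close>, equal signs to
    \<open>M_c_1m1\<close>.\<close>
  have "e1 = 1 \<or> e1 = -1" "e2 = 1 \<or> e2 = -1" using e by (auto simp: power2_eq_1_iff)
  then consider "e2 = - e1" | "e2 = e1" by auto
  then show ?thesis
  proof cases
    case 1
    have "b * ln (- lor (fst x) (L x0)) = a * ln (- lor (snd x) (R x0))" if "x \<in> M" for x
    proof -
      have "e1 * (b * ln (- lor (fst x) (L x0)) - a * ln (- lor (snd x) (R x0))) = 0"
        using rel[OF that] unfolding 1 by (simp add: algebra_simps)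
      then show ?thesis using e(1) by auto
    qed
    then have "f ` M \<subseteq> M_c_11 c"
      unfolding M_c_11_eq[OF c(1,2)] using inH h1(3) h2(3) c by (auto simp: f_def)
    then have "open_part (f ` M) (M_c_11 c)"
      by (rule open_part_image[OF hyp cont isometry_inj[OF iso], where W = "\<lambda>_. nullvec"])
        (use fib indepM in \<open>auto simp: M_c_11_eq[OF c(1,2)]\<close>)
    then show ?thesis using iso c by blast
  next
    case 2
    have "b * ln (- lor (fst x) (L x0)) = - (a * ln (- lor (snd x) (R x0)))" if "x \<in> M" for x
    proof -
      have "e1 * (b * ln (- lor (fst x) (L x0)) + a * ln (- lor (snd x) (R x0))) = 0"
        using rel[OF that] unfolding 2 by (simp add: algebra_simps)
      then show ?thesis using e(1) by auto
    qed
    then have "f ` M \<subseteq> M_c_1m1 c"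
      unfolding M_c_1m1_eq[OF c(1,2)] using inH h1(3) h2(3) c by (auto simp: f_def)
    then have "open_part (f ` M) (M_c_1m1 c)"
      by (rule open_part_image[OF hyp cont isometry_inj[OF iso], where W = "\<lambda>_. nullvec"])
        (use fib indepM in \<open>auto simp: M_c_1m1_eq[OF c(1,2)]\<close>)
    then show ?thesis using iso c by blast
  qed
qed

end

section \<open>The equidistant case\<close>

context cpc_shape begin

lemma equidistant_case:
  assumes "a = b" and A: "\<forall>x\<in>M. mu x \<noteq> 0 \<and> al x = A \<and> de x = A \<and> A\<^sup>2 = 1 + (mu x)\<^sup>2 / 2"
  shows "\<exists>f. isometry f \<and> (\<exists>\<tau>. \<tau> < -1 \<and> open_part (f ` M) (M_tau \<tau>))"
proof -
  obtain x0 where x0: "x0 \<in> M" using nonempty by blast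
  have a2: "a\<^sup>2 = 1 / 2" using ab_sum assms(1) by simp
  have mu: "mu x = mu x0" if "x \<in> M" for x
    by (rule constant_of_square[OF _ _ coefficients_differentiable_chart(2) that x0, where c = "2 * (A\<^sup>2 - 1)"])
      (use A x0 in auto)
  define r where "r = a * mu x0"
  have r: "r \<noteq> 0" using A x0 ab by (auto simp: r_def)
  have r2: "r\<^sup>2 = A\<^sup>2 - 1" using A x0 by (simp add: r_def power_mult_distrib a2)
  have "A\<^sup>2 \<noteq> 0" using r2 zero_le_power2[of r] by linarith
  then have A0: "A \<noteq> 0" by simp
  \<comment> \<open>The boost \<open>(K, S)\<close> is dictated by the wish that the boosted point
    move like \<open>q\<close>: the coefficient \<open>K + S * A\<close> of \<open>F1.tht\<close>
    must vanish and \<open>S * r\<close> must be a sign. That sign is taken to make \<open>K\<close>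
    positive, and \<open>r\<^sup>2 = A\<^sup>2 - 1\<close> becomes
    \<open>K * K - S * S = 1\<close>.\<close>
  define \<sigma> where "\<sigma> = - sgn (A / r)"
  define S where "S = \<sigma> / r"
  define K where "K = - A * S"
  have \<sigma>: "\<sigma> * \<sigma> = 1" using A0 r by (simp add: \<sigma>_def sgn_if)
  have Sr: "S * r = \<sigma>" using r by (simp add: S_def)
  have KS: "K * K - S * S = 1"
  proof -
    have "(K * K - S * S) * r\<^sup>2 = (A\<^sup>2 - 1) * (S * r)\<^sup>2" unfolding K_def by algebra
    also have "\<dots> = 1 * r\<^sup>2" unfolding Sr using r2 \<sigma> by (simp add: power2_eq_square)
    finally show ?thesis using r by simp
  qed
  have "K = \<bar>A / r\<bar>"
    using A0 r by (simp add: K_def S_def \<sigma>_def abs_if sgn_if field_simps)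
  then have "K > 0" using A0 r by simp
  have "S \<noteq> 0" using Sr \<sigma> by auto
  then have "S * S > 0" by (simp add: zero_less_mult_iff linorder_neq_iff[symmetric])
  then have "1\<^sup>2 < K\<^sup>2" using KS by (simp add: power2_eq_square)
  then have K1: "K > 1" using \<open>K > 0\<close> by (intro power_less_imp_less_base[of 1 2 K]) auto
  have id1: "K + S * A = 0" by (simp add: K_def)
  have id2: "S + K * A = - (\<sigma> * r)"
  proof -
    have "S + K * A = - S * r\<^sup>2" unfolding r2 K_def by (simp add: algebra_simps power2_eq_square)
    then show ?thesis using Sr by (simp add: power2_eq_square flip: mult.assoc)
  qed
  have id3: "K * r = - (\<sigma> * A)" unfolding K_def using Sr by (simp add: algebra_simps)
  define p' where "p' x = K *\<^sub>R fst x + S *\<^sub>R n1 x" for x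
  define n' where "n' x = - (S *\<^sub>R fst x + K *\<^sub>R n1 x)" for x
  define t' where "t' x = \<sigma> *\<^sub>R t1 x" for x
  have F': "lframe (p' x) (n' x) (t' x)" if "x \<in> M" for x
    using lframeD[OF lframe1[OF that]] KS \<sigma>
    by (simp add: lframe_def p'_def n'_def t'_def lor_simps algebra_simps)
  have p'H: "p' x \<in> H2" if x: "x \<in> M" for x
    by (rule H2_I[OF M_H2(1)[OF x]])
      (use lframeD[OF F'[OF x]] lframeD[OF lframe1[OF x]] \<open>K > 0\<close> in \<open>simp_all add: p'_def lor_simps\<close>)
  \<comment> \<open>The boosted frame satisfies the same differential equations, with the same
    coefficient forms, as the frame at \<open>q\<close> (\<open>dP, dN, dT\<close> against
    \<open>dq, dn2, dt2\<close>). Hence the transformation between them does not change.\<close>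
  define B where "B x = frame_map (snd x) (n2 x) (t2 x) (p' x) (n' x) (t' x)" for x
  have B: "B x y = B x0 y" if x: "x \<in> M" for x y
  proof (rule chart_zero_derivative_imp_constant[OF hyp conn _ x x0, of "\<lambda>x. B x y"])
    fix U \<phi> u assume c: "chart M U \<phi>" "u \<in> U"
    interpret cpc_shape_chart M N C k1 k2 k3 al mu de U \<phi> by unfold_locales (rule c(1))
    have om: "F1.om u v = A * F1.tht u v + r * F2.tht u v" "F2.om u v = r * F1.tht u v + A * F2.tht u v" for v
      using om_eq[OF c(2), of v] A phi_M[OF c(2)] mu assms(1) by (simp_all add: r_def)
    define P where "P = p' (\<phi> u)"
    define Nn where "Nn = n' (\<phi> u)"
    have basis: "fst (\<phi> u) = K *\<^sub>R P + S *\<^sub>R Nn" "n1 (\<phi> u) = - (S *\<^sub>R P + K *\<^sub>R Nn)"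
    proof -
      have "K *\<^sub>R P + S *\<^sub>R Nn = (K * K - S * S) *\<^sub>R fst (\<phi> u)" "- (S *\<^sub>R P + K *\<^sub>R Nn) = (K * K - S * S) *\<^sub>R n1 (\<phi> u)"
        by (simp_all add: P_def Nn_def p'_def n'_def algebra_simps)
      then show "fst (\<phi> u) = K *\<^sub>R P + S *\<^sub>R Nn" "n1 (\<phi> u) = - (S *\<^sub>R P + K *\<^sub>R Nn)"
        unfolding KS by simp_all
    qed
    define \<theta> where "\<theta> v = F1.thn u v" for v
    have thn2: "F2.thn u v = - \<theta> v" for v
      using thn_nu[OF c(2), of v] assms(1) by (simp add: \<theta>_def)
    have c1: "K * F1.tht u v + S * F1.om u v = \<sigma> * F2.tht u v" for v
    proof -
      have "K * F1.tht u v + S * F1.om u v = (K + S * A) * F1.tht u v + (S * r) * F2.tht u v"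
        unfolding om by (simp add: algebra_simps)
      then show ?thesis unfolding id1 Sr by simp
    qed
    have c2: "S * F1.tht u v + K * F1.om u v = - (\<sigma> * F2.om u v)" for v
    proof -
      have "S * F1.tht u v + K * F1.om u v = (S + K * A) * F1.tht u v + (K * r) * F2.tht u v"
        unfolding om by (simp add: algebra_simps)
      then show ?thesis unfolding id2 id3 om by (simp add: algebra_simps)
    qed
    have dP: "((\<lambda>u. p' (\<phi> u)) has_derivative (\<lambda>v. - \<theta> v *\<^sub>R Nn + (\<sigma> * F2.tht u v) *\<^sub>R t1 (\<phi> u))) (at u)"
    proof -
      have "((\<lambda>u. p' (\<phi> u)) has_derivative (\<lambda>v. K *\<^sub>R fst (D u v) + S *\<^sub>R ((1 / b) *\<^sub>R fst (DN u v)))) (at u)"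
        unfolding p'_def by (intro has_derivative_add has_derivative_scaleR_right F1.p_der[OF c(2)] F1.n_der[OF c(2)])
      moreover have "K *\<^sub>R fst (D u v) + S *\<^sub>R ((1 / b) *\<^sub>R fst (DN u v)) = - \<theta> v *\<^sub>R Nn + (\<sigma> * F2.tht u v) *\<^sub>R t1 (\<phi> u)" for v
        unfolding F1.p'_expand[OF c(2)] F1.n'_expand[OF c(2)] c1[symmetric] t_eq \<theta>_def Nn_def n'_def
        by (simp add: algebra_simps)
      ultimately show ?thesis by simp
    qed
    have dN: "((\<lambda>u. n' (\<phi> u)) has_derivative (\<lambda>v. - \<theta> v *\<^sub>R P + (\<sigma> * F2.om u v) *\<^sub>R t1 (\<phi> u))) (at u)"
    proof -
      have "((\<lambda>u. n' (\<phi> u)) has_derivative (\<lambda>v. - (S *\<^sub>R fst (D u v) + K *\<^sub>R ((1 / b) *\<^sub>R fst (DN u v))))) (at u)"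
        unfolding n'_def by (intro has_derivative_minus has_derivative_add has_derivative_scaleR_right F1.p_der[OF c(2)] F1.n_der[OF c(2)])
      moreover have "- (S *\<^sub>R fst (D u v) + K *\<^sub>R ((1 / b) *\<^sub>R fst (DN u v))) = - \<theta> v *\<^sub>R P + (\<sigma> * F2.om u v) *\<^sub>R t1 (\<phi> u)" for v
      proof -
        have s: "\<sigma> * F2.om u v = - (S * F1.tht u v + K * F1.om u v)" using c2[of v] by simp
        show ?thesis
          unfolding s F1.p'_expand[OF c(2)] F1.n'_expand[OF c(2)] t_eq \<theta>_def P_def p'_def
          by (simp add: algebra_simps)
      qed
      ultimately show ?thesis by simp
    qed
    have dT: "((\<lambda>u. t' (\<phi> u)) has_derivative (\<lambda>v. F2.tht u v *\<^sub>R P - F2.om u v *\<^sub>R Nn)) (at u)"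
    proof -
      have "((\<lambda>u. t' (\<phi> u)) has_derivative (\<lambda>v. \<sigma> *\<^sub>R F1.t' u v)) (at u)"
        unfolding t'_def t_eq(1)[symmetric] by (intro has_derivative_scaleR_right F1.t_der[OF c(2)])
      moreover have "\<sigma> *\<^sub>R F1.t' u v = F2.tht u v *\<^sub>R P - F2.om u v *\<^sub>R Nn" for v
      proof -
        have "\<sigma> *\<^sub>R F1.t' u v = (\<sigma> * (K * F1.tht u v + S * F1.om u v)) *\<^sub>R P + (\<sigma> * (S * F1.tht u v + K * F1.om u v)) *\<^sub>R Nn"
          unfolding F1.t'_expand[OF c(2)] basis by (simp add: algebra_simps)
        also have "\<dots> = (\<sigma> * \<sigma> * F2.tht u v) *\<^sub>R P - (\<sigma> * \<sigma> * F2.om u v) *\<^sub>R Nn"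
          unfolding c1 c2 by (simp add: mult.assoc)
        finally show ?thesis unfolding \<sigma> by simp
      qed
      ultimately show ?thesis by simp
    qed
    have lin: "((\<lambda>u. lor y (x u)) has_derivative (\<lambda>v. lor y (x' v))) (at u)" if "(x has_derivative x') (at u)" for x x'
      by (rule bounded_linear.has_derivative[OF lor.bounded_linear_right that])
    have dq: "((\<lambda>u. lor y (snd (\<phi> u))) has_derivative (\<lambda>v. lor y (- \<theta> v *\<^sub>R n2 (\<phi> u) + F2.tht u v *\<^sub>R t2 (\<phi> u)))) (at u)"
      using lin[OF F2.p_der[OF c(2)]] unfolding F2.p'_expand[OF c(2)] thn2 t_eq .
    have dn2: "((\<lambda>u. lor y (n2 (\<phi> u))) has_derivative (\<lambda>v. lor y (- \<theta> v *\<^sub>R snd (\<phi> u) + F2.om u v *\<^sub>R t2 (\<phi> u)))) (at u)"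
      using lin[OF F2.n_der[OF c(2)]] unfolding F2.n'_expand[OF c(2)] thn2 t_eq .
    have dt2: "((\<lambda>u. lor y (t2 (\<phi> u))) has_derivative (\<lambda>v. lor y (F2.tht u v *\<^sub>R snd (\<phi> u) - F2.om u v *\<^sub>R n2 (\<phi> u)))) (at u)"
      using lin[OF F2.t_der[OF c(2)]] unfolding F2.t'_expand[OF c(2)] t_eq .
    have "((\<lambda>u. B (\<phi> u) y) has_derivative (\<lambda>v.
        (- lor y (snd (\<phi> u))) *\<^sub>R (- \<theta> v *\<^sub>R Nn + (\<sigma> * F2.tht u v) *\<^sub>R t1 (\<phi> u))
        + (- lor y (- \<theta> v *\<^sub>R n2 (\<phi> u) + F2.tht u v *\<^sub>R t2 (\<phi> u))) *\<^sub>R P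
        + (lor y (n2 (\<phi> u)) *\<^sub>R (- \<theta> v *\<^sub>R P + (\<sigma> * F2.om u v) *\<^sub>R t1 (\<phi> u))
          + lor y (- \<theta> v *\<^sub>R snd (\<phi> u) + F2.om u v *\<^sub>R t2 (\<phi> u)) *\<^sub>R Nn)
        + (lor y (t2 (\<phi> u)) *\<^sub>R (F2.tht u v *\<^sub>R P - F2.om u v *\<^sub>R Nn)
          + lor y (F2.tht u v *\<^sub>R snd (\<phi> u) - F2.om u v *\<^sub>R n2 (\<phi> u)) *\<^sub>R t' (\<phi> u)))) (at u)"
      unfolding B_def frame_map_def P_def Nn_def
      by (intro has_derivative_add has_derivative_scaleR has_derivative_minus dP[unfolded P_def Nn_def]
          dN[unfolded P_def Nn_def] dT[unfolded P_def Nn_def] dq dn2 dt2)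
    moreover have "(- lor y (snd (\<phi> u))) *\<^sub>R (- \<theta> v *\<^sub>R Nn + (\<sigma> * F2.tht u v) *\<^sub>R t1 (\<phi> u))
        + (- lor y (- \<theta> v *\<^sub>R n2 (\<phi> u) + F2.tht u v *\<^sub>R t2 (\<phi> u))) *\<^sub>R P
        + (lor y (n2 (\<phi> u)) *\<^sub>R (- \<theta> v *\<^sub>R P + (\<sigma> * F2.om u v) *\<^sub>R t1 (\<phi> u))
          + lor y (- \<theta> v *\<^sub>R snd (\<phi> u) + F2.om u v *\<^sub>R t2 (\<phi> u)) *\<^sub>R Nn)
        + (lor y (t2 (\<phi> u)) *\<^sub>R (F2.tht u v *\<^sub>R P - F2.om u v *\<^sub>R Nn)
          + lor y (F2.tht u v *\<^sub>R snd (\<phi> u) - F2.om u v *\<^sub>R n2 (\<phi> u)) *\<^sub>R t' (\<phi> u)) = 0" for v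
      unfolding t'_def by (simp add: lor_simps algebra_simps)
    ultimately show "((\<lambda>u. B (\<phi> u) y) has_derivative (\<lambda>_. 0)) (at u)" by (simp only:)
  qed
  have B0: "bij_betw (B x0) H2 H2" "lor (B x0 x) (B x0 y) = lor x y" "continuous_on UNIV (B x0)" for x y
    unfolding B_def
    using bij_betw_frame_map_H2[OF lframe2[OF x0] F'[OF x0] M_H2(2)[OF x0] p'H[OF x0]]
      frame_map_lor[OF lframe2[OF x0] F'[OF x0]] continuous_on_frame_map by blast+
  define f :: "pt \<Rightarrow> pt" where "f = map_prod id (B x0)"
  have iso: "isometry f" unfolding f_def by (rule isometry_map_prod) (use B0 in auto)
  have cont: "continuous_on UNIV f"
    unfolding f_def using continuous_on_map_prod[OF continuous_on_id[unfolded id_def[symmetric]] B0(3)] by (simp add: id_def)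
  have "f ` M \<subseteq> M_tau (- K)"
  proof
    fix z assume "z \<in> f ` M"
    then obtain x where x: "x \<in> M" "z = (fst x, B x0 (snd x))" by (auto simp: f_def)
    have "B x0 (snd x) = p' x"
      using B[OF x(1), of "snd x"] lframeD[OF lframe2[OF x(1)]] by (simp add: B_def frame_map_def)
    then have "lor (fst x) (B x0 (snd x)) = - K"
      using lframeD[OF lframe1[OF x(1)]] by (simp add: p'_def lor_simps)
    then show "z \<in> M_tau (- K)"
      using x M_H2[OF x(1)] B0(1) bij_betwE by (force simp: M_tau_def)
  qed
  then have "open_part (f ` M) (M_tau (- K))"
  \<comment> \<open>The fibre over \<open>p\<close> is the circle of radius \<open>arcosh K\<close>
    about \<open>p\<close>, a plane section with conormal \<open>p\<close> itself.\<close>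
  proof (rule open_part_image[OF hyp cont isometry_inj[OF iso], where W = "\<lambda>p. p"])
    fix p q assume "(p, q) \<in> f ` M"
    then have pq: "p \<in> H2" "q \<in> H2" "lor p q = - K" using \<open>f ` M \<subseteq> M_tau (- K)\<close> by (auto simp: M_tau_def)
    show "lcross p q \<noteq> 0"
    proof
      assume "lcross p q = 0"
      then have "K\<^sup>2 - 1 = 0" using lor_lcross_self[of p q] pq H2D by (simp add: lor_simps)
      then show False using \<open>1\<^sup>2 < K\<^sup>2\<close> by simp
    qed
  qed (auto simp: M_tau_def lor_commute)
  then show ?thesis using iso K1 by (intro exI[of _ f] conjI exI[of _ "- K"]) auto
qed

end

section \<open>The product case\<close>

context cpc_hypersurface begin

text \<open>When \<open>|C| = 1\<close> one component of the normal vanishes and \<open>M\<close> is a product; \<open>pr\<close> projects to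
  the factor containing the normal.\<close>
lemma normal_in_factor:
  fixes pr pr' :: "pt \<Rightarrow> real^3"
  assumes pr: "(pr = fst \<and> pr' = snd \<and> C = 1) \<or> (pr = snd \<and> pr' = fst \<and> C = -1)" and x: "x \<in> M"
  shows "pr' (N x) = 0" "lframe (pr x) (pr (N x)) (lcross (pr x) (pr (N x)))"
proof -
  show "pr' (N x) = 0"
    using pr N_norms[OF x] H2_tangent_spacelike(2)[OF M_H2(1)[OF x] N_orth(1)[OF x]]
      H2_tangent_spacelike(2)[OF M_H2(2)[OF x] N_orth(2)[OF x]] by auto
  show "lframe (pr x) (pr (N x)) (lcross (pr x) (pr (N x)))"
    using pr N_norms[OF x] N_orth[OF x] H2D M_H2[OF x] by (intro lframe_lcross) auto
qed

text \<open>The derivative of \<open>N\<close> has no part in the other factor, so two rows of the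
  symmetric matrix vanish and \<open>h11\<close> is the whole trace.\<close>

lemma shape_in_factor:
  fixes pr pr' :: "pt \<Rightarrow> real^3"
  assumes pr: "(pr = fst \<and> pr' = snd \<and> C = 1) \<or> (pr = snd \<and> pr' = fst \<and> C = -1)"
    and c: "chart M U \<phi>" "u \<in> U"
  shows "lor (pr (frechet_derivative (N \<circ> \<phi>) (at u) v)) (lcross (pr (\<phi> u)) (pr (N (\<phi> u))))
    = - (k1 + k2 + k3) * lor (pr (frechet_derivative \<phi> (at u) v)) (lcross (pr (\<phi> u)) (pr (N (\<phi> u))))"
proof -
  define x where "x = \<phi> u"
  have x: "x \<in> M" "\<phi> u = x" using chartD(2)[OF c] by (auto simp: x_def)
  define t where "t = lcross (pr x) (pr (N x))"
  note F = normal_in_factor[OF pr x(1), folded t_def]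
  have "((\<lambda>u. pr' (N (\<phi> u))) has_derivative (\<lambda>v. pr' (frechet_derivative (N \<circ> \<phi>) (at u) v))) (at u)"
    using pr chartD(6)[OF c] by (auto intro: has_derivative_fst has_derivative_snd)
  then have z: "pr' (frechet_derivative (N \<circ> \<phi>) (at u) v) = 0" for v
    using has_derivative_const_on_open[OF chartD(1)[OF c] c(2), of "\<lambda>u. pr' (N (\<phi> u))" 0]
      normal_in_factor(1)[OF pr chartD(2)[OF c(1)]] by blast
  have H2': "pr' x \<in> H2" using pr M_H2[OF x(1)] by auto
  obtain m where m: "lor (pr' x) m = 0" "lor m m = 1" using ex_unit_tangent[OF H2'] by blast
  define s where "s = lcross (pr' x) m"
  have G: "lframe (pr' x) m s" unfolding s_def by (rule lframe_lcross[OF H2D[OF H2'] m(2,1)])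
  have FD: "lframe (pr x) (pr (N x)) t" using F(2) .
  have "\<exists>E1 E2 E3. tframe N x E1 E2 E3 \<and> (\<forall>Y. pmetric Y E1 = lor (pr Y) t) \<and>
      (\<forall>Y. pr' Y = 0 \<longrightarrow> pmetric Y E2 = 0 \<and> pmetric Y E3 = 0)"
    using pr
  proof (elim disjE conjE)
    assume p: "pr = fst" "pr' = snd"
    have "tframe N x (t, 0) (0, s) (0 *\<^sub>R fst (N x), - 1 *\<^sub>R m)"
    proof (rule tframe_of_lframes)
      show "lframe (fst x) (fst (N x)) t" "lframe (snd x) m s" using FD G p by auto
      show "N x = (1 *\<^sub>R fst (N x), 0 *\<^sub>R m)" using F(1) p by (simp add: prod_eq_iff)
    qed auto
    then show ?thesis
      using p by (intro exI[of _ "(t, 0)"] exI[of _ "(0, s)"] exI[of _ "(0, - m)"]) (auto simp: pmetric_def lor_simps)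
  next
    assume p: "pr = snd" "pr' = fst"
    have tf: "tframe N x (s, 0) (0, t) (1 *\<^sub>R m, - 0 *\<^sub>R snd (N x))"
    proof (rule tframe_of_lframes)
      show "lframe (fst x) m s" "lframe (snd x) (snd (N x)) t" using FD G p by auto
      show "N x = (0 *\<^sub>R m, 1 *\<^sub>R snd (N x))" using F(1) p by (simp add: prod_eq_iff)
    qed auto
    have "tframe N x (0, t) (s, 0) (m, 0)"
      using tf unfolding tframe_def by (simp add: pmetric_commute add.commute add.left_commute)
    then show ?thesis
      using p by (intro exI[of _ "(0, t)"] exI[of _ "(s, 0)"] exI[of _ "(m, 0)"]) (auto simp: pmetric_def lor_simps)
  qed
  then obtain E1 E2 E3 where E: "tframe N x E1 E2 E3" "\<And>Y. pmetric Y E1 = lor (pr Y) t"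
      "\<And>Y. pr' Y = 0 \<Longrightarrow> pmetric Y E2 = 0 \<and> pmetric Y E3 = 0" by blast
  obtain h11 h12 h13 h22 h23 h33 where H:
    "\<And>U \<phi> u v. \<lbrakk>chart M U \<phi>; u \<in> U; \<phi> u = x\<rbrakk> \<Longrightarrow>
       (let X = frechet_derivative \<phi> (at u) v; Y = frechet_derivative (N \<circ> \<phi>) (at u) v in
        pmetric Y E1 = - (h11 * pmetric X E1 + h12 * pmetric X E2 + h13 * pmetric X E3) \<and>
        pmetric Y E2 = - (h12 * pmetric X E1 + h22 * pmetric X E2 + h23 * pmetric X E3) \<and>
        pmetric Y E3 = - (h13 * pmetric X E1 + h23 * pmetric X E2 + h33 * pmetric X E3))"
    and tr: "h11 + h22 + h33 = k1 + k2 + k3"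
    by (rule shape_matrix[OF x(1) E(1)]) (rule that; assumption)
  define X where "X v = frechet_derivative \<phi> (at u) v" for v
  define Y where "Y v = frechet_derivative (N \<circ> \<phi>) (at u) v" for v
  have row: "pmetric (Y v) E1 = - (h11 * pmetric (X v) E1 + h12 * pmetric (X v) E2 + h13 * pmetric (X v) E3)"
    "0 = - (h12 * pmetric (X v) E1 + h22 * pmetric (X v) E2 + h23 * pmetric (X v) E3)"
    "0 = - (h13 * pmetric (X v) E1 + h23 * pmetric (X v) E2 + h33 * pmetric (X v) E3)" for v
    using H[OF c x(2), of v] E(3)[OF z[of v]] by (simp_all add: Let_def X_def Y_def)
  note co = ex_coords[OF c, unfolded x(2), OF E(1), folded X_def]
  obtain v1 v2 v3 where v: "pmetric (X v1) E1 = 1" "pmetric (X v1) E2 = 0" "pmetric (X v1) E3 = 0"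
    "pmetric (X v2) E1 = 0" "pmetric (X v2) E2 = 1" "pmetric (X v2) E3 = 0"
    "pmetric (X v3) E1 = 0" "pmetric (X v3) E2 = 0" "pmetric (X v3) E3 = 1"
    using co[of 1 0 0] co[of 0 1 0] co[of 0 0 1] by blast
  have h0: "h12 = 0" "h13 = 0" "h22 = 0" "h33 = 0"
    using row(2)[of v1] row(3)[of v1] row(2)[of v2] row(3)[of v3] by (simp_all add: v)
  then have "lor (pr (Y v)) t = - (k1 + k2 + k3) * lor (pr (X v)) t"
    using row(1)[of v] tr unfolding E(2) by (simp add: algebra_simps)
  then show ?thesis unfolding X_def Y_def t_def x_def .
qed

lemma product_case:
  fixes pr pr' :: "pt \<Rightarrow> real^3"
  assumes pr: "(pr = fst \<and> pr' = snd \<and> C = 1) \<or> (pr = snd \<and> pr' = fst \<and> C = -1)" and "M \<noteq> {}"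
  shows "\<exists>f. isometry f \<and> (\<exists>G. const_curv_curve G \<and> open_part (f ` M) (M_Gamma G))"
proof -
  obtain x0 where x0: "x0 \<in> M" using \<open>M \<noteq> {}\<close> by blast
  define \<alpha> where "\<alpha> = - (k1 + k2 + k3)"
  \<comment> \<open>\<open>p\<close> and its normal both move along \<open>t\<close>, with speeds in
    the ratio \<alpha>, so \<open>w\<close> is constant; the plane section
    \<open>lor x w = - \<alpha>\<close> is the curve sought.\<close>
  define w where "w x = \<alpha> *\<^sub>R pr x - pr (N x)" for x
  note F = normal_in_factor[OF pr]
  have pr_lin: "bounded_linear pr" using pr bounded_linear_fst bounded_linear_snd by metis
  have w: "w x = w x0" if x: "x \<in> M" for x
  proof (rule chart_zero_derivative_imp_constant[OF hyp conn _ x x0])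
    fix U \<phi> u assume c: "chart M U \<phi>" "u \<in> U"
    note cd = chartD[OF c]
    define X where "X v = frechet_derivative \<phi> (at u) v" for v
    define Y where "Y v = frechet_derivative (N \<circ> \<phi>) (at u) v" for v
    define p where "p = pr (\<phi> u)"
    define n where "n = pr (N (\<phi> u))"
    define t where "t = lcross p n"
    have Fr: "lframe p n t" using F(2)[OF cd(2)] by (simp add: p_def n_def t_def)
    have dp: "((\<lambda>u. pr (\<phi> u)) has_derivative (\<lambda>v. pr (X v))) (at u)"
      unfolding X_def by (rule bounded_linear.has_derivative[OF pr_lin cd(4)])
    have dn: "((\<lambda>u. pr (N (\<phi> u))) has_derivative (\<lambda>v. pr (Y v))) (at u)"
      unfolding Y_def by (rule bounded_linear.has_derivative[OF pr_lin cd(6)])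
    have tan: "lor p (pr (X v)) = 0" "lor n (pr (X v)) = 0" for v
      using tangential_derivative[OF c, of v] pr F(1)[OF cd(2)]
      by (auto simp: tangential_def X_def p_def n_def pmetric_def lor_simps)
    have Xv: "pr (X v) = lor (pr (X v)) t *\<^sub>R t" for v
      using lframe_expand[OF Fr, of "pr (X v)"] tan[of v] by (simp add: lor_commute)
    have "lor (pr (N (\<phi> u))) (pr (N (\<phi> u))) = 1" "lor (pr (\<phi> u)) (pr (N (\<phi> u))) = 0" if "u \<in> U" for u
      using lframeD[OF F(2)[OF chartD(2)[OF c(1) that]]] by auto
    then have "lor n (pr (Y v)) + lor (pr (Y v)) n = 0" "lor p (pr (Y v)) + lor (pr (X v)) n = 0" for v
      using has_derivative_const_on_open[OF cd(1) c(2) _ lor.FDERIV[OF dn dn]]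
        has_derivative_const_on_open[OF cd(1) c(2) _ lor.FDERIV[OF dp dn]] unfolding n_def p_def by blast+
    then have "lor (pr (Y v)) n = 0" "lor (pr (Y v)) p = 0" for v
      using tan[of v] lor_commute by (metis add.right_neutral mult_2 mult_eq_0_iff zero_neq_numeral)+
    then have Yv: "pr (Y v) = lor (pr (Y v)) t *\<^sub>R t" for v
      using lframe_expand[OF Fr, of "pr (Y v)"] by simp
    have "lor (pr (Y v)) t = \<alpha> * lor (pr (X v)) t" for v
      using shape_in_factor[OF pr c, of v] by (simp add: X_def Y_def \<alpha>_def t_def n_def p_def)
    then have "\<alpha> *\<^sub>R pr (X v) - pr (Y v) = 0" for v
      by (subst Xv, subst Yv) simp
    moreover have "((\<lambda>u. w (\<phi> u)) has_derivative (\<lambda>v. \<alpha> *\<^sub>R pr (X v) - pr (Y v))) (at u)"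
      unfolding w_def by (intro has_derivative_diff has_derivative_scaleR_right dp dn)
    ultimately show "((\<lambda>u. w (\<phi> u)) has_derivative (\<lambda>_. 0)) (at u)" by simp
  qed
  have H: "pr x \<in> H2" "pr' x \<in> H2" if "x \<in> M" for x using pr M_H2[OF that] by auto
  define G where "G = {x \<in> H2. lor x (w x0) = - \<alpha>}"
  have G: "const_curv_curve G"
    unfolding G_def w_def by (rule const_curv_curve_level[OF H(1)[OF x0] F(2)[OF x0]])
  have prG: "pr x \<in> G" if "x \<in> M" for x
    using H[OF that] lframeD[OF F(2)[OF that]] unfolding G_def w[OF that, symmetric] by (simp add: w_def lor_simps)
  \<comment> \<open>\<open>open_part_image\<close> wants the linear constraint on the second
    component, so the curve factor is placed last here and swapped to the front by
    \<open>f\<close>.\<close>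
  define g where "g x = (pr' x, pr x)" for x
  have g: "g = id \<or> g = prod.swap" using pr by (auto simp: g_def fun_eq_iff)
  have gi: "isometry g" "continuous_on UNIV g"
    using g isometry_id isometry_swap
    by (auto simp: prod.swap_def intro!: continuous_intros simp del: id_apply) 
  have og: "open_part (g ` M) {(y, x). y \<in> H2 \<and> x \<in> G}"
  proof (rule open_part_image[OF hyp gi(2) isometry_inj[OF gi(1)], where W = "\<lambda>_. w x0"])
    show "g ` M \<subseteq> {(y, x). y \<in> H2 \<and> x \<in> G}" using H prG by (auto simp: g_def)
    fix p q assume "(p, q) \<in> g ` M"
    then obtain x where x: "x \<in> M" "q = pr x" by (auto simp: g_def)
    have "lcross (w x0) q = lcross q (pr (N x))"
      unfolding w[OF x(1), symmetric] x(2) by (simp add: w_def vec3_eq_iff algebra_simps)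
    moreover have "lor (lcross q (pr (N x))) (lcross q (pr (N x))) = 1"
      using lframeD[OF F(2)[OF x(1)]] x(2) by simp
    ultimately show "lcross (w x0) q \<noteq> 0" by (auto simp: lor_simps)
  qed (auto simp: G_def)
  define f where "f = prod.swap \<circ> g"
  have fi: "isometry f"
    using g isometry_id isometry_swap by (auto simp: f_def o_def id_def)
  have "open_part (f ` M) (M_Gamma G)"
  proof -
    have sw: "prod.swap ` (A \<inter> B) = prod.swap ` A \<inter> prod.swap ` B" for A B :: "pt set"
      by (rule image_Int) auto
    obtain S where S: "open S" "g ` M = {(y, x). y \<in> H2 \<and> x \<in> G} \<inter> S"
      using og by (auto simp: open_part_def openin_open)
    have "prod.swap ` S = prod.swap -` S" by force
    then have "open (prod.swap ` S)"
      using open_vimage[OF S(1), of prod.swap] by (simp add: continuous_on_swap)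
    moreover have "prod.swap ` {(y, x). y \<in> H2 \<and> x \<in> G} = M_Gamma G"
      by (force simp: M_Gamma_def)
    then have "f ` M = M_Gamma G \<inter> prod.swap ` S"
      unfolding f_def image_comp[symmetric] S(2) sw by simp
    ultimately show ?thesis by (auto simp: open_part_def openin_open)
  qed
  then show ?thesis using fi G by blast
qed

end

section \<open>The classification\<close>

theorem theorem1p1:
  fixes M :: "pt set" and N :: "pt \<Rightarrow> pt"
  assumes "hypersurface M"
    and "connected M"
    and "unit_normal M N"
    and "const_principal_curvatures M N"
    and "\<exists>C. \<forall>p\<in>M. pmetric (Pstr (N p)) (N p) = C"
  shows "\<exists>f. isometry f \<and>
    ((\<exists>G. const_curv_curve G \<and> open_part (f ` M) (M_Gamma G))
     \<or> (\<exists>c. 0 < c \<and> c < 1 \<and> open_part (f ` M) (M_c_1m1 c))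
     \<or> (\<exists>c. 0 < c \<and> c < 1 \<and> open_part (f ` M) (M_c_11 c))
     \<or> (\<exists>\<tau>. \<tau> < -1 \<and> open_part (f ` M) (M_tau \<tau>)))"
proof (cases "M = {}")
  case True
  \<comment> \<open>The empty set is an open part of every model; the value \<open>-2\<close> is
    arbitrary.\<close>
  have "isometry id \<and> (-2::real) < -1 \<and> open_part (id ` M) (M_tau (-2))"
    using True isometry_id by (simp add: open_part_def)
  then show ?thesis by blast
next
  case False
  obtain k1 k2 k3 where k: "\<forall>p\<in>M. \<exists>e1 e2 e3.
     pmetric e1 e1 = 1 \<and> pmetric e2 e2 = 1 \<and> pmetric e3 e3 = 1 \<and>
     pmetric e1 e2 = 0 \<and> pmetric e1 e3 = 0 \<and> pmetric e2 e3 = 0 \<and>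
     principal_dir M N p k1 e1 \<and> principal_dir M N p k2 e2 \<and> principal_dir M N p k3 e3"
    using assms(4) unfolding const_principal_curvatures_def by blast
  obtain C where C: "\<forall>p\<in>M. pmetric (Pstr (N p)) (N p) = C" using assms(5) by blast
  interpret cpc_hypersurface M N C k1 k2 k3
    using assms(1-3) k C by unfold_locales blast+
  obtain x0 where x0: "x0 \<in> M" using False by blast
  have "(1 + C) / 2 \<ge> 0" "(1 - C) / 2 \<ge> 0"
    using H2_tangent_spacelike(1)[OF M_H2(1)[OF x0] N_orth(1)[OF x0]]
      H2_tangent_spacelike(1)[OF M_H2(2)[OF x0] N_orth(2)[OF x0]] N_norms[OF x0] by simp_all
  then have "-1 \<le> C" "C \<le> 1" by simp_all
  then consider "C = 1" | "C = -1" | "-1 < C" "C < 1" by (metis order_le_less)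
  then show ?thesis
  proof cases
    case 1
    then show ?thesis using product_case[of fst snd] False by blast
  next
    case 2
    then show ?thesis using product_case[of snd fst] False by blast
  next
    case 3
    then interpret cpc_generic M N C k1 k2 k3 by unfold_locales
    obtain al mu de where s: "\<forall>x\<in>M. shape_at x (al x) (mu x) (de x) \<and> b * al x + a * de x = - (k1 + k2 + k3)
      \<and> b\<^sup>2 * (al x)\<^sup>2 + a\<^sup>2 * (de x)\<^sup>2 + 2 * a\<^sup>2 * b\<^sup>2 * (mu x)\<^sup>2 = k1\<^sup>2 + k2\<^sup>2 + k3\<^sup>2"
      using ex_shape by metis
    interpret cpc_shape M N C k1 k2 k3 al mu de
      using False s by unfold_locales auto
    show ?thesis
      using alternative
    proof (elim disjE conjE exE)
      assume "\<forall>x\<in>M. mu x = 0 \<and> (al x)\<^sup>2 = 1 \<and> (de x)\<^sup>2 = 1"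
      then show ?thesis using horocyclic_case by blast
    next
      fix A assume "a = b" "\<forall>x\<in>M. mu x \<noteq> 0 \<and> al x = A \<and> de x = A \<and> A\<^sup>2 = 1 + (mu x)\<^sup>2 / 2"
      then show ?thesis using equidistant_case by blast
    qed
  qed
qed

end
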